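(* Let $1\le k\le n+1$, let $f\in\mathcal F_+^{k:n}$, let $z\in(a,b)$, and for $y\in(a,z]$ let $g_y$ be the function on $I$ constructed from $f,z,y$ in the context. Then $$g_y\nearrow f\ \text{ on } I\cap[z,\infty)\quad\text{and}\quad (-1)^k(f-g_y)\searrow 0\ \text{ on } I\cap(-\infty,z]\qquad\text{as } y\downarrow a,$$ where $\nearrow$ and $\searrow$ mean monotone pointwise convergence: on $I\cap[z,\infty)$ the values $g_y(x)$ are nondecreasing as $y$ decreases to $a$, with limit $f(x)$; on $I\cap(-\infty,z]$ the values $(-1)^k(f-g_y)(x)$ are nonincreasing as $y$ decreases to $a$, with limit $0$.
   Context: Indices $i,j,k,m,n$ are nonnegative integers unless specified otherwise. $I\subseteq\mathbb R$ is an interval of nonzero length, $a=\inf I$, $b=\sup I$ ($-\infty\le a<b\le\infty$). $\mathcal B$ is the set of Borel-measurable functions $I\to\mathbb R$; $\mathcal B^+=\{w\in\mathcal B: w>0\}$. $\mathcal{RC}$ is the set of functions $I\to\mathbb R$ that are right-continuous on $I\setminus\{b\}$ and, if $b\in I$, left-continuous at $b$. For $w\in\mathcal B^+$, $\mathcal{RC}_w=\{f\in\mathcal B: f/w\in\mathcal{RC}\}$, and $\mathcal S_w$ is the set of $f\in\mathcal B$ for which there is a function $D_wf\in\mathcal{RC}_w$ (necessarily unique) with $f(x)=f(z)+\int_z^x(D_wf)(u)\,du$ for all $x,z\in I$ (with $\int_z^x=-\int_x^z$ if $x<z$). Fix a sequence $\mathbf w=(w_0,w_1,\dots)$ of gauge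 functions in $\mathcal B^+$, each bounded on every compact subset of $I$. Put $\mathcal S^0=\mathcal B$, $f^{(0)}=f/w_0$, and recursively for $j\ge1$: $\mathcal S^j=\{f\in\mathcal S^{j-1}: f^{(j-1)}\in\mathcal S_{w_j}\}$ and $f^{(j)}=(D_{w_j}f^{(j-1)})/w_j$ for $f\in\mathcal S^j$. For integers $j\ge-1$, $\mathcal P^{\le j}=\{p\in\mathcal S^{j+1}: p^{(j+1)}=0\}$. $\mathcal F_+^{k:n}$ is the set of $f\in\mathcal S^n$ such that $f^{(j)}$ is nondecreasing on $I$ for each $j\in\{k-1,\dots,n\}$. For $t\in I\cup\{a\}$ and $j\le m$ define $p_{t;j,m}:I\to(-\infty,\infty]$ by $p_{t;m,m}=w_m$ and $p_{t;j,m}(x)=w_j(x)\int_{t+}^{x}p_{t;j+1,m}(u)\,du$ for $j<m$ (real-valued if $t\in I$; if $t=a\notin I$, then $p_{a;j,m}$ is either finite everywhere on $I$ or $\infty$ everywhere on $I$). Put $p_{t;j,m}^+(x)=p_{t;j,m}(x)$ if $x\ge t$ and $0$ if $x<t$. Let $F_{k,n}=\{j: k\le j\le n,\ p_{a;k,j}<\infty\}$ (empty if $k=n+1$). For $j\in F_{k,n}$ and $0\le i\le k$ let $p_{a,z;k:k:j}=p_{a;k,j}$ and $p_{a,z;i:k:j}(x)=w_i(x)\int_z^x p_{a,z;i+1:k:j}(u)\,du$ for $i<k$. Construction of $g_y$: for $j\in\{k,\dots,n\}$ let $f^{(j)}(a+)=\lim_{x\downarrow a}f^{(j)}(x)\in[0,\infty)$,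 which exists. Let $$\tilde g_y=\sum_{j\in F_{k,n}}f^{(j)}(a+)\,p_{a,z;0:k:j}+\int_{I\cap[y,\infty)}df^{(n)}(t)\,p_{t;0,n}^+$$ (the integral is pointwise, with respect to the nonnegative Lebesgue--Stieltjes measure of the nondecreasing function $f^{(n)}$; a sum over the empty set is $0$). Let $q_{k;z,y}$ be the unique element of $\mathcal P^{\le k-1}$ with $(q_{k;z,y})^{(i)}(z)=(f-\tilde g_y)^{(i)}(z)$ for all $i\in\{0,\dots,k-1\}$. Then $g_y=q_{k;z,y}+\tilde g_y$.
   Formalization: For n = 0 (so k = 1), f^(0) = f/w_0 is additionally assumed right-continuous on I; without it the claim fails, e.g. I = R, w_j = 1, f = 1_{(0,∞)}, z = −1, where g_y(0) = 1 > f(0) = 0. For n ≥ 1 nothing is added. *)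

theory Defs
  imports "HOL-Analysis.Analysis"
begin

text \<open>Functions \<open>I \<rightarrow> \<real>\<close> are represented by total functions of which only the restriction
  to \<open>I\<close> matters. Objects singled out by uniqueness on \<open>I\<close> are made unique as HOL functions by
  requiring them to be \<^const>\<open>extensional\<close> on \<open>I\<close>.\<close>

definition left_end :: "real set \<Rightarrow> ereal" where
  "left_end I = (INF x\<in>I. ereal x)"

definition right_end :: "real set \<Rightarrow> ereal" where
  "right_end I = (SUP x\<in>I. ereal x)"

text \<open>The filter \<open>x \<down> a\<close> for real \<open>x\<close>, where \<open>a = inf I\<close> may be \<open>-\<infinity>\<close>.\<close>

definition down_to_left_end :: "real set \<Rightarrow> real filter" where
  "down_to_left_end I =
     (if left_end I = -\<infinity> then at_bot else at_right (real_of_ereal (left_end I)))"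

definition Bor :: "real set \<Rightarrow> (real \<Rightarrow> real) set" where
  "Bor I = borel_measurable (restrict_space borel I)"

definition Bor_pos :: "real set \<Rightarrow> (real \<Rightarrow> real) set" where
  "Bor_pos I = {v \<in> Bor I. \<forall>x\<in>I. 0 < v x}"

definition RC :: "real set \<Rightarrow> (real \<Rightarrow> real) set" where
  "RC I = {f. (\<forall>x\<in>I. ereal x \<noteq> right_end I \<longrightarrow> continuous (at_right x) f) \<and>
              (\<forall>x\<in>I. ereal x = right_end I \<longrightarrow> continuous (at_left x) f)}"

definition RC_wt :: "real set \<Rightarrow> (real \<Rightarrow> real) \<Rightarrow> (real \<Rightarrow> real) set" where
  "RC_wt I v = {f \<in> Bor I. (\<lambda>x. f x / v x) \<in> RC I}"

text \<open>Functions in \<^term>\<open>RC_wt I v\<close> need not be locally integrable, and the integral of a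
  non-integrable function is \<open>0\<close> in HOL; so integrability is required explicitly.\<close>

definition is_wt_density :: "real set \<Rightarrow> (real \<Rightarrow> real) \<Rightarrow> (real \<Rightarrow> real) \<Rightarrow> (real \<Rightarrow> real) \<Rightarrow> bool" where
  "is_wt_density I v f D \<longleftrightarrow> D \<in> RC_wt I v \<and>
     (\<forall>x\<in>I. \<forall>z\<in>I. interval_lebesgue_integrable lborel (ereal z) (ereal x) D \<and>
        f x = f z + (LBINT u=ereal z..ereal x. D u))"

definition S_wt :: "real set \<Rightarrow> (real \<Rightarrow> real) \<Rightarrow> (real \<Rightarrow> real) set" where
  "S_wt I v = {f \<in> Bor I. \<exists>D. is_wt_density I v f D}"

definition D_wt :: "real set \<Rightarrow> (real \<Rightarrow> real) \<Rightarrow> (real \<Rightarrow> real) \<Rightarrow> real \<Rightarrow> real" where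
  "D_wt I v f = (THE D. D \<in> extensional I \<and> is_wt_density I v f D)"

text \<open>\<open>f\<^sup>(\<^sup>j\<^sup>)\<close> is \<open>wderiv I w f j\<close>.\<close>

primrec wderiv :: "real set \<Rightarrow> (nat \<Rightarrow> real \<Rightarrow> real) \<Rightarrow> (real \<Rightarrow> real) \<Rightarrow> nat \<Rightarrow> real \<Rightarrow> real" where
  "wderiv I w f 0 = (\<lambda>x. f x / w 0 x)"
| "wderiv I w f (Suc j) = (\<lambda>x. D_wt I (w (Suc j)) (wderiv I w f j) x / w (Suc j) x)"

primrec S_cls :: "real set \<Rightarrow> (nat \<Rightarrow> real \<Rightarrow> real) \<Rightarrow> nat \<Rightarrow> (real \<Rightarrow> real) set" where
  "S_cls I w 0 = Bor I"
| "S_cls I w (Suc j) = {f \<in> S_cls I w j. wderiv I w f j \<in> S_wt I (w (Suc j))}"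

text \<open>The index \<open>j\<close> ranges over the integers \<open>\<ge> -1\<close>.\<close>

definition P_le :: "real set \<Rightarrow> (nat \<Rightarrow> real \<Rightarrow> real) \<Rightarrow> int \<Rightarrow> (real \<Rightarrow> real) set" where
  "P_le I w j = {p \<in> S_cls I w (nat (j + 1)). \<forall>x\<in>I. wderiv I w p (nat (j + 1)) x = 0}"

definition F_plus :: "real set \<Rightarrow> (nat \<Rightarrow> real \<Rightarrow> real) \<Rightarrow> nat \<Rightarrow> nat \<Rightarrow> (real \<Rightarrow> real) set" where
  "F_plus I w k n = {f \<in> S_cls I w n. \<forall>j\<in>{k - 1..n}. mono_on I (wderiv I w f j)}"

text \<open>Lebesgue integral of an extended-real-valued function: positive part minus negative part
  (\<^const>\<open>e2ennreal\<close> maps negative numbers to \<open>0\<close>), and its oriented version.\<close>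

definition ext_integral :: "real set \<Rightarrow> (real \<Rightarrow> ereal) \<Rightarrow> ereal" where
  "ext_integral A h = enn2ereal (\<integral>\<^sup>+u\<in>A. e2ennreal (h u) \<partial>lborel)
                    - enn2ereal (\<integral>\<^sup>+u\<in>A. e2ennreal (- h u) \<partial>lborel)"

definition ext_integral_from_to :: "ereal \<Rightarrow> ereal \<Rightarrow> (real \<Rightarrow> ereal) \<Rightarrow> ereal" where
  "ext_integral_from_to t x h =
     (if t \<le> x then ext_integral (einterval t x) h else - ext_integral (einterval x t) h)"

text \<open>\<open>p\<^bsub>t;j,m\<^esub>(x)\<close> for \<open>j \<le> m\<close>, where \<open>t\<close> is a point of \<open>I\<close> or the (possibly infinite) left
  endpoint of \<open>I\<close>.\<close>

function p_fun :: "(nat \<Rightarrow> real \<Rightarrow> real) \<Rightarrow> ereal \<Rightarrow> nat \<Rightarrow> nat \<Rightarrow> real \<Rightarrow> ereal" where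
  "p_fun w t j m =
     (if j < m
      then (\<lambda>x. ereal (w j x) * ext_integral_from_to t (ereal x) (p_fun w t (Suc j) m))
      else (\<lambda>x. ereal (w m x)))"
  by pat_completeness auto
termination by (relation "Wellfounded.measure (\<lambda>(w, t, j, m). m - j)") auto

declare p_fun.simps [simp del]

definition p_plus :: "(nat \<Rightarrow> real \<Rightarrow> real) \<Rightarrow> ereal \<Rightarrow> nat \<Rightarrow> nat \<Rightarrow> real \<Rightarrow> ereal" where
  "p_plus w t j m x = (if t \<le> ereal x then p_fun w t j m x else 0)"

definition F_idx :: "real set \<Rightarrow> (nat \<Rightarrow> real \<Rightarrow> real) \<Rightarrow> nat \<Rightarrow> nat \<Rightarrow> nat set" where
  "F_idx I w k n = {j \<in> {k..n}. \<forall>x\<in>I. p_fun w (left_end I) k j x < \<infinity>}"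

text \<open>\<open>p\<^bsub>a,z;i:k:j\<^esub>\<close> for \<open>i \<le> k\<close> and \<open>j \<in> F_idx I w k n\<close>; the latter makes \<open>p\<^bsub>a;k,j\<^esub>\<close> finite
  on \<open>I\<close>.\<close>

function p_az :: "real set \<Rightarrow> (nat \<Rightarrow> real \<Rightarrow> real) \<Rightarrow> real \<Rightarrow> nat \<Rightarrow> nat \<Rightarrow> nat \<Rightarrow> real \<Rightarrow> real" where
  "p_az I w z i k j =
     (if i < k
      then (\<lambda>x. w i x * (LBINT u=ereal z..ereal x. p_az I w z (Suc i) k j u))
      else (\<lambda>x. real_of_ereal (p_fun w (left_end I) k j x)))"
  by pat_completeness auto
termination by (relation "Wellfounded.measure (\<lambda>(I, w, z, i, k, j). k - i)") auto

declare p_az.simps [simp del]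

text \<open>The Lebesgue--Stieltjes measure on \<open>I\<close> of a nondecreasing right-continuous \<open>F\<close> on \<open>I\<close>,
  viewed as a Borel measure on \<open>\<real>\<close>. It differs from \<^const>\<open>interval_measure\<close> in that \<open>F\<close> may be
  unbounded near a finite endpoint not in \<open>I\<close>, in which case it has no nondecreasing extension to \<open>\<real>\<close>.
  The values on \<open>{c<..d}\<close> leave open only the mass of \<open>{inf I}\<close> when \<open>inf I \<in> I\<close>; it is taken
  to be \<open>0\<close> (and is not used below).\<close>

definition LS_measure :: "real set \<Rightarrow> (real \<Rightarrow> real) \<Rightarrow> real measure" where
  "LS_measure I F = (THE M. sets M = sets borel \<and>
     (\<forall>c\<in>I. \<forall>d\<in>I. c \<le> d \<longrightarrow> emeasure M {c<..d} = ennreal (F d - F c)) \<and>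
     emeasure M (- {x \<in> I. left_end I < ereal x}) = 0)"

definition g_tilde ::
  "real set \<Rightarrow> (nat \<Rightarrow> real \<Rightarrow> real) \<Rightarrow> nat \<Rightarrow> nat \<Rightarrow> (real \<Rightarrow> real) \<Rightarrow> real \<Rightarrow> real \<Rightarrow> real \<Rightarrow> real" where
  "g_tilde I w k n f z y x =
     (\<Sum>j\<in>F_idx I w k n. Lim (down_to_left_end I) (wderiv I w f j) * p_az I w z 0 k j x) +
     (LINT t:I \<inter> {y..}|LS_measure I (wderiv I w f n). real_of_ereal (p_plus w (ereal t) 0 n x))"

definition q_fun ::
  "real set \<Rightarrow> (nat \<Rightarrow> real \<Rightarrow> real) \<Rightarrow> nat \<Rightarrow> nat \<Rightarrow> (real \<Rightarrow> real) \<Rightarrow> real \<Rightarrow> real \<Rightarrow> real \<Rightarrow> real" where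
  "q_fun I w k n f z y =
     (THE q. q \<in> extensional I \<and> q \<in> P_le I w (int k - 1) \<and>
        (\<forall>i<k. wderiv I w q i z = wderiv I w (\<lambda>x. f x - g_tilde I w k n f z y x) i z))"

definition g_fun ::
  "real set \<Rightarrow> (nat \<Rightarrow> real \<Rightarrow> real) \<Rightarrow> nat \<Rightarrow> nat \<Rightarrow> (real \<Rightarrow> real) \<Rightarrow> real \<Rightarrow> real \<Rightarrow> real \<Rightarrow> real" where
  "g_fun I w k n f z y x = q_fun I w k n f z y x + g_tilde I w k n f z y x"

end

theory Submission
  imports Defs
begin

text \<open>
  Let \<open>r = f - g\<^sub>y\<close>. By construction \<open>r\<^sup>(\<^sup>i\<^sup>)(z) = 0\<close> for \<open>i < k\<close>, so \<open>r\<close> is recovered from a single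
  function by \<open>k\<close> iterated weighted integrations from \<open>z\<close> (the first of them being trivial if
  \<open>k = n + 1\<close>). Each integration preserves sign, monotonicity in \<open>y\<close> and (by dominated convergence)
  the limit \<open>0\<close> to the right of \<open>z\<close>, and does the same with reversed sign to the left of \<open>z\<close>; this
  produces the factor \<open>(-1)\<^sup>k\<close>.

  For \<open>k \<le> n\<close> the function to start from is \<open>r\<^sup>(\<^sup>k\<^sup>)\<close>. All functions involved are nonnegative, so
  Taylor's formula at the left endpoint and Tonelli's theorem hold in \<open>[0, \<infinity>]\<close>:
  \<open>w\<^sub>k f\<^sup>(\<^sup>k\<^sup>) = (\<Sum>j=k..n. f\<^sup>(\<^sup>j\<^sup>)(a+) p\<^bsub>a;k,j\<^esub>) + \<integral> p\<^sup>+\<^bsub>t;k,n\<^esub> df\<^sup>(\<^sup>n\<^sup>)(t)\<close>. The left-hand side is finite, hence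
  \<open>f\<^sup>(\<^sup>j\<^sup>)(a+) = 0\<close> for \<open>j \<notin> F\<^bsub>k,n\<^esub>\<close>, and \<open>w\<^sub>k r\<^sup>(\<^sup>k\<^sup>)\<close> is the part of the integral over \<open>t < y\<close>. For \<open>k = n + 1\<close> one
  starts from \<open>r\<^sup>(\<^sup>n\<^sup>)(x)\<close>, which is minus the mass of \<open>(x, y)\<close> under \<open>df\<^sup>(\<^sup>n\<^sup>)\<close>.
\<close>

section \<open>Intervals, local integrability and weighted densities\<close>

text \<open>Derivatives and \<open>q_fun\<close> are definite descriptions, which cannot be computed
  with directly. The work is done on towers, explicit sequences G_0, G_1, ... in which w_(j+1)
  G_(j+1) is a density of G_j; uniqueness of densities turns a tower into the sequence of
  derivatives. Two kinds of integration are kept apart. Those from the left endpoint a may be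
  infinite but are nonnegative and live in \<open>ennreal\<close>; those from z are signed, run over
  compact parts of I, where the weights are bounded, and live in the reals.
  \<open>nn_prim_real\<close> links them. The obstacle is the case k = n + 1: f^(n) need not have a
  derivative, so there is no r^(k). Both cases are therefore brought to one statement about r^(k-1),
  with sign exponent 1, and the remaining k - 1 integrations are common. A Lebesgue-Stieltjes
  measure presupposes right-continuity of f^(n). For n > 0 this comes from \<open>RC\<close>; for n
  = 0 the class S^0 contains all Borel functions, and it is assumed. Limits are taken along a
  sequence of knots y; monotonicity in y extends them to the filter.\<close>

definition loc_integrable :: "real set \<Rightarrow> (real \<Rightarrow> real) \<Rightarrow> bool" where
  "loc_integrable I \<phi> \<longleftrightarrow>
     (\<forall>x\<in>I. \<forall>z\<in>I. interval_lebesgue_integrable lborel (ereal z) (ereal x) \<phi>)"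

lemma is_wt_densityD:
  assumes "is_wt_density I v g D"
  shows "D \<in> Bor I" "(\<lambda>x. D x / v x) \<in> RC I" "loc_integrable I D"
    and "x \<in> I \<Longrightarrow> z \<in> I \<Longrightarrow> g x = g z + (LBINT u=ereal z..ereal x. D u)"
  using assms unfolding is_wt_density_def RC_wt_def loc_integrable_def by blast+

lemma is_wt_densityI:
  assumes "D \<in> Bor I" "(\<lambda>x. D x / v x) \<in> RC I" "loc_integrable I D"
    and "\<And>x z. x \<in> I \<Longrightarrow> z \<in> I \<Longrightarrow> g x = g z + (LBINT u=ereal z..ereal x. D u)"
  shows "is_wt_density I v g D"
  using assms unfolding is_wt_density_def RC_wt_def loc_integrable_def by blast

locale nontrivial_interval =
  fixes I :: "real set"
  assumes interval: "is_interval I" and nontrivial: "\<exists>x\<in>I. \<exists>y\<in>I. x < y"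
begin

lemma between_mem: "c \<in> I \<Longrightarrow> d \<in> I \<Longrightarrow> c \<le> x \<Longrightarrow> x \<le> d \<Longrightarrow> x \<in> I"
  using interval unfolding is_interval_1 by blast

lemma Icc_subset: "c \<in> I \<Longrightarrow> d \<in> I \<Longrightarrow> {c..d} \<subseteq> I"
  by (auto intro: between_mem[of c d])

lemma sets_I [measurable]: "I \<in> sets borel"
  using interval by (simp add: is_interval_convex_1 real_interval_borel_measurable)

lemma left_end_le: "x \<in> I \<Longrightarrow> left_end I \<le> ereal x"
  unfolding left_end_def by (rule INF_lower)

lemma le_right_end: "x \<in> I \<Longrightarrow> ereal x \<le> right_end I"
  unfolding right_end_def by (rule SUP_upper)

lemma left_end_less_obtain:
  assumes "left_end I < ereal y" obtains c where "c \<in> I" "c < y"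
  using assms unfolding left_end_def INF_less_iff by auto

lemma less_right_end_obtain:
  assumes "ereal y < right_end I" obtains c where "c \<in> I" "y < c"
  using assms unfolding right_end_def less_SUP_iff by auto

lemma mem_if_le:
  assumes "left_end I < ereal y" "y \<le> z" "z \<in> I" shows "y \<in> I"
proof -
  obtain c where "c \<in> I" "c < y" using left_end_less_obtain[OF assms(1)] by blast
  then show ?thesis using between_mem[of c z y] assms by auto
qed

lemma mem_if_strictly_between:
  assumes "left_end I < ereal y" "ereal y < right_end I" shows "y \<in> I"
proof -
  obtain d where "d \<in> I" "y < d" using less_right_end_obtain[OF assms(2)] by blast
  then show ?thesis using mem_if_le[OF assms(1), of d] by auto
qed

lemma exists_greater:
  assumes "x \<in> I" "ereal x \<noteq> right_end I" shows "\<exists>d\<in>I. x < d"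
proof -
  have "ereal x < right_end I" using le_right_end[OF assms(1)] assms(2) by simp
  then show ?thesis using less_right_end_obtain by blast
qed

lemma exists_less:
  assumes "x \<in> I" "ereal x = right_end I" shows "\<exists>d\<in>I. d < x"
proof -
  obtain c d where cd: "c \<in> I" "d \<in> I" "c < d" using nontrivial by blast
  then have "d \<le> x" using le_right_end[of d] assms(2) by (metis ereal_less_eq(3))
  then show ?thesis using cd by force
qed

lemma loc_integrable_Icc:
  assumes "loc_integrable I \<phi>" "c \<in> I" "d \<in> I"
  shows "set_integrable lborel {c..d} \<phi>"
proof (cases "c \<le> d")
  case True
  then have "set_integrable lborel {c<..<d} \<phi>"
    using assms unfolding loc_integrable_def interval_lebesgue_integrable_def by force
  then show ?thesis
    unfolding set_integrable_def
    by (subst integrable_discrete_difference[where X="{c,d}" and g="\<lambda>x. indicat_real {c<..<d} x *\<^sub>R \<phi> x"])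
       (auto simp: indicator_def)
qed (simp add: set_integrable_def)

lemma loc_integrableI:
  assumes "\<And>c d. c \<in> I \<Longrightarrow> d \<in> I \<Longrightarrow> c \<le> d \<Longrightarrow> set_integrable lborel {c..d} \<phi>"
  shows "loc_integrable I \<phi>"
  unfolding loc_integrable_def interval_lebesgue_integrable_def
  using set_integrable_subset[OF assms] by (auto simp: greaterThanLessThan_subseteq_atLeastAtMost_iff)

lemma integral_split:
  assumes "loc_integrable I \<phi>" "a \<in> I" "b \<in> I" "c \<in> I"
  shows "(LBINT u=ereal a..ereal b. \<phi> u) + (LBINT u=ereal b..ereal c. \<phi> u) = (LBINT u=ereal a..ereal c. \<phi> u)"
proof (rule interval_integral_sum)
  show "interval_lebesgue_integrable lborel (min (ereal a) (min (ereal b) (ereal c)))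
     (max (ereal a) (max (ereal b) (ereal c))) \<phi>"
    using assms unfolding loc_integrable_def by (auto simp: min_def max_def)
qed

lemma integral_Icc:
  "c \<le> d \<Longrightarrow> (LBINT u=ereal c..ereal d. \<phi> u) = (LBINT u:{c..d}. \<phi> u)"
  by (rule interval_integral_Icc)

lemma LBINT_cong:
  assumes "c \<in> I" "d \<in> I" "\<And>u. u \<in> I \<Longrightarrow> \<phi> u = \<psi> u"
  shows "(LBINT u=ereal c..ereal d. \<phi> u) = (LBINT u=ereal c..ereal d. \<psi> u)"
proof (rule interval_integral_cong)
  fix x assume "x \<in> einterval (min (ereal c) (ereal d)) (max (ereal c) (ereal d))"
  then have "x \<in> I" using between_mem[of c d x] between_mem[of d c x] assms(1,2)
    by (auto simp: einterval_iff min_def max_def split: if_splits)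
  then show "\<phi> x = \<psi> x" using assms by simp
qed

lemma loc_integrable_cong:
  assumes "\<And>u. u \<in> I \<Longrightarrow> \<phi> u = \<psi> u"
  shows "loc_integrable I \<phi> \<longleftrightarrow> loc_integrable I \<psi>"
proof -
  have "loc_integrable I \<psi>" if "loc_integrable I \<phi>" "\<And>u. u \<in> I \<Longrightarrow> \<phi> u = \<psi> u" for \<phi> \<psi>
  proof (rule loc_integrableI)
    fix c d assume cd: "c \<in> I" "d \<in> I" "c \<le> d"
    have *: "indicat_real {c..d} x *\<^sub>R \<psi> x = indicat_real {c..d} x *\<^sub>R \<phi> x" for x
      using that(2) between_mem[OF cd(1,2)] by (auto simp: indicator_def)
    show "set_integrable lborel {c..d} \<psi>"
      using loc_integrable_Icc[OF that(1) cd(1,2)] unfolding set_integrable_def * .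
  qed
  from this[of \<phi> \<psi>] this[of \<psi> \<phi>] show ?thesis using assms by auto
qed

lemma loc_integrable_add: "loc_integrable I \<phi> \<Longrightarrow> loc_integrable I \<psi> \<Longrightarrow> loc_integrable I (\<lambda>x. \<phi> x + \<psi> x)"
  unfolding loc_integrable_def by auto

lemma loc_integrable_diff: "loc_integrable I \<phi> \<Longrightarrow> loc_integrable I \<psi> \<Longrightarrow> loc_integrable I (\<lambda>x. \<phi> x - \<psi> x)"
  unfolding loc_integrable_def by auto

lemma loc_integrable_cmult: "loc_integrable I \<phi> \<Longrightarrow> loc_integrable I (\<lambda>x. c * \<phi> x)"
  unfolding loc_integrable_def by auto

lemma loc_integrable_bounded:
  assumes "\<phi> \<in> Bor I" "\<And>c d. c \<in> I \<Longrightarrow> d \<in> I \<Longrightarrow> c \<le> d \<Longrightarrow> \<exists>B. \<forall>x\<in>{c..d}. \<bar>\<phi> x\<bar> \<le> B"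
  shows "loc_integrable I \<phi>"
proof (rule loc_integrableI)
  fix c d assume cd: "c \<in> I" "d \<in> I" "c \<le> d"
  then obtain B where B: "\<And>x. x \<in> {c..d} \<Longrightarrow> \<bar>\<phi> x\<bar> \<le> B" using assms(2) by blast
  have m: "\<phi> \<in> borel_measurable (restrict_space borel {c..d})"
    using measurable_restrict_mono[of \<phi> borel I borel "{c..d}"] assms(1) Icc_subset[OF cd(1,2)]
    unfolding Bor_def by auto
  then have m': "(\<lambda>x. indicat_real {c..d} x *\<^sub>R \<phi> x) \<in> borel_measurable borel"
    by (subst (asm) borel_measurable_restrict_space_iff) auto
  have "0 \<le> B" using B[of c] cd(3) abs_ge_zero[of "\<phi> c"] by (smt (verit) atLeastAtMost_iff)
  have "integrable lborel (\<lambda>x. indicat_real {c..d} x * B)"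
    by (intro integrable_mult_left integrable_real_indicator) (auto simp: cd(3))
  then show "set_integrable lborel {c..d} \<phi>"
    unfolding set_integrable_def
  proof (rule Bochner_Integration.integrable_bound)
    show "(\<lambda>x. indicat_real {c..d} x *\<^sub>R \<phi> x) \<in> borel_measurable lborel" using m' by simp
    show "AE x in lborel. norm (indicat_real {c..d} x *\<^sub>R \<phi> x) \<le> norm (indicat_real {c..d} x * B)"
      using B \<open>0 \<le> B\<close> by (intro AE_I2) (simp add: indicator_def)
  qed
qed

text \<open>On a compact {c..d} in I the integral is a constant plus an indefinite Henstock-Kurzweil
  integral, which is continuous. Continuity within I at x is read off from a {c..d} that is a
  neighbourhood of x in I.\<close>

lemma indefinite_continuous_on:
  assumes "loc_integrable I \<phi>" "z \<in> I"
  shows "continuous_on I (\<lambda>x. LBINT u=ereal z..ereal x. \<phi> u)"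
proof -
  have Icc: "continuous_on {c..d} (\<lambda>x. LBINT u=ereal z..ereal x. \<phi> u)" if cd: "c \<in> I" "d \<in> I" "c \<le> d" for c d
  proof -
    have si: "set_integrable lborel {c..d} \<phi>" using loc_integrable_Icc assms cd by blast
    then have "\<phi> integrable_on {c..d}" by (rule set_borel_integral_eq_integral)
    then have 1: "continuous_on {c..d} (\<lambda>x. (LBINT u=ereal z..ereal c. \<phi> u) + integral {c..x} \<phi>)"
      by (intro continuous_intros indefinite_integral_continuous_1)
    show ?thesis
    proof (rule continuous_on_eq[OF 1])
      fix x assume x: "x \<in> {c..d}"
      then have xI: "x \<in> I" using between_mem[OF cd(1,2)] by auto
      have "(LBINT u=ereal c..ereal x. \<phi> u) = integral {c..x} \<phi>"
        using x set_borel_integral_eq_integral(2)[OF loc_integrable_Icc[OF assms(1) cd(1) xI]]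
        by (simp only: integral_Icc atLeastAtMost_iff)
      then show "(LBINT u=ereal z..ereal c. \<phi> u) + integral {c..x} \<phi> = (LBINT u=ereal z..ereal x. \<phi> u)"
        using integral_split[OF assms(1,2) cd(1) xI] by simp
    qed
  qed
  show ?thesis unfolding continuous_on_eq_continuous_within
  proof
    fix x assume xI: "x \<in> I"
    define \<Phi> where "\<Phi> = (\<lambda>x. LBINT u=ereal z..ereal x. \<phi> u)"
    \<comment> \<open>If x is the least (greatest) point of I, then c = x (d = x) and I has no
      points on that side; otherwise there is room on that side.\<close>
    obtain c where c: "c \<in> I" "c \<le> x" "c < x \<or> (\<forall>y\<in>I. x \<le> y)"
      using xI by (cases "\<exists>c\<in>I. c < x") (auto simp: not_less)
    obtain d where d: "d \<in> I" "x \<le> d" "x < d \<or> (\<forall>y\<in>I. y \<le> x)"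
      using xI by (cases "\<exists>d\<in>I. x < d") (auto simp: not_less)
    have "continuous (at x within {c..d}) \<Phi>"
      using Icc[OF c(1) d(1)] c d unfolding \<Phi>_def continuous_on_eq_continuous_within by force
    moreover have "at x within I = at x within {c..d}"
    proof (rule at_within_nhd)
      define lo where "lo = (if c < x then c else x - 1)"
      define hi where "hi = (if x < d then d else x + 1)"
      show "x \<in> {lo<..<hi}" "open {lo<..<hi}" by (auto simp: lo_def hi_def)
      show "I \<inter> {lo<..<hi} - {x} = {c..d} \<inter> {lo<..<hi} - {x}"
        using c d Icc_subset[OF c(1) d(1)] unfolding lo_def hi_def by force
    qed
    ultimately show "continuous (at x within I) (\<lambda>x. LBINT u=ereal z..ereal x. \<phi> u)"
      by (simp only: \<Phi>_def)
  qed
qed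

section \<open>Borel functions and one-sided continuity on I\<close>

lemma continuous_on_Bor: "continuous_on I \<phi> \<Longrightarrow> \<phi> \<in> Bor I"
  unfolding Bor_def by (rule borel_measurable_continuous_on_restrict)

lemma eventually_at_right_mem:
  assumes "x \<in> I" "ereal x \<noteq> right_end I" shows "\<forall>\<^sub>F u in at_right x. u \<in> I"
proof -
  obtain d where d: "d \<in> I" "x < d" using exists_greater[OF assms] by auto
  then show ?thesis
    unfolding eventually_at_right_field using between_mem[OF assms(1) d(1)] by (intro exI[of _ d]) auto
qed

lemma eventually_at_left_mem:
  assumes "x \<in> I" "ereal x = right_end I" shows "\<forall>\<^sub>F u in at_left x. u \<in> I"
proof -
  obtain d where d: "d \<in> I" "d < x" using exists_less[OF assms] by auto
  then show ?thesis
    unfolding eventually_at_left_field using between_mem[OF d(1) assms(1)] by (intro exI[of _ d]) auto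
qed

lemma RC_cong:
  assumes "\<And>u. u \<in> I \<Longrightarrow> g u = h u" "g \<in> RC I"
  shows "h \<in> RC I"
proof -
  have "continuous (at_right x) h" if "x \<in> I" "ereal x \<noteq> right_end I" for x
  proof -
    have "(g \<longlongrightarrow> g x) (at_right x)" using assms(2) that by (auto simp: RC_def continuous_within)
    moreover have "\<forall>\<^sub>F u in at_right x. g u = h u"
      using eventually_at_right_mem[OF that] by eventually_elim (rule assms(1))
    ultimately show ?thesis using that assms(1) by (simp add: continuous_within tendsto_cong)
  qed
  moreover have "continuous (at_left x) h" if "x \<in> I" "ereal x = right_end I" for x
  proof -
    have "(g \<longlongrightarrow> g x) (at_left x)" using assms(2) that by (auto simp: RC_def continuous_within)
    moreover have "\<forall>\<^sub>F u in at_left x. g u = h u"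
      using eventually_at_left_mem[OF that] by eventually_elim (rule assms(1))
    ultimately show ?thesis using that assms(1) by (simp add: continuous_within tendsto_cong)
  qed
  ultimately show ?thesis by (auto simp: RC_def)
qed

lemma continuous_on_RC:
  assumes "continuous_on I g" shows "g \<in> RC I"
proof -
  have c: "(g \<longlongrightarrow> g x) (at x within I)" if "x \<in> I" for x
    using assms that by (auto simp: continuous_on)
  have "continuous (at_right x) g" if "x \<in> I" "ereal x \<noteq> right_end I" for x
    unfolding continuous_within
    by (rule filterlim_mono[OF c[OF that(1)] order_refl])
       (use eventually_at_right_mem[OF that] in \<open>auto simp: at_within_def le_inf_iff le_principal eventually_at_filter eventually_inf_principal\<close>)
  moreover have "continuous (at_left x) g" if "x \<in> I" "ereal x = right_end I" for x
    unfolding continuous_within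
    by (rule filterlim_mono[OF c[OF that(1)] order_refl])
       (use eventually_at_left_mem[OF that] in \<open>auto simp: at_within_def le_inf_iff le_principal eventually_at_filter eventually_inf_principal\<close>)
  ultimately show ?thesis by (auto simp: RC_def)
qed

lemma RC_add: "g \<in> RC I \<Longrightarrow> h \<in> RC I \<Longrightarrow> (\<lambda>x. g x + h x) \<in> RC I"
  by (auto simp: RC_def intro!: continuous_add)

lemma RC_diff: "g \<in> RC I \<Longrightarrow> h \<in> RC I \<Longrightarrow> (\<lambda>x. g x - h x) \<in> RC I"
  by (auto simp: RC_def intro!: continuous_diff)

lemma RC_cmult: "g \<in> RC I \<Longrightarrow> (\<lambda>x. c * g x) \<in> RC I"
  by (auto simp: RC_def intro!: continuous_mult continuous_const)

text \<open>Turns positivity at one point into positivity on a set of positive Lebesgue measure. The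
  interval lies on the side of x on which g is known to be continuous.\<close>

lemma RC_pos_interval:
  assumes "g \<in> RC I" "x \<in> I" "0 < g x"
  shows "\<exists>c\<in>I. \<exists>d\<in>I. c < d \<and> (\<forall>u. c < u \<and> u < d \<longrightarrow> 0 < g u)"
proof (cases "ereal x = right_end I")
  case False
  then have "(g \<longlongrightarrow> g x) (at_right x)" using assms by (auto simp: RC_def continuous_within)
  then have "\<forall>\<^sub>F u in at_right x. 0 < g u" using assms(3) by (rule order_tendstoD)
  then obtain e where e: "e > x" "\<And>u. x < u \<Longrightarrow> u < e \<Longrightarrow> 0 < g u" by (auto simp: eventually_at_right_field)
  obtain d where d: "d \<in> I" "x < d" using exists_greater[OF assms(2) False] by auto
  have "min e d \<in> I" using between_mem[OF assms(2) d(1), of "min e d"] e d by auto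
  then show ?thesis using e d assms(2) by (intro bexI[of _ x] bexI[of _ "min e d"]) auto
next
  case True
  then have "(g \<longlongrightarrow> g x) (at_left x)" using assms by (auto simp: RC_def continuous_within)
  then have "\<forall>\<^sub>F u in at_left x. 0 < g u" using assms(3) by (rule order_tendstoD)
  then obtain e where e: "e < x" "\<And>u. e < u \<Longrightarrow> u < x \<Longrightarrow> 0 < g u" by (auto simp: eventually_at_left_field)
  obtain d where d: "d \<in> I" "d < x" using exists_less[OF assms(2) True] by auto
  have "max e d \<in> I" using between_mem[OF d(1) assms(2), of "max e d"] e d by auto
  then show ?thesis using e d assms(2) by (intro bexI[of _ "max e d"] bexI[of _ x]) auto
qed

text \<open>Suppose D x < 0. One-sided continuity is known for D / v, which has the sign of D, so D
  < 0 on a nonempty open interval. The integral of D over it is an increment of g, hence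
  nonnegative, and this forces D = 0 almost everywhere there.\<close>

lemma density_nonneg:
  assumes "v \<in> Bor_pos I" "is_wt_density I v g D" "mono_on I g" "x \<in> I"
  shows "0 \<le> D x"
proof (rule ccontr)
  assume "\<not> 0 \<le> D x"
  note D = is_wt_densityD[OF assms(2)]
  have v: "0 < v u" if "u \<in> I" for u using assms(1) that by (auto simp: Bor_pos_def)
  have neg: "0 < - 1 * (D x / v x)" using v[OF assms(4)] \<open>\<not> 0 \<le> D x\<close> by (auto simp: field_simps)
  have rc: "(\<lambda>x. -1 * (D x / v x)) \<in> RC I" by (rule RC_cmult[OF D(2)])
  obtain c d where cd: "c \<in> I" "d \<in> I" "c < d" "\<And>u. c < u \<Longrightarrow> u < d \<Longrightarrow> 0 < -1 * (D u / v u)"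
    using RC_pos_interval[OF rc assms(4) neg] by blast
  have pos: "D u < 0" if "c < u" "u < d" for u
    using cd(4)[OF that] v between_mem[OF cd(1,2), of u] that
    by (auto simp: divide_less_0_iff dest: less_asym)
  have int: "set_integrable lborel {c<..<d} D"
    using set_integrable_subset[OF loc_integrable_Icc[OF D(3) cd(1,2)]]
    by (simp add: greaterThanLessThan_subseteq_atLeastAtMost_iff)
  have "(LBINT u:{c<..<d}. D u) = g d - g c"
    using D(4)[OF cd(2,1)] cd(3) by (simp add: interval_lebesgue_integral_def)
  then have ge: "0 \<le> (LBINT u:{c<..<d}. D u)" using assms(3) cd by (simp add: mono_on_def)
  define h where "h = (\<lambda>u. - (indicat_real {c<..<d} u *\<^sub>R D u))"
  have hi: "integrable lborel h" using int unfolding h_def set_integrable_def by (rule integrable_minus)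
  have hn: "0 \<le> h u" for u unfolding h_def using pos[of u] by (auto simp: indicator_def)
  have "integral\<^sup>L lborel h \<le> 0" using ge unfolding h_def set_lebesgue_integral_def by simp
  then have "integral\<^sup>L lborel h = 0"
    using Bochner_Integration.integral_nonneg[of lborel h] hn by (simp add: antisym)
  then have "AE u in lborel. h u = 0" using integral_nonneg_eq_0_iff_AE[OF hi] hn by simp
  then have ae: "AE u in lborel. u \<notin> {c<..<d}"
  proof eventually_elim
    fix u assume "h u = 0"
    then show "u \<notin> {c<..<d}" using pos[of u] by (auto simp: h_def indicator_def split: if_splits)
  qed
  have "emeasure lborel {c<..<d} = 0"
    by (subst AE_iff_measurable[where P="\<lambda>u. u \<notin> {c<..<d}", symmetric]) (use ae in auto)
  then show False using cd(3) by simp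
qed

text \<open>The difference of two densities of g is a density of the zero function, which is
  nondecreasing; \<open>density_nonneg\<close> applies to both D - D' and D' - D.\<close>

lemma density_unique:
  assumes "v \<in> Bor_pos I" "is_wt_density I v g D" "is_wt_density I v g D'" "x \<in> I"
  shows "D x = D' x"
proof -
  have *: "is_wt_density I v (\<lambda>_. 0) (\<lambda>x. D x - D' x)"
    if D: "is_wt_density I v g D" and D': "is_wt_density I v g D'" for D D'
  proof (rule is_wt_densityI)
    note D = is_wt_densityD[OF D] and D' = is_wt_densityD[OF D']
    show "(\<lambda>x. D x - D' x) \<in> Bor I" using D(1) D'(1) by (simp add: Bor_def)
    show "(\<lambda>x. (D x - D' x) / v x) \<in> RC I" using RC_diff[OF D(2) D'(2)] by (simp add: diff_divide_distrib)
    show "loc_integrable I (\<lambda>x. D x - D' x)" using loc_integrable_diff[OF D(3) D'(3)] .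
    fix x z assume xz: "x \<in> I" "z \<in> I"
    then have i: "interval_lebesgue_integrable lborel (ereal z) (ereal x) D"
      "interval_lebesgue_integrable lborel (ereal z) (ereal x) D'"
      using D(3) D'(3) by (auto simp: loc_integrable_def)
    show "0 = 0 + (LBINT x=ereal z..ereal x. D x - D' x)"
      using interval_lebesgue_integral_diff(2)[OF i] D(4)[OF xz] D'(4)[OF xz] by simp
  qed
  have m: "mono_on I (\<lambda>_. 0::real)" by (simp add: mono_on_def)
  show ?thesis
    using density_nonneg[OF assms(1) *[OF assms(2,3)] m assms(4)]
      density_nonneg[OF assms(1) *[OF assms(3,2)] m assms(4)] by simp
qed

lemma density_cong:
  assumes "is_wt_density I v g D" "\<And>x. x \<in> I \<Longrightarrow> g x = g' x" "\<And>x. x \<in> I \<Longrightarrow> D x = D' x"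
  shows "is_wt_density I v g' D'"
proof (rule is_wt_densityI)
  note D = is_wt_densityD[OF assms(1)]
  show "D' \<in> Bor I" using D(1) assms(3) measurable_cong[of "restrict_space borel I" D D' borel]
    by (simp add: Bor_def space_restrict_space)
  show "(\<lambda>x. D' x / v x) \<in> RC I"
    by (rule RC_cong[OF _ D(2)]) (simp add: assms(3))
  show "loc_integrable I D'" using D(3) loc_integrable_cong assms(3) by blast
  fix x z assume xz: "x \<in> I" "z \<in> I"
  show "g' x = g' z + (LBINT u=ereal z..ereal x. D' u)"
    using D(4)[OF xz] assms(2)[OF xz(1)] assms(2)[OF xz(2)] LBINT_cong[OF xz(2,1), of D D', OF assms(3)]
    by simp
qed

lemma D_wt_density:
  assumes "v \<in> Bor_pos I" "is_wt_density I v g D"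
  shows "is_wt_density I v g (D_wt I v g)"
proof -
  have "\<exists>!D. D \<in> extensional I \<and> is_wt_density I v g D"
  proof (rule ex1I[of _ "restrict D I"])
    show "restrict D I \<in> extensional I \<and> is_wt_density I v g (restrict D I)"
      using density_cong[OF assms(2), of g "restrict D I"] by auto
    fix D' assume "D' \<in> extensional I \<and> is_wt_density I v g D'"
    then show "D' = restrict D I"
      using density_unique[OF assms(1) assms(2)] by (intro extensionalityI[of _ I]) auto
  qed
  from theI'[OF this] show ?thesis unfolding D_wt_def by simp
qed

lemma D_wt_eq:
  assumes "v \<in> Bor_pos I" "is_wt_density I v g D" "x \<in> I"
  shows "D_wt I v g x = D x"
  using density_unique[OF assms(1) D_wt_density[OF assms(1,2)] assms(2,3)] .

end

section \<open>Towers of weighted derivatives\<close>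

locale gauged_interval = nontrivial_interval I for I :: "real set" +
  fixes w :: "nat \<Rightarrow> real \<Rightarrow> real"
  assumes w_Bor_pos: "w j \<in> Bor_pos I"
    and w_bounded: "compact K \<Longrightarrow> K \<subseteq> I \<Longrightarrow> bounded (w j ` K)"
begin

lemma w_pos: "x \<in> I \<Longrightarrow> 0 < w j x"
  using w_Bor_pos[of j] by (simp add: Bor_pos_def)

lemma w_Bor: "w j \<in> Bor I"
  using w_Bor_pos[of j] by (simp add: Bor_pos_def)

lemma w_bound:
  assumes "c \<in> I" "d \<in> I" obtains B where "0 < B" "\<And>x. x \<in> {c..d} \<Longrightarrow> w j x \<le> B"
proof -
  have "bounded (w j ` {c..d})" by (rule w_bounded[OF compact_Icc Icc_subset[OF assms]])
  then obtain B where "\<forall>x\<in>{c..d}. \<bar>w j x\<bar> \<le> B" by (auto simp: bounded_iff)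
  then show ?thesis by (intro that[of "max B 1"]) (force simp: le_max_iff_disj)+
qed

lemma Bor_cong: "(\<And>x. x \<in> I \<Longrightarrow> g x = h x) \<Longrightarrow> g \<in> Bor I \<longleftrightarrow> h \<in> Bor I"
  unfolding Bor_def by (rule measurable_cong) (simp add: space_restrict_space)

lemma Bor_mult: "g \<in> Bor I \<Longrightarrow> h \<in> Bor I \<Longrightarrow> (\<lambda>x. g x * h x) \<in> Bor I"
  by (simp add: Bor_def)

lemma Bor_mult_w_iff: "(\<lambda>x. w j x * g x) \<in> Bor I \<longleftrightarrow> g \<in> Bor I"
proof
  assume "(\<lambda>x. w j x * g x) \<in> Bor I"
  then have "(\<lambda>x. w j x * g x / w j x) \<in> Bor I"
    using w_Bor[of j] unfolding Bor_def by (rule borel_measurable_divide)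
  then show "g \<in> Bor I" by (rule Bor_cong[THEN iffD1, rotated]) (simp add: w_pos less_imp_neq[symmetric])
qed (rule Bor_mult[OF w_Bor])

lemma loc_integrable_w_mult:
  assumes "g \<in> Bor I" "\<And>c d. c \<in> I \<Longrightarrow> d \<in> I \<Longrightarrow> c \<le> d \<Longrightarrow> \<exists>B. \<forall>x\<in>{c..d}. \<bar>g x\<bar> \<le> B"
  shows "loc_integrable I (\<lambda>x. w j x * g x)"
proof (rule loc_integrable_bounded)
  show "(\<lambda>x. w j x * g x) \<in> Bor I" using assms(1) by (simp add: Bor_mult_w_iff)
  fix c d assume cd: "c \<in> I" "d \<in> I" "c \<le> d"
  obtain B where B: "\<forall>x\<in>{c..d}. \<bar>g x\<bar> \<le> B" using assms(2)[OF cd] by blast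
  obtain C where C: "0 < C" "\<And>x. x \<in> {c..d} \<Longrightarrow> w j x \<le> C" using w_bound[OF cd(1,2)] by blast
  show "\<exists>B. \<forall>x\<in>{c..d}. \<bar>w j x * g x\<bar> \<le> B"
  proof (intro exI ballI)
    fix x assume x: "x \<in> {c..d}"
    then have "0 < w j x" using w_pos Icc_subset[OF cd(1,2)] by blast
    then show "\<bar>w j x * g x\<bar> \<le> C * B"
      unfolding abs_mult using B C x by (intro mult_mono) auto
  qed
qed

lemma loc_integrable_w_mult_continuous:
  assumes "continuous_on I g" shows "loc_integrable I (\<lambda>x. w j x * g x)"
proof (rule loc_integrable_w_mult)
  show "g \<in> Bor I" using continuous_on_Bor[OF assms] .
  fix c d assume cd: "c \<in> I" "d \<in> I"
  have "bounded (g ` {c..d})"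
    using continuous_on_subset[OF assms Icc_subset[OF cd]]
    by (intro compact_imp_bounded compact_continuous_image) auto
  then show "\<exists>B. \<forall>x\<in>{c..d}. \<bar>g x\<bar> \<le> B" by (auto simp: bounded_iff)
qed

text \<open>G stands for f^(0), ..., f^(m) without the descriptions behind \<open>wderiv\<close>. By
  \<open>wderiv_tower\<close> and \<open>tower_wderiv\<close>, f lies in \<open>S_cls I w m\<close>
  exactly when f = w_0 G_0 on I for some tower G of height m, and then G agrees on I with
  \<open>wderiv I w f\<close>.\<close>

definition tower :: "(nat \<Rightarrow> real \<Rightarrow> real) \<Rightarrow> nat \<Rightarrow> bool" where
  "tower G m \<longleftrightarrow> G 0 \<in> Bor I \<and>
     (\<forall>j<m. is_wt_density I (w (Suc j)) (G j) (\<lambda>x. w (Suc j) x * G (Suc j) x))"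

lemma towerD: "tower G m \<Longrightarrow> j < m \<Longrightarrow> is_wt_density I (w (Suc j)) (G j) (\<lambda>x. w (Suc j) x * G (Suc j) x)"
  by (simp add: tower_def)

lemma tower_Bor: "tower G m \<Longrightarrow> j \<le> m \<Longrightarrow> G j \<in> Bor I"
  using is_wt_densityD(1)[OF towerD, of G m "j - 1"]
  by (cases j) (auto simp: tower_def Bor_mult_w_iff)

lemma tower_RC:
  assumes "tower G m" "0 < j" "j \<le> m" shows "G j \<in> RC I"
proof -
  obtain i where i: "j = Suc i" using assms(2) by (cases j) auto
  have "(\<lambda>x. w j x * G j x / w j x) \<in> RC I"
    using is_wt_densityD(2)[OF towerD[OF assms(1), of i]] assms i by simp
  then show ?thesis by (rule RC_cong[rotated]) (simp add: w_pos less_imp_neq[symmetric])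
qed

lemma tower_loc_integrable:
  assumes "tower G m" "j < m" shows "loc_integrable I (\<lambda>x. w (Suc j) x * G (Suc j) x)"
  by (rule is_wt_densityD(3)[OF towerD[OF assms]])

lemma tower_eq:
  assumes "tower G m" "j < m" "x \<in> I" "z \<in> I"
  shows "G j x = G j z + (LBINT u=ereal z..ereal x. w (Suc j) u * G (Suc j) u)"
  by (rule is_wt_densityD(4)[OF towerD[OF assms(1,2)] assms(3,4)])

lemma tower_mono: "tower G m \<Longrightarrow> i \<le> m \<Longrightarrow> tower G i"
  by (simp add: tower_def)

lemma density_wI:
  assumes "h \<in> RC I" "h \<in> Bor I" "loc_integrable I (\<lambda>x. w j x * h x)" "z \<in> I"
    and "\<And>x. x \<in> I \<Longrightarrow> g x = c + (LBINT u=ereal z..ereal x. w j u * h u)"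
  shows "is_wt_density I (w j) g (\<lambda>x. w j x * h x)"
proof (rule is_wt_densityI)
  show "(\<lambda>x. w j x * h x) \<in> Bor I" using assms(2) by (simp add: Bor_mult_w_iff)
  show "(\<lambda>x. w j x * h x / w j x) \<in> RC I" by (rule RC_cong[OF _ assms(1)]) (use w_pos[of _ j] in force)
  show "loc_integrable I (\<lambda>x. w j x * h x)" by fact
  fix x y assume xy: "x \<in> I" "y \<in> I"
  show "g x = g y + (LBINT u=ereal y..ereal x. w j u * h u)"
    using integral_split[OF assms(3,4) xy(2,1)] assms(5)[OF xy(1)] assms(5)[OF xy(2)] by simp
qed

lemma tower_lin:
  assumes "tower G m" "tower H m"
  shows "tower (\<lambda>j x. a * G j x + b * H j x) m"
  unfolding tower_def
proof (intro conjI allI impI)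
  show "(\<lambda>x. a * G 0 x + b * H 0 x) \<in> Bor I"
    using tower_Bor[OF assms(1), of 0] tower_Bor[OF assms(2), of 0] by (simp add: Bor_def)
  fix j assume j: "j < m"
  obtain z where z: "z \<in> I" using nontrivial by blast
  note G = tower_loc_integrable[OF assms(1) j] and H = tower_loc_integrable[OF assms(2) j]
  have eq: "w (Suc j) x * (a * G (Suc j) x + b * H (Suc j) x) =
     a * (w (Suc j) x * G (Suc j) x) + b * (w (Suc j) x * H (Suc j) x)" for x
    by (simp add: algebra_simps)
  show "is_wt_density I (w (Suc j)) (\<lambda>x. a * G j x + b * H j x)
     (\<lambda>x. w (Suc j) x * (a * G (Suc j) x + b * H (Suc j) x))"
  proof (rule density_wI[OF _ _ _ z])
    show "(\<lambda>x. a * G (Suc j) x + b * H (Suc j) x) \<in> RC I"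
      using tower_RC[OF assms(1), of "Suc j"] tower_RC[OF assms(2), of "Suc j"] j by (intro RC_add RC_cmult) auto
    show "(\<lambda>x. a * G (Suc j) x + b * H (Suc j) x) \<in> Bor I"
      using tower_Bor[OF assms(1), of "Suc j"] tower_Bor[OF assms(2), of "Suc j"] j by (simp add: Bor_def)
    show "loc_integrable I (\<lambda>x. w (Suc j) x * (a * G (Suc j) x + b * H (Suc j) x))"
      unfolding eq by (intro loc_integrable_add loc_integrable_cmult G H)
    fix x assume x: "x \<in> I"
    have "interval_lebesgue_integrable lborel (ereal z) (ereal x) (\<lambda>x. a * (w (Suc j) x * G (Suc j) x))"
      "interval_lebesgue_integrable lborel (ereal z) (ereal x) (\<lambda>x. b * (w (Suc j) x * H (Suc j) x))"
      using G H x z by (auto simp: loc_integrable_def)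
    from interval_lebesgue_integral_add(2)[OF this]
    have "(LBINT u=ereal z..ereal x. w (Suc j) u * (a * G (Suc j) u + b * H (Suc j) u)) =
       a * (LBINT u=ereal z..ereal x. w (Suc j) u * G (Suc j) u) +
       b * (LBINT u=ereal z..ereal x. w (Suc j) u * H (Suc j) u)"
      unfolding eq by simp
    moreover note tower_eq[OF assms(1) j x z] tower_eq[OF assms(2) j x z]
    ultimately show "a * G j x + b * H j x = (a * G j z + b * H j z) +
       (LBINT u=ereal z..ereal x. w (Suc j) u * (a * G (Suc j) u + b * H (Suc j) u))"
      by (simp add: algebra_simps)
  qed
qed

lemma tower_zero: "tower (\<lambda>j x. 0) m"
proof -
  obtain z where z: "z \<in> I" using nontrivial by blast
  have "loc_integrable I (\<lambda>x. w j x * 0)" for j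
    by (rule loc_integrable_w_mult_continuous) (rule continuous_on_const)
  then show ?thesis
    unfolding tower_def
    using density_wI[OF continuous_on_RC[OF continuous_on_const] continuous_on_Bor[OF continuous_on_const] _ z, of _ 0 "\<lambda>_. 0" 0]
    by (auto intro: continuous_on_Bor)
qed

lemma tower_sum:
  assumes "\<And>i. i \<in> A \<Longrightarrow> tower (G i) m"
  shows "tower (\<lambda>j x. \<Sum>i\<in>A. c i * G i j x) m"
  using assms
proof (induction A rule: infinite_finite_induct)
  case (insert i A)
  then show ?case using tower_lin[of "G i" m "\<lambda>j x. \<Sum>i\<in>A. c i * G i j x" "c i" 1] by simp
qed (simp_all add: tower_zero)

text \<open>Induction on the level: the next entry of the tower, times its weight, is a density of
  the present one, and densities are unique on I, so \<open>D_wt\<close> can only return it.\<close>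

lemma wderiv_tower:
  assumes "tower G m" "\<And>x. x \<in> I \<Longrightarrow> f x = w 0 x * G 0 x"
  shows "f \<in> S_cls I w m \<and> (\<forall>j\<le>m. \<forall>x\<in>I. wderiv I w f j x = G j x)"
  using assms(1)
proof (induction m)
  case 0
  have "(\<lambda>x. w 0 x * G 0 x) \<in> Bor I" using tower_Bor[OF 0, of 0] by (simp add: Bor_mult_w_iff)
  then have "f \<in> Bor I" by (rule Bor_cong[THEN iffD1, rotated]) (simp add: assms(2))
  moreover have "wderiv I w f 0 x = G 0 x" if "x \<in> I" for x
    using assms(2)[OF that] w_pos[OF that, of 0] by simp
  ultimately show ?case by simp
next
  case (Suc m)
  have IH: "f \<in> S_cls I w m" "\<And>j x. j \<le> m \<Longrightarrow> x \<in> I \<Longrightarrow> wderiv I w f j x = G j x"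
    using Suc.IH tower_mono[OF Suc.prems, of m] by auto
  have d: "is_wt_density I (w (Suc m)) (wderiv I w f m) (\<lambda>x. w (Suc m) x * G (Suc m) x)"
    by (rule density_cong[OF towerD[OF Suc.prems, of m]]) (simp_all add: IH)
  have "wderiv I w f m \<in> Bor I"
    using tower_Bor[OF Suc.prems, of m] Bor_cong[of "wderiv I w f m" "G m"] IH(2)[of m] by auto
  then have "f \<in> S_cls I w (Suc m)" using IH(1) d by (auto simp: S_wt_def)
  moreover have "wderiv I w f (Suc m) x = G (Suc m) x" if "x \<in> I" for x
    using D_wt_eq[OF w_Bor_pos d that] w_pos[OF that, of "Suc m"] by simp
  ultimately show ?case using IH by (auto simp: le_Suc_eq simp del: wderiv.simps)
qed

lemma tower_wderiv:
  assumes "f \<in> S_cls I w m" shows "tower (wderiv I w f) m"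
  using assms
proof (induction m)
  case 0
  then show ?case using w_Bor[of 0] by (simp add: tower_def Bor_def)
next
  case (Suc m)
  then obtain D where "is_wt_density I (w (Suc m)) (wderiv I w f m) D" by (auto simp: S_wt_def)
  from D_wt_density[OF w_Bor_pos this]
  have "is_wt_density I (w (Suc m)) (wderiv I w f m) (\<lambda>x. w (Suc m) x * wderiv I w f (Suc m) x)"
    by (rule density_cong) (use w_pos[of _ "Suc m"] in \<open>force\<close>)+
  then show ?case using Suc by (auto simp: tower_def less_Suc_eq simp del: wderiv.simps)
qed

section \<open>Iterated integration from z and interpolation at z\<close>

lemma tower_unique:
  assumes "tower G k" "tower H k" "z \<in> I" "\<And>x. x \<in> I \<Longrightarrow> G k x = H k x"
    and "\<And>i. i < k \<Longrightarrow> G i z = H i z" and "i \<le> k" "x \<in> I"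
  shows "G i x = H i x"
  using assms(6,7)
proof (induction i arbitrary: x rule: inc_induct)
  case (step i)
  have "(LBINT u=ereal z..ereal x. w (Suc i) u * G (Suc i) u) = (LBINT u=ereal z..ereal x. w (Suc i) u * H (Suc i) u)"
    by (rule LBINT_cong[OF assms(3) step.prems]) (simp add: step.IH)
  then show ?case
    using tower_eq[OF assms(1) step.hyps(2) step.prems assms(3)] tower_eq[OF assms(2) step.hyps(2) step.prems assms(3)]
      assms(5)[OF step.hyps(2)] by simp
qed (use assms(4) in simp)

text \<open>Repeated integration of \<psi> from level k down to level i, with the value c i imposed
  at z on each level i < k. For \<psi> = 0 these are the weighted Taylor polynomials at z that make
  up \<open>P_le\<close>; for c = 0 and \<psi> = \<open>p_left k j\<close> they give
  \<open>p_az\<close>.\<close>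

function tint :: "real \<Rightarrow> (nat \<Rightarrow> real) \<Rightarrow> (real \<Rightarrow> real) \<Rightarrow> nat \<Rightarrow> nat \<Rightarrow> real \<Rightarrow> real" where
  "tint z c \<psi> k i =
     (if i < k then (\<lambda>x. c i + (LBINT u=ereal z..ereal x. w (Suc i) u * tint z c \<psi> k (Suc i) u)) else \<psi>)"
  by pat_completeness auto
termination by (relation "Wellfounded.measure (\<lambda>(z, c, \<psi>, k, i). k - i)") auto

declare tint.simps [simp del]

lemma tint_k: "tint z c \<psi> k k = \<psi>"
  by (subst tint.simps) simp

lemma tint_less: "i < k \<Longrightarrow> tint z c \<psi> k i x = c i + (LBINT u=ereal z..ereal x. w (Suc i) u * tint z c \<psi> k (Suc i) u)"
  by (subst tint.simps) simp

lemma tint_at: "i < k \<Longrightarrow> tint z c \<psi> k i z = c i"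
  by (simp add: tint_less)

lemma tint_regular:
  assumes "z \<in> I" "\<psi> \<in> Bor I" "loc_integrable I (\<lambda>x. w k x * \<psi> x)" "i \<le> k"
  shows "loc_integrable I (\<lambda>x. w i x * tint z c \<psi> k i x) \<and> tint z c \<psi> k i \<in> Bor I \<and>
    (i < k \<longrightarrow> continuous_on I (tint z c \<psi> k i))"
  using assms(4)
proof (induction i rule: inc_induct)
  case base
  then show ?case using assms by (simp add: tint_k)
next
  case (step i)
  have "continuous_on I (\<lambda>x. c i + (LBINT u=ereal z..ereal x. w (Suc i) u * tint z c \<psi> k (Suc i) u))"
    using step.IH by (intro continuous_on_add continuous_on_const indefinite_continuous_on assms(1)) auto
  then have "continuous_on I (tint z c \<psi> k i)" using step.hyps by (simp add: tint_less cong: continuous_on_cong)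
  then show ?case using continuous_on_Bor loc_integrable_w_mult_continuous by blast
qed

text \<open>Levels below k are continuous, whereas level k is \<psi> itself, whose membership in
  \<open>RC\<close> matters only if the tower reaches it; hence a height m separate from k. The uses
  are m = k with \<psi> = 0, and m = k - 1 with \<psi> = \<open>p_left k j\<close>.\<close>

lemma tint_tower:
  assumes "z \<in> I" "\<psi> \<in> Bor I" "loc_integrable I (\<lambda>x. w k x * \<psi> x)"
    and "m \<le> k" "m = k \<Longrightarrow> \<psi> \<in> RC I"
  shows "tower (tint z c \<psi> k) m"
  unfolding tower_def
proof (intro conjI allI impI)
  note reg = tint_regular[OF assms(1-3)]
  show "tint z c \<psi> k 0 \<in> Bor I" using reg by simp
  fix j assume j: "j < m"
  show "is_wt_density I (w (Suc j)) (tint z c \<psi> k j) (\<lambda>x. w (Suc j) x * tint z c \<psi> k (Suc j) x)"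
  proof (rule density_wI[OF _ _ _ assms(1)])
    show "tint z c \<psi> k (Suc j) \<in> RC I"
    proof (cases "Suc j = k")
      case True
      then show ?thesis using assms j by (simp add: tint_k)
    next
      case False
      then show ?thesis using reg[of "Suc j"] assms(4) j by (intro continuous_on_RC) auto
    qed
    show "tint z c \<psi> k (Suc j) \<in> Bor I" "loc_integrable I (\<lambda>x. w (Suc j) x * tint z c \<psi> k (Suc j) x)"
      using reg[of "Suc j"] assms(4) j by auto
    show "tint z c \<psi> k j x = c j + (LBINT u=ereal z..ereal x. w (Suc j) u * tint z c \<psi> k (Suc j) u)" for x
      using assms(4) j by (intro tint_less) simp
  qed
qed

text \<open>Evaluates the description behind \<open>q_fun\<close>. Existence is the tower with
  \<psi> = 0. Two solutions agree at level k, where both vanish, and at z on every level below, so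
  \<open>tower_unique\<close> gives uniqueness.\<close>

lemma interpolating_P_le:
  assumes "z \<in> I"
  shows "(THE q. q \<in> extensional I \<and> q \<in> P_le I w (int k - 1) \<and> (\<forall>i<k. wderiv I w q i z = c i)) =
    restrict (\<lambda>x. w 0 x * tint z c (\<lambda>_. 0) k 0 x) I"
    (is "_ = ?q")
    and "tower (tint z c (\<lambda>_. 0) k) k"
proof -
  have "(\<lambda>_. 0) \<in> RC I" "(\<lambda>_. 0) \<in> Bor I" "loc_integrable I (\<lambda>x. w k x * 0)"
    by (intro continuous_on_RC continuous_on_Bor loc_integrable_w_mult_continuous continuous_on_const)+
  then show t: "tower (tint z c (\<lambda>_. 0) k) k" by (intro tint_tower assms) auto
  show "(THE q. q \<in> extensional I \<and> q \<in> P_le I w (int k - 1) \<and> (\<forall>i<k. wderiv I w q i z = c i)) = ?q"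
  proof (rule the_equality, intro conjI allI impI)
    have q: "?q \<in> S_cls I w k \<and> (\<forall>j\<le>k. \<forall>x\<in>I. wderiv I w ?q j x = tint z c (\<lambda>_. 0) k j x)"
      by (rule wderiv_tower[OF t]) simp
    show "?q \<in> P_le I w (int k - 1)" using q by (simp add: P_le_def tint_k)
    show "wderiv I w ?q i z = c i" if "i < k" for i using q assms that by (simp add: tint_at)
    fix q assume "q \<in> extensional I \<and> q \<in> P_le I w (int k - 1) \<and> (\<forall>i<k. wderiv I w q i z = c i)"
    then have q: "q \<in> extensional I" "q \<in> S_cls I w k" "\<And>x. x \<in> I \<Longrightarrow> wderiv I w q k x = 0"
      "\<And>i. i < k \<Longrightarrow> wderiv I w q i z = c i"
      by (auto simp: P_le_def)
    have "q x = w 0 x * tint z c (\<lambda>_. 0) k 0 x" if "x \<in> I" for x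
    proof -
      have "wderiv I w q 0 x = tint z c (\<lambda>_. 0) k 0 x"
        by (rule tower_unique[OF tower_wderiv[OF q(2)] t assms]) (auto simp: q tint_k tint_at that simp del: wderiv.simps)
      then show ?thesis using w_pos[OF that, of 0] by (simp add: field_simps)
    qed
    then show "q = ?q" using q(1) by (intro extensionalityI[of _ I]) auto
  qed simp
qed

end

section \<open>Iterated integrals in the extended nonnegative reals\<close>

text \<open>The lower limit of integration is encoded in the support of \<phi>. A variable starting
  point t thus never appears as a limit of integration, which keeps joint measurability and
  Tonelli's theorem simple.\<close>

definition nn_prim :: "(real \<Rightarrow> ennreal) \<Rightarrow> real \<Rightarrow> ennreal" where
  "nn_prim \<phi> x = (\<integral>\<^sup>+u. \<phi> u * indicator {..<x} u \<partial>lborel)"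

lemma nn_prim_cong: "(\<And>u. u < x \<Longrightarrow> \<phi> u = \<psi> u) \<Longrightarrow> nn_prim \<phi> x = nn_prim \<psi> x"
  unfolding nn_prim_def by (intro nn_integral_cong) (simp add: indicator_def)

lemma nn_prim_mono: "(\<And>u. u < x \<Longrightarrow> \<phi> u \<le> \<psi> u) \<Longrightarrow> nn_prim \<phi> x \<le> nn_prim \<psi> x"
  unfolding nn_prim_def by (intro nn_integral_mono) (simp add: indicator_def)

lemma nn_prim_incseq: "x \<le> y \<Longrightarrow> nn_prim \<phi> x \<le> nn_prim \<phi> y"
  unfolding nn_prim_def by (intro nn_integral_mono) (simp add: indicator_def)

lemma measurable_nn_prim2:
  assumes [measurable]: "case_prod \<phi> \<in> borel_measurable (N \<Otimes>\<^sub>M borel)"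
  shows "(\<lambda>(s, x). nn_prim (\<phi> s) x) \<in> borel_measurable (N \<Otimes>\<^sub>M borel)"
  unfolding nn_prim_def indicator_def lessThan_iff by measurable

lemma measurable_nn_prim [measurable]:
  assumes [measurable]: "\<phi> \<in> borel_measurable borel"
  shows "nn_prim \<phi> \<in> borel_measurable borel"
  unfolding nn_prim_def[abs_def] indicator_def lessThan_iff by measurable

lemma nn_prim_split:
  assumes [measurable]: "\<phi> \<in> borel_measurable borel" and "c \<le> d"
  shows "nn_prim \<phi> d = nn_prim \<phi> c + (\<integral>\<^sup>+u\<in>{c..<d}. \<phi> u \<partial>lborel)"
  unfolding nn_prim_def using assms(2)
  by (subst nn_integral_add[symmetric]) (auto intro!: nn_integral_cong simp: indicator_def)

lemma nn_prim_sum: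
  assumes "finite A" "\<And>j. j \<in> A \<Longrightarrow> \<phi> j \<in> borel_measurable borel" "\<psi> \<in> borel_measurable borel"
  shows "nn_prim (\<lambda>u. (\<Sum>j\<in>A. c j * \<phi> j u) + \<psi> u) x = (\<Sum>j\<in>A. c j * nn_prim (\<phi> j) x) + nn_prim \<psi> x"
proof -
  note [measurable] = assms(2,3)
  have "nn_prim (\<lambda>u. (\<Sum>j\<in>A. c j * \<phi> j u) + \<psi> u) x =
      (\<integral>\<^sup>+u. (\<Sum>j\<in>A. c j * (\<phi> j u * indicator {..<x} u)) + \<psi> u * indicator {..<x} u \<partial>lborel)"
    unfolding nn_prim_def by (intro nn_integral_cong) (simp add: distrib_right sum_distrib_right mult.assoc)
  also have "\<dots> = (\<Sum>j\<in>A. c j * nn_prim (\<phi> j) x) + nn_prim \<psi> x"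
    unfolding nn_prim_def
    by (subst nn_integral_add) (auto simp: nn_integral_sum nn_integral_cmult intro!: borel_measurable_sum)
  finally show ?thesis .
qed

context gauged_interval
begin

text \<open>The passage from [0, \<infinity>] to signed integrals between points of I: finite values
  of the primitive make \<phi> integrable over {c..<d}, and its increments are the integrals over
  {c..<d}.\<close>

lemma nn_prim_real:
  assumes [measurable]: "\<phi> \<in> borel_measurable borel"
    and fin: "\<And>u. \<phi> u < \<infinity>" "\<And>x. x \<in> I \<Longrightarrow> nn_prim \<phi> x < \<infinity>"
  shows "loc_integrable I (\<lambda>u. enn2real (\<phi> u))"
    and "x \<in> I \<Longrightarrow> z \<in> I \<Longrightarrow> enn2real (nn_prim \<phi> x) = enn2real (nn_prim \<phi> z) + (LBINT u=ereal z..ereal x. enn2real (\<phi> u))"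
proof -
  have eq: "ennreal (norm (indicat_real {c..<d} u *\<^sub>R enn2real (\<phi> u))) = \<phi> u * indicator {c..<d} u"
    "ennreal (indicat_real {c..<d} u *\<^sub>R enn2real (\<phi> u)) = \<phi> u * indicator {c..<d} u" for c d u
    using fin(1)[of u] by (simp_all add: indicator_def)
  have I: "set_integrable lborel {c..<d} (\<lambda>u. enn2real (\<phi> u))" if "c \<in> I" "d \<in> I" "c \<le> d" for c d
    unfolding set_integrable_def
  proof (rule integrableI_bounded)
    have "(\<integral>\<^sup>+u\<in>{c..<d}. \<phi> u \<partial>lborel) \<le> nn_prim \<phi> d"
      using nn_prim_split[OF assms(1) that(3)] by simp
    then show "(\<integral>\<^sup>+u. ennreal (norm (indicat_real {c..<d} u *\<^sub>R enn2real (\<phi> u))) \<partial>lborel) < \<infinity>"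
      unfolding eq using fin(2)[OF that(2)] by (auto intro: le_less_trans)
  qed measurable
  show "loc_integrable I (\<lambda>u. enn2real (\<phi> u))"
  proof -
    have "interval_lebesgue_integrable lborel (ereal c) (ereal d) (\<lambda>u. enn2real (\<phi> u))"
      if "c \<in> I" "d \<in> I" "c \<le> d" for c d
      using set_integrable_subset[OF I[OF that], of "{c<..<d}"] that(3)
      by (auto simp: interval_lebesgue_integrable_def subset_eq)
    then show ?thesis
      unfolding loc_integrable_def using interval_integrable_endpoints_reverse by (meson linear)
  qed
  have E: "enn2real (nn_prim \<phi> d) = enn2real (nn_prim \<phi> c) + (LBINT u=ereal c..ereal d. enn2real (\<phi> u))"
    if "c \<in> I" "d \<in> I" "c \<le> d" for c d
  proof -
    have "(LBINT u=ereal c..ereal d. enn2real (\<phi> u)) = (LBINT u:{c..<d}. enn2real (\<phi> u))"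
      using that(3) by (rule interval_integral_Ico)
    also have "\<dots> = enn2real (\<integral>\<^sup>+u\<in>{c..<d}. \<phi> u \<partial>lborel)"
      unfolding set_lebesgue_integral_def eq(2)[symmetric] by (rule integral_eq_nn_integral) auto
    finally show ?thesis
      using nn_prim_split[OF assms(1) that(3)] fin(2)[OF that(1)] fin(2)[OF that(2)]
      by (simp add: enn2real_plus)
  qed
  show "enn2real (nn_prim \<phi> x) = enn2real (nn_prim \<phi> z) + (LBINT u=ereal z..ereal x. enn2real (\<phi> u))"
    if "x \<in> I" "z \<in> I"
  proof (cases "z \<le> x")
    case True
    then show ?thesis using E[OF that(2,1)] by blast
  next
    case False
    then show ?thesis using E[of x z] that interval_integral_endpoints_reverse[of "ereal z" "ereal x" "\<lambda>u. enn2real (\<phi> u)"]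
      by linarith
  qed
qed

text \<open>With the weights extended by \<open>0\<close> off \<open>I\<close>, integration from the left endpoint, or from the point
  where an integrand starts to be nonzero, becomes integration over \<open>{..<x}\<close>.\<close>

definition wn :: "nat \<Rightarrow> real \<Rightarrow> ennreal" where
  "wn j x = ennreal (w j x) * indicator I x"

lemma wn_measurable [measurable]: "wn j \<in> borel_measurable borel"
proof -
  have "(\<lambda>x. w j x * indicator I x) \<in> borel_measurable borel"
    using w_Bor[of j] unfolding Bor_def by (subst (asm) borel_measurable_restrict_space_iff) (auto simp: mult.commute)
  then have "(\<lambda>x. ennreal (w j x * indicator I x)) \<in> borel_measurable borel" by simp
  also have "(\<lambda>x. ennreal (w j x * indicator I x)) = wn j"
    by (auto simp: wn_def indicator_def)
  finally show ?thesis .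
qed

lemma wn_I: "x \<in> I \<Longrightarrow> wn j x = ennreal (w j x)"
  and wn_notI: "x \<notin> I \<Longrightarrow> wn j x = 0"
  by (simp_all add: wn_def)

text \<open>Written out: w_i times the integral of w_(i+1) times ... times the integral of w_m
  \<phi>. For \<phi> = 1 this is p_(a;i,m); for \<phi> the indicator of {t..} it is
  p^+_(t;i,m).\<close>

function nn_iter :: "nat \<Rightarrow> nat \<Rightarrow> (real \<Rightarrow> ennreal) \<Rightarrow> real \<Rightarrow> ennreal" where
  "nn_iter i m \<phi> = (if i < m then (\<lambda>x. wn i x * nn_prim (nn_iter (Suc i) m \<phi>) x) else (\<lambda>x. wn m x * \<phi> x))"
  by pat_completeness auto
termination by (relation "Wellfounded.measure (\<lambda>(i, m, \<phi>). m - i)") auto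

declare nn_iter.simps [simp del]

lemma nn_iter_base: "nn_iter m m \<phi> = (\<lambda>x. wn m x * \<phi> x)"
  by (subst nn_iter.simps) simp

lemma nn_iter_less: "i < m \<Longrightarrow> nn_iter i m \<phi> = (\<lambda>x. wn i x * nn_prim (nn_iter (Suc i) m \<phi>) x)"
  by (subst nn_iter.simps) simp

lemma nn_iter_outside: "i \<le> m \<Longrightarrow> x \<notin> I \<Longrightarrow> nn_iter i m \<phi> x = 0"
  by (cases "i = m") (simp_all add: nn_iter_base nn_iter_less wn_notI)

lemma nn_iter_zero: "i \<le> m \<Longrightarrow> nn_iter i m (\<lambda>_. 0) = (\<lambda>_. 0)"
  by (induction i rule: inc_induct) (simp_all add: nn_iter_base nn_iter_less nn_prim_def)

lemma measurable_nn_iter2: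
  assumes [measurable]: "case_prod \<phi> \<in> borel_measurable (N \<Otimes>\<^sub>M borel)" and "i \<le> m"
  shows "(\<lambda>(s, x). nn_iter i m (\<phi> s) x) \<in> borel_measurable (N \<Otimes>\<^sub>M borel)"
  using assms(2)
proof (induction i rule: inc_induct)
  case (step i)
  note [measurable] = step.IH
  show ?case unfolding nn_iter_less[OF step.hyps(2)] using measurable_nn_prim2[OF step.IH] by measurable
qed (simp add: nn_iter_base)

lemma measurable_nn_iter:
  assumes [measurable]: "\<phi> \<in> borel_measurable borel" and "i \<le> m"
  shows "nn_iter i m \<phi> \<in> borel_measurable borel"
  using assms(2)
proof (induction i rule: inc_induct)
  case (step i)
  note [measurable] = step.IH
  show ?case unfolding nn_iter_less[OF step.hyps(2)] by measurable
qed (simp add: nn_iter_base)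

lemma nn_iter_cong:
  assumes "i \<le> m" "\<And>u. u \<in> I \<Longrightarrow> u \<le> x \<Longrightarrow> \<phi> u = \<psi> u"
  shows "nn_iter i m \<phi> x = nn_iter i m \<psi> x"
  using assms
proof (induction i arbitrary: x rule: inc_induct)
  case base
  then show ?case by (cases "x \<in> I") (simp_all add: nn_iter_base wn_notI)
next
  case (step i)
  have "nn_prim (nn_iter (Suc i) m \<phi>) x = nn_prim (nn_iter (Suc i) m \<psi>) x"
    by (rule nn_prim_cong) (auto intro!: step.IH step.prems)
  then show ?case using step.hyps by (simp add: nn_iter_less)
qed

lemma nn_iter_mono:
  assumes "i \<le> m" "\<And>u. u \<in> I \<Longrightarrow> u \<le> x \<Longrightarrow> \<phi> u \<le> \<psi> u"
  shows "nn_iter i m \<phi> x \<le> nn_iter i m \<psi> x"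
  using assms
proof (induction i arbitrary: x rule: inc_induct)
  case base
  then show ?case by (cases "x \<in> I") (simp_all add: nn_iter_base wn_notI mult_left_mono)
next
  case (step i)
  have "nn_prim (nn_iter (Suc i) m \<phi>) x \<le> nn_prim (nn_iter (Suc i) m \<psi>) x"
    by (rule nn_prim_mono) (auto intro!: step.IH step.prems)
  then show ?case using step.hyps by (simp add: nn_iter_less mult_left_mono)
qed

text \<open>One interchange of Lebesgue measure with N per level. Applied to the indicators of
  {t..}, it moves the Stieltjes integral over t to the innermost level, where it becomes the mass of
  an interval.\<close>

lemma nn_iter_Tonelli:
  assumes "sigma_finite_measure N" and \<phi>: "case_prod \<phi> \<in> borel_measurable (N \<Otimes>\<^sub>M borel)" and "i \<le> m"
  shows "(\<integral>\<^sup>+s. nn_iter i m (\<phi> s) x \<partial>N) = nn_iter i m (\<lambda>x. \<integral>\<^sup>+s. \<phi> s x \<partial>N) x"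
  using assms(3)
proof (induction i arbitrary: x rule: inc_induct)
  case base
  note [measurable] = \<phi>
  have "(\<lambda>s. \<phi> s x) \<in> borel_measurable N" by measurable
  then show ?case by (simp add: nn_iter_base nn_integral_cmult)
next
  case (step i)
  interpret N: sigma_finite_measure N by fact
  interpret pair_sigma_finite N lborel ..
  have 1[measurable]: "(\<lambda>(s, x). nn_iter (Suc i) m (\<phi> s) x) \<in> borel_measurable (N \<Otimes>\<^sub>M borel)"
    using measurable_nn_iter2[OF \<phi>, of "Suc i" m] step.hyps by simp
  have 2: "(\<lambda>s. nn_prim (nn_iter (Suc i) m (\<phi> s)) x) \<in> borel_measurable N"
    using measurable_nn_prim2[OF 1] by measurable
  have "(\<integral>\<^sup>+s. nn_iter i m (\<phi> s) x \<partial>N) = wn i x * (\<integral>\<^sup>+s. nn_prim (nn_iter (Suc i) m (\<phi> s)) x \<partial>N)"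
    using step.hyps 2 by (simp add: nn_iter_less nn_integral_cmult)
  also have "(\<integral>\<^sup>+s. nn_prim (nn_iter (Suc i) m (\<phi> s)) x \<partial>N) =
      (\<integral>\<^sup>+s. (\<integral>\<^sup>+u. nn_iter (Suc i) m (\<phi> s) u * indicator {..<x} u \<partial>lborel) \<partial>N)"
    unfolding nn_prim_def ..
  also have "\<dots> = (\<integral>\<^sup>+u. (\<integral>\<^sup>+s. nn_iter (Suc i) m (\<phi> s) u * indicator {..<x} u \<partial>N) \<partial>lborel)"
    by (rule Fubini'[symmetric]) measurable
  also have "\<dots> = (\<integral>\<^sup>+u. (\<integral>\<^sup>+s. nn_iter (Suc i) m (\<phi> s) u \<partial>N) * indicator {..<x} u \<partial>lborel)"
    by (intro nn_integral_cong nn_integral_multc) measurable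
  also have "\<dots> = nn_prim (nn_iter (Suc i) m (\<lambda>x. \<integral>\<^sup>+s. \<phi> s x \<partial>N)) x"
    unfolding nn_prim_def step.IH ..
  finally show ?case using step.hyps by (simp add: nn_iter_less)
qed

text \<open>Monotone convergence on each level. It provides the limit for knots decreasing to a at a
  stage where values may still be infinite.\<close>

lemma nn_iter_SUP:
  assumes "\<And>n. \<phi> n \<in> borel_measurable borel" "incseq \<phi>" "i \<le> m"
  shows "nn_iter i m (\<lambda>x. SUP n. \<phi> n x) x = (SUP n. nn_iter i m (\<phi> n) x)"
  using assms(3)
proof (induction i arbitrary: x rule: inc_induct)
  case base
  then show ?case by (simp add: nn_iter_base SUP_mult_left_ennreal)
next
  case (step i)
  have i: "Suc i \<le> m" using step.hyps by simp
  have m: "nn_iter (Suc i) m (\<phi> n) u \<le> nn_iter (Suc i) m (\<phi> n') u" if "n \<le> n'" for n n' u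
    using incseqD[OF assms(2) that] by (intro nn_iter_mono[OF i]) (auto simp: le_fun_def)
  have "nn_prim (nn_iter (Suc i) m (\<lambda>x. SUP n. \<phi> n x)) x =
      (\<integral>\<^sup>+u. (SUP n. nn_iter (Suc i) m (\<phi> n) u * indicator {..<x} u) \<partial>lborel)"
    unfolding nn_prim_def step.IH by (simp add: SUP_mult_right_ennreal)
  also have "\<dots> = (SUP n. nn_prim (nn_iter (Suc i) m (\<phi> n)) x)"
    unfolding nn_prim_def
  proof (rule nn_integral_monotone_convergence_SUP)
    show "incseq (\<lambda>n u. nn_iter (Suc i) m (\<phi> n) u * indicator {..<x} u)"
      using m by (auto simp: incseq_def le_fun_def intro!: mult_right_mono)
    show "(\<lambda>u. nn_iter (Suc i) m (\<phi> n) u * indicator {..<x} u) \<in> borel_measurable lborel" for n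
      using measurable_nn_iter[OF assms(1) i, of n] by measurable
  qed
  finally show ?case using step.hyps by (simp add: nn_iter_less SUP_mult_left_ennreal)
qed

text \<open>Such functions vanish to the left of a point of \<open>I\<close>, which makes all iterated integrals finite.\<close>

definition bounded_from :: "real \<Rightarrow> (real \<Rightarrow> ennreal) \<Rightarrow> bool" where
  "bounded_from y \<phi> \<longleftrightarrow> (\<forall>u\<in>I. u < y \<longrightarrow> \<phi> u = 0) \<and> (\<forall>d\<in>I. \<exists>C. \<forall>u\<in>I. u \<le> d \<longrightarrow> \<phi> u \<le> ennreal C)"

lemma bounded_from_wn:
  assumes "y \<in> I" "bounded_from y \<phi>" shows "bounded_from y (\<lambda>u. wn j u * \<phi> u)"
  unfolding bounded_from_def
proof (intro conjI ballI impI)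
  fix u assume "u \<in> I" "u < y" then show "wn j u * \<phi> u = 0" using assms by (simp add: bounded_from_def)
next
  fix d assume d: "d \<in> I"
  obtain C where C: "\<And>u. u \<in> I \<Longrightarrow> u \<le> d \<Longrightarrow> \<phi> u \<le> ennreal C" using assms d unfolding bounded_from_def by blast
  obtain B where B: "0 < B" "\<And>x. x \<in> {y..d} \<Longrightarrow> w j x \<le> B" using w_bound[OF assms(1) d] by blast
  show "\<exists>C. \<forall>u\<in>I. u \<le> d \<longrightarrow> wn j u * \<phi> u \<le> ennreal C"
  proof (intro exI ballI impI)
    fix u assume u: "u \<in> I" "u \<le> d"
    \<comment> \<open>The weight is bounded by B only on {y..d}; to the left of y the factor \<phi>
      u is 0.\<close>
    show "wn j u * \<phi> u \<le> ennreal (B * max C 0)"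
    proof (cases "u < y")
      case False
      have "wn j u * \<phi> u \<le> ennreal B * ennreal (max C 0)"
        using B(2)[of u] C[OF u] u False by (intro mult_mono) (auto simp: wn_I ennreal_leI intro: order_trans)
      then show ?thesis using B(1) by (simp add: ennreal_mult)
    qed (use u assms in \<open>simp add: bounded_from_def\<close>)
  qed
qed

lemma bounded_from_nn_prim:
  assumes "y \<in> I" "bounded_from y \<phi>" "\<And>u. u \<notin> I \<Longrightarrow> \<phi> u = 0"
  shows "bounded_from y (nn_prim \<phi>)"
proof -
  have z: "\<phi> u = 0" if "u < y" for u using assms that unfolding bounded_from_def by (cases "u \<in> I") auto
  have "\<exists>C. \<forall>u\<in>I. u \<le> d \<longrightarrow> nn_prim \<phi> u \<le> ennreal C" if d: "d \<in> I" for d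
  proof -
    obtain C where C: "\<And>u. u \<in> I \<Longrightarrow> u \<le> d \<Longrightarrow> \<phi> u \<le> ennreal C" using assms d unfolding bounded_from_def by blast
    \<comment> \<open>Height times length of {y..d}; the second \<open>max\<close> covers d <
      y.\<close>
    have "nn_prim \<phi> u \<le> ennreal (max C 0 * max (d - y) 0)" if "u \<in> I" "u \<le> d" for u
    proof -
      have "nn_prim \<phi> u \<le> (\<integral>\<^sup>+v. ennreal (max C 0) * indicator {y..max d y} v \<partial>lborel)"
        unfolding nn_prim_def
      proof (rule nn_integral_mono)
        fix v
        show "\<phi> v * indicator {..<u} v \<le> ennreal (max C 0) * indicator {y..max d y} v"
        proof (cases "v \<in> I \<and> y \<le> v \<and> v < u")
          case True
          then have "\<phi> v \<le> ennreal (max C 0)" using C[of v] that by (auto intro: order_trans ennreal_leI)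
          then show ?thesis using True that by (simp add: indicator_def)
        next
          case False
          then have "\<phi> v = 0 \<or> \<not> v < u" using z[of v] assms(3)[of v] by linarith
          then show ?thesis by auto
        qed
      qed
      also have "\<dots> = ennreal (max C 0) * ennreal (max d y - y)"
        by (simp add: nn_integral_cmult)
      also have "max d y - y = max (d - y) 0" by simp
      finally show ?thesis by (simp add: ennreal_mult)
    qed
    then show ?thesis by blast
  qed
  moreover have "nn_prim \<phi> u = 0" if "u < y" for u
  proof -
    have "nn_prim \<phi> u = nn_prim (\<lambda>_. 0) u" by (rule nn_prim_cong) (use z that in auto)
    then show ?thesis by (simp add: nn_prim_def)
  qed
  ultimately show ?thesis by (auto simp: bounded_from_def)
qed

lemma bounded_from_nn_iter:
  assumes "y \<in> I" "bounded_from y \<phi>" "i \<le> m"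
  shows "bounded_from y (nn_iter i m \<phi>)"
  using assms(3)
proof (induction i rule: inc_induct)
  case base
  then show ?case using bounded_from_wn[OF assms(1,2)] by (simp add: nn_iter_base)
next
  case (step i)
  have "bounded_from y (nn_prim (nn_iter (Suc i) m \<phi>))"
    by (rule bounded_from_nn_prim[OF assms(1) step.IH]) (use step.hyps in \<open>simp add: nn_iter_outside\<close>)
  then show ?case using bounded_from_wn[OF assms(1)] step.hyps by (simp add: nn_iter_less)
qed

lemma bounded_from_finite: "bounded_from y \<phi> \<Longrightarrow> u \<in> I \<Longrightarrow> \<phi> u < \<infinity>"
  unfolding bounded_from_def by (metis ennreal_less_top infinity_ennreal_def le_less_trans order_refl)

text \<open>For t \<le> x all integrands are nonnegative, so the negative part in
  \<open>ext_integral\<close> is 0 and the recursion becomes that of \<open>nn_iter\<close>.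
  Integrating over the open interval from t to x or over {..<x} makes a difference at most at the
  point t, a null set.\<close>

lemma p_fun_eq:
  assumes "left_end I \<le> t" "t \<le> ereal x" "x \<in> I" "j \<le> m"
  shows "p_fun w t j m x = enn2ereal (nn_iter j m (\<lambda>u. if t \<le> ereal u then 1 else 0) x)"
  using assms(4,2,3)
proof (induction j arbitrary: x rule: inc_induct)
  case base
  then show ?case using w_pos[of x m]
    by (subst p_fun.simps) (simp add: nn_iter_base wn_I enn2ereal_ennreal less_imp_le)
next
  case (step j)
  define N where "N = nn_iter (Suc j) m (\<lambda>u. if t \<le> ereal u then 1 else 0)"
  have N: "p_fun w t (Suc j) m u = enn2ereal (N u)" if "u \<in> einterval t (ereal x)" for u
  proof -
    have "u \<in> I" using mem_if_le[of u x] that step.prems assms(1) by (auto simp: einterval_iff)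
    then show ?thesis unfolding N_def using step.IH that by (simp add: einterval_iff less_imp_le)
  qed
  have z: "N u = 0" if "ereal u < t" for u
  proof -
    have "N u = nn_iter (Suc j) m (\<lambda>_. 0) u"
      unfolding N_def using step.hyps that
      by (intro nn_iter_cong) (auto simp: not_le elim: order_le_less_trans[rotated])
    then show ?thesis using step.hyps by (simp add: nn_iter_zero)
  qed
  \<comment> \<open>If t is infinite, \<open>real_of_ereal t\<close> is 0; excluding this point is
    harmless and avoids a case distinction.\<close>
  have "AE u in lborel. u \<noteq> real_of_ereal t" by (rule AE_lborel_singleton)
  then have ae: "AE u in lborel. e2ennreal (p_fun w t (Suc j) m u) * indicator (einterval t (ereal x)) u = N u * indicator {..<x} u"
  proof eventually_elim
    fix u assume u: "u \<noteq> real_of_ereal t"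
    consider "ereal u < t" | "u \<in> einterval t (ereal x)" | "x \<le> u"
    proof -
      have "ereal u \<noteq> t" using u by auto
      then have "ereal u < t \<or> t < ereal u" by (rule neq_iff[THEN iffD1])
      then show ?thesis using that by (cases "u < x") (auto simp: einterval_iff not_less)
    qed
    then show "e2ennreal (p_fun w t (Suc j) m u) * indicator (einterval t (ereal x)) u = N u * indicator {..<x} u"
    proof cases
      case 1 then show ?thesis by (auto simp: z einterval_iff indicator_def)
    next
      case 2 then show ?thesis by (simp add: N e2ennreal_enn2ereal einterval_iff)
    next
      case 3 then show ?thesis by (simp add: einterval_iff)
    qed
  qed
  have neg: "e2ennreal (- p_fun w t (Suc j) m u) * indicator (einterval t (ereal x)) u = 0" for u
    by (cases "u \<in> einterval t (ereal x)") (auto simp: N e2ennreal_neg)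
  have "ext_integral (einterval t (ereal x)) (p_fun w t (Suc j) m) = enn2ereal (nn_prim N x)"
    unfolding ext_integral_def neg nn_prim_def by (subst nn_integral_cong_AE[OF ae]) (simp add: zero_ennreal.rep_eq)
  then show ?case
    using step.prems step.hyps w_pos[of x j]
    by (subst p_fun.simps) (simp add: ext_integral_from_to_def nn_iter_less N_def[symmetric] wn_I
        times_ennreal.rep_eq enn2ereal_ennreal less_imp_le)
qed

lemma p_fun_left_end:
  assumes "x \<in> I" "j \<le> m"
  shows "p_fun w (left_end I) j m x = enn2ereal (nn_iter j m (\<lambda>_. 1) x)"
  using p_fun_eq[OF order_refl left_end_le[OF assms(1)] assms]
    nn_iter_cong[OF assms(2), of x "\<lambda>u. if left_end I \<le> ereal u then 1 else 0" "\<lambda>_. 1"] left_end_le by simp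

lemma p_plus_eq:
  assumes "t \<in> I" "x \<in> I" "j \<le> m"
  shows "p_plus w (ereal t) j m x = enn2ereal (nn_iter j m (indicator {t..}) x)"
proof -
  have eq: "(\<lambda>u. if ereal t \<le> ereal u then 1 else 0) = (indicator {t..} :: real \<Rightarrow> ennreal)"
    by (auto simp: indicator_def)
  have bf: "bounded_from t (indicator {t..})" unfolding bounded_from_def by (auto intro!: exI[of _ 1] simp: indicator_def)
  show ?thesis
  proof (cases "t \<le> x")
    case True
    then show ?thesis using p_fun_eq[of "ereal t" x j m] assms left_end_le
      unfolding eq by (simp add: p_plus_def)
  next
    case False
    then show ?thesis using bounded_from_nn_iter[OF assms(1) bf assms(3)] assms
      by (simp add: p_plus_def bounded_from_def zero_ennreal.rep_eq)
  qed
qed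

lemma F_idx_eq: "F_idx I w k n = {j \<in> {k..n}. \<forall>x\<in>I. nn_iter k j (\<lambda>_. 1) x < \<infinity>}"
  unfolding F_idx_def
  by (auto simp: p_fun_left_end less_ennreal.rep_eq top_ennreal.rep_eq infinity_ennreal_def)

text \<open>Level k of the tower that belongs to \<open>p_az I w z 0 k j\<close>; tower entries
  carry no leading weight, hence the division. Infinite values are sent to 0, so this is meaningful
  for j in \<open>F_idx\<close>.\<close>

definition p_left :: "nat \<Rightarrow> nat \<Rightarrow> real \<Rightarrow> real" where
  "p_left k j x = enn2real (nn_iter k j (\<lambda>_. 1) x) / w k x"

lemma w_p_left: "x \<in> I \<Longrightarrow> w k x * p_left k j x = enn2real (nn_iter k j (\<lambda>_. 1) x)"
  using w_pos[of x k] by (simp add: p_left_def)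

lemma nn_iter_one_prim:
  "k < j \<Longrightarrow> x \<in> I \<Longrightarrow> p_left k j x = enn2real (nn_prim (nn_iter (Suc k) j (\<lambda>_. 1)) x)"
  using w_pos[of x k] by (simp add: p_left_def nn_iter_less wn_I enn2real_mult)

text \<open>For j = k the function is 1 on I. For j > k it is a nondecreasing primitive, bounded on
  {c..d} by its value at d, which is finite because j lies in \<open>F_idx\<close> and w_k(d) >
  0.\<close>

lemma p_left_regular:
  assumes "j \<in> F_idx I w k n"
  shows "p_left k j \<in> Bor I" "loc_integrable I (\<lambda>x. w k x * p_left k j x)"
proof -
  have j: "k \<le> j" and fin: "\<And>x. x \<in> I \<Longrightarrow> nn_iter k j (\<lambda>_. 1) x < \<infinity>" using assms by (auto simp: F_idx_eq)
  have "nn_iter k j (\<lambda>_. 1) \<in> borel_measurable borel" using measurable_nn_iter[OF _ j] by simp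
  then have "(\<lambda>x. enn2real (nn_iter k j (\<lambda>_. 1) x)) \<in> Bor I"
    unfolding Bor_def by (intro measurable_restrict_space1) measurable
  then have "(\<lambda>x. w k x * p_left k j x) \<in> Bor I"
    by (rule Bor_cong[THEN iffD1, rotated]) (simp add: w_p_left)
  then show B: "p_left k j \<in> Bor I" by (simp add: Bor_mult_w_iff)
  show "loc_integrable I (\<lambda>x. w k x * p_left k j x)"
  proof (rule loc_integrable_w_mult[OF B])
    fix c d assume cd: "c \<in> I" "d \<in> I" "c \<le> d"
    show "\<exists>B. \<forall>x\<in>{c..d}. \<bar>p_left k j x\<bar> \<le> B"
    proof (cases "k = j")
      case True
      have "p_left k j x = 1" if "x \<in> {c..d}" for x
        using w_pos[of x k] Icc_subset[OF cd(1,2)] that True by (auto simp: p_left_def nn_iter_base wn_I)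
      then show ?thesis by (intro exI[of _ 1]) simp
    next
      case False
      then have kj: "k < j" using j by simp
      let ?J = "nn_prim (nn_iter (Suc k) j (\<lambda>_. 1))"
      have "?J d < \<infinity>" using fin[OF cd(2)] w_pos[OF cd(2), of k] cd(2)
        by (auto simp: nn_iter_less[OF kj] wn_I ennreal_mult_less_top less_top)
      then have "\<bar>p_left k j x\<bar> \<le> enn2real (?J d)" if "x \<in> {c..d}" for x
        using nn_iter_one_prim[OF kj, of x] subsetD[OF Icc_subset[OF cd(1,2)] that] that
        by (simp add: enn2real_mono nn_prim_incseq)
      then show ?thesis by blast
    qed
  qed
qed

lemma p_az_k: "p_az I w z k k j = (\<lambda>x. real_of_ereal (p_fun w (left_end I) k j x))"
  by (subst p_az.simps) simp

lemma p_az_less: "i < k \<Longrightarrow> p_az I w z i k j = (\<lambda>x. w i x * (LBINT u=ereal z..ereal x. p_az I w z (Suc i) k j u))"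
  by (subst p_az.simps) simp

lemma p_az_eq:
  assumes "z \<in> I" "k \<le> j" "i \<le> k" "x \<in> I"
  shows "p_az I w z i k j x = w i x * tint z (\<lambda>_. 0) (p_left k j) k i x"
  using assms(3,4)
proof (induction i arbitrary: x rule: inc_induct)
  case base
  then show ?case
    using p_fun_left_end[OF base(1) assms(2)] w_p_left[OF base(1), of k j]
    by (simp only: tint_k p_az_k enn2real_def)
next
  case (step i)
  have "(LBINT u=ereal z..ereal x. p_az I w z (Suc i) k j u) =
      (LBINT u=ereal z..ereal x. w (Suc i) u * tint z (\<lambda>_. 0) (p_left k j) k (Suc i) u)"
    by (rule LBINT_cong[OF assms(1) step.prems]) (rule step.IH)
  then show ?case using step.hyps(2) by (simp only: p_az_less tint_less add_0)
qed

end

section \<open>The left endpoint and the Lebesgue--Stieltjes measure\<close>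

context nontrivial_interval
begin

lemma left_end_cases:
  obtains "left_end I = -\<infinity>" | a where "left_end I = ereal a"
proof (cases "left_end I")
  case PInf
  then show ?thesis using nontrivial left_end_le by fastforce
qed (use that in auto)

text \<open>A common description for finite and infinite left endpoint, which spares most later
  arguments the case distinction.\<close>

lemma eventually_down:
  "eventually P (down_to_left_end I) \<longleftrightarrow>
    (\<exists>c. left_end I < ereal c \<and> (\<forall>y. left_end I < ereal y \<and> y < c \<longrightarrow> P y))"
proof (rule left_end_cases)
  assume "left_end I = -\<infinity>"
  then show ?thesis by (simp add: down_to_left_end_def eventually_at_bot_dense)
next
  fix a assume "left_end I = ereal a"
  then show ?thesis by (auto simp: down_to_left_end_def eventually_at_right_field)
qed

lemma down_nontrivial: "down_to_left_end I \<noteq> bot"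
  by (auto simp: down_to_left_end_def)

lemma filterlim_down:
  assumes "\<And>i. left_end I < ereal (c i)" "\<And>y. left_end I < ereal y \<Longrightarrow> \<forall>\<^sub>F i in sequentially. c i < y"
  shows "filterlim c (down_to_left_end I) sequentially"
  unfolding filterlim_iff eventually_down
proof (intro allI impI, elim exE conjE)
  fix P c0 assume c0: "left_end I < ereal c0" "\<forall>y. left_end I < ereal y \<and> y < c0 \<longrightarrow> P y"
  from assms(2)[OF c0(1)] show "\<forall>\<^sub>F i in sequentially. P (c i)"
    by eventually_elim (use c0(2) assms(1) in blast)
qed

text \<open>For a monotone h, a limit along one sequence approaching a is the limit along the
  filter. So convergence theorems for integrals, which speak of sequences, suffice.\<close>

lemma tendsto_down_mono:
  fixes h :: "real \<Rightarrow> real"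
  assumes mono: "mono_on {y. left_end I < ereal y \<and> y \<le> z} h"
    and c: "\<And>i. left_end I < ereal (c i)" "\<And>i. c i \<le> z" "\<And>y. left_end I < ereal y \<Longrightarrow> \<forall>\<^sub>F i in sequentially. c i < y"
    and lim: "(\<lambda>i. h (c i)) \<longlonglongrightarrow> l"
  shows "(h \<longlongrightarrow> l) (down_to_left_end I)"
proof (rule order_tendstoI)
  have ge: "l \<le> h y" if y: "left_end I < ereal y" "y \<le> z" for y
  proof (rule tendsto_upperbound[OF lim])
    show "\<forall>\<^sub>F i in sequentially. h (c i) \<le> h y"
      using c(3)[OF y(1)] by eventually_elim (rule mono_onD[OF mono], use c y in auto)
  qed simp
  have az: "left_end I < ereal z" using order_less_le_trans[OF c(1)] c(2) by (metis ereal_less_eq(3))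
  fix b assume b: "b < l"
  show "\<forall>\<^sub>F y in down_to_left_end I. b < h y"
    unfolding eventually_down using b ge az by (intro exI[of _ z]) (auto intro: less_le_trans)
next
  fix b assume b: "l < b"
  have "\<forall>\<^sub>F i in sequentially. h (c i) < b" using order_tendstoD(2)[OF lim b] .
  then obtain i where i: "h (c i) < b" by (auto simp: eventually_sequentially)
  have "h y < b" if "left_end I < ereal y" "y < c i" for y
    using mono_onD[OF mono, of y "c i"] that c(1,2)[of i] i by auto
  then show "\<forall>\<^sub>F y in down_to_left_end I. h y < b"
    unfolding eventually_down using c(1)[of i] by blast
qed

lemma approximating_sequences:
  assumes "left_end I < ereal z" "ereal z < right_end I"
  obtains c d where "decseq c" "\<And>i. c i \<in> I" "\<And>i. left_end I < ereal (c i)" "\<And>i. c i \<le> z"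
    "\<And>y. left_end I < ereal y \<Longrightarrow> \<forall>\<^sub>F i in sequentially. c i < y"
    "incseq d" "\<And>i. d i \<in> I" "\<And>x. x \<in> I \<Longrightarrow> \<forall>\<^sub>F i in sequentially. x \<le> d i"
proof -
  have zI: "z \<in> I" using mem_if_strictly_between[OF assms] .
  obtain c where c: "decseq c" "\<And>i. left_end I < ereal (c i)" "\<And>i. ereal (c i) < ereal z"
    "(\<lambda>i. ereal (c i)) \<longlonglongrightarrow> left_end I" using ereal_decseq_approx[OF assms(1)] by blast
  have ev: "\<forall>\<^sub>F i in sequentially. c i < y" if "left_end I < ereal y" for y
    using order_tendstoD(2)[OF c(4) that] by simp
  have cI: "c i \<in> I" for i using mem_if_le[OF c(2)[of i] _ zI] c(3)[of i] by simp
  obtain d where d: "incseq d" "\<And>i. d i \<in> I" "\<And>x. x \<in> I \<Longrightarrow> \<forall>\<^sub>F i in sequentially. x \<le> d i"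
  proof (cases "\<exists>b\<in>I. right_end I = ereal b")
    case True
    then obtain b where b: "b \<in> I" "right_end I = ereal b" by blast
    \<comment> \<open>A sequence staying strictly below b would never reach x = b; the constant
      sequence does.\<close>
    show ?thesis by (rule that[of "\<lambda>_. b"]) (use b le_right_end in \<open>auto simp: incseq_def\<close>)
  next
    case False
    obtain d where d: "incseq d" "\<And>i. ereal z < ereal (d i)" "\<And>i. ereal (d i) < right_end I"
      "(\<lambda>i. ereal (d i)) \<longlonglongrightarrow> right_end I" using ereal_incseq_approx[OF assms(2)] by blast
    show ?thesis
    proof (rule that[OF d(1)])
      show "d i \<in> I" for i
        by (rule mem_if_strictly_between[OF less_trans[OF assms(1) d(2)] d(3)])
      fix x assume "x \<in> I"
      then have "ereal x < right_end I" using le_right_end False by (metis order.not_eq_order_implies_strict)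
      from order_tendstoD(1)[OF d(4) this] show "\<forall>\<^sub>F i in sequentially. x \<le> d i"
        by eventually_elim simp
    qed
  qed
  show ?thesis by (rule that[OF c(1) cI c(2) _ ev d]) (use c(3) in \<open>simp add: less_imp_le\<close>)
qed

lemma interior_nonempty: obtains z where "left_end I < ereal z" "ereal z < right_end I"
proof -
  obtain x y where "x \<in> I" "y \<in> I" "x < y" using nontrivial by blast
  then have "left_end I < ereal ((x + y) / 2)" "ereal ((x + y) / 2) < right_end I"
    using le_less_trans[OF left_end_le, of x "ereal ((x + y) / 2)"]
      less_le_trans[OF _ le_right_end, of "ereal ((x + y) / 2)" y] by auto
  then show ?thesis by (rule that)
qed

text \<open>Along a decreasing sequence the values of h decrease and are bounded below by 0. If a
  belongs to I, the filter is \<open>at_right\<close> at a, and right-continuity identifies the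
  limit with the value there.\<close>

lemma Lim_down:
  fixes h :: "real \<Rightarrow> real"
  assumes "mono_on I h" "\<And>x. x \<in> I \<Longrightarrow> 0 \<le> h x"
  shows "(h \<longlongrightarrow> Lim (down_to_left_end I) h) (down_to_left_end I)"
    and "0 \<le> Lim (down_to_left_end I) h"
    and "x \<in> I \<Longrightarrow> left_end I < ereal x \<Longrightarrow> Lim (down_to_left_end I) h \<le> h x"
    and "x \<in> I \<Longrightarrow> left_end I = ereal x \<Longrightarrow> h \<in> RC I \<Longrightarrow> Lim (down_to_left_end I) h = h x"
proof -
  obtain z where z: "left_end I < ereal z" "ereal z < right_end I" by (rule interior_nonempty)
  obtain c d where cd: "decseq c" "\<And>i. c i \<in> I" "\<And>i. left_end I < ereal (c i)" "\<And>i. c i \<le> z"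
    "\<And>y. left_end I < ereal y \<Longrightarrow> \<forall>\<^sub>F i in sequentially. c i < y"
    using approximating_sequences[OF z] by metis
  have dec: "decseq (\<lambda>i. h (c i))"
    using cd(1,2) assms(1) by (auto simp: decseq_def mono_on_def)
  obtain l where l: "(\<lambda>i. h (c i)) \<longlonglongrightarrow> l"
    using decseq_convergent[OF dec, of 0] assms(2)[OF cd(2)] by blast
  have zI: "z \<in> I" using mem_if_strictly_between[OF z] .
  have m: "mono_on {y. left_end I < ereal y \<and> y \<le> z} h"
    using assms(1) mem_if_le[OF _ _ zI] by (auto simp: mono_on_def)
  have L: "(h \<longlongrightarrow> l) (down_to_left_end I)" by (rule tendsto_down_mono[OF m cd(3,4,5) l])
  then have eq: "Lim (down_to_left_end I) h = l" by (rule tendsto_Lim[OF down_nontrivial])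
  show "(h \<longlongrightarrow> Lim (down_to_left_end I) h) (down_to_left_end I)" unfolding eq by (rule L)
  show "0 \<le> Lim (down_to_left_end I) h" unfolding eq
    by (rule LIMSEQ_le_const[OF l]) (use assms(2)[OF cd(2)] in blast)
  show "Lim (down_to_left_end I) h \<le> h x" if x: "x \<in> I" "left_end I < ereal x"
    unfolding eq
  proof (rule tendsto_upperbound[OF l])
    show "\<forall>\<^sub>F i in sequentially. h (c i) \<le> h x"
      using cd(5)[OF x(2)] by eventually_elim (rule mono_onD[OF assms(1)], use cd x in auto)
  qed simp
  show "Lim (down_to_left_end I) h = h x" if x: "x \<in> I" "left_end I = ereal x" "h \<in> RC I"
  proof -
    have "ereal x \<noteq> right_end I" using less_trans[OF z] x(2) by auto
    then have "(h \<longlongrightarrow> h x) (at_right x)" using x by (auto simp: RC_def continuous_within)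
    then show ?thesis unfolding eq using tendsto_unique[OF down_nontrivial L] x(2)
      by (simp add: down_to_left_end_def)
  qed
qed

section \<open>The Lebesgue-Stieltjes measure: existence, uniqueness, masses of intervals\<close>

definition is_LS :: "(real \<Rightarrow> real) \<Rightarrow> real measure \<Rightarrow> bool" where
  "is_LS F M \<longleftrightarrow> sets M = sets borel \<and>
     (\<forall>c\<in>I. \<forall>d\<in>I. c \<le> d \<longrightarrow> emeasure M {c<..d} = ennreal (F d - F c)) \<and>
     emeasure M (- {x \<in> I. left_end I < ereal x}) = 0"

lemma sets_inner [measurable]: "{x \<in> I. left_end I < ereal x} \<in> sets borel"
  by measurable

text \<open>The Lebesgue--Stieltjes measure is the image of Lebesgue measure on the interval between the
  infimum and the supremum of \<open>F\<close> under the generalized inverse of \<open>F\<close>.\<close>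

lemma is_LS_exists:
  assumes mono: "mono_on I F" and rc: "\<And>x. x \<in> I \<Longrightarrow> ereal x \<noteq> right_end I \<Longrightarrow> continuous (at_right x) F"
  shows "\<exists>M. is_LS F M"
proof -
  \<comment> \<open>The levels that F crosses inside I. A point c with F c < u bounds the infimum in
    G u from below and keeps G u strictly to the right of the left endpoint.\<close>
  define U where "U = {u. (\<exists>c\<in>I. F c < u) \<and> (\<exists>d\<in>I. u \<le> F d)}"
  define G where "G = (\<lambda>u. Inf {x \<in> I. u \<le> F x})"
  have bdd: "bdd_below {x \<in> I. u \<le> F x}" if "c \<in> I" "F c < u" for c u
  proof (rule bdd_belowI)
    fix x assume "x \<in> {x \<in> I. u \<le> F x}"
    then show "c \<le> x" using mono_onD[OF mono, of x c] that by (cases "c \<le> x") auto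
  qed
  have G: "G u \<in> I \<and> u \<le> F (G u) \<and> left_end I < ereal (G u)" if u: "u \<in> U" for u
  proof -
    obtain c d where c: "c \<in> I" "F c < u" and d: "d \<in> I" "u \<le> F d" using u by (auto simp: U_def)
    have cx: "c \<le> x" if "x \<in> I" "u \<le> F x" for x
      using mono_onD[OF mono, of x c] that c by (cases "c \<le> x") auto
    have gd: "G u \<le> d" unfolding G_def by (rule cInf_lower[OF _ bdd[OF c]]) (use d in simp)
    have cg: "c \<le> G u" unfolding G_def by (rule cInf_greatest) (use d cx in auto)
    have gI: "G u \<in> I" by (rule between_mem[OF c(1) d(1) cg gd])
    \<comment> \<open>Right-continuity makes the infimum attained: otherwise F < u on a right
      neighbourhood of G u, and the infimum would be larger.\<close>
    have le: "u \<le> F (G u)"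
    proof (rule ccontr)
      assume "\<not> u \<le> F (G u)"
      then have lt: "F (G u) < u" by simp
      then have "G u < d" using gd d by (cases "G u = d") auto
      then have "ereal (G u) \<noteq> right_end I" using le_right_end[OF d(1)] by (metis ereal_less(3) ereal_less_eq(3) leD)
      then have "(F \<longlongrightarrow> F (G u)) (at_right (G u))" using rc[OF gI] by (simp add: continuous_within)
      then have "\<forall>\<^sub>F x in at_right (G u). F x < u" using lt by (rule order_tendstoD)
      then obtain e where e: "G u < e" "\<And>x. G u < x \<Longrightarrow> x < e \<Longrightarrow> F x < u" by (auto simp: eventually_at_right_field)
      have "e \<le> Inf {x \<in> I. u \<le> F x}"
      proof (rule cInf_greatest)
        show "{x \<in> I. u \<le> F x} \<noteq> {}" using d by auto
        fix x assume x: "x \<in> {x \<in> I. u \<le> F x}"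
        then have "G u \<le> x" unfolding G_def by (intro cInf_lower[OF _ bdd[OF c]])
        then show "e \<le> x" using e(2)[of x] x lt by (cases "G u = x") force+
      qed
      then show False using e(1) by (simp add: G_def)
    qed
    have "c \<noteq> G u" using c le by auto
    then have "ereal c < ereal (G u)" using cg by simp
    then show ?thesis using le_less_trans[OF left_end_le[OF c(1)]] gI le by blast
  qed
  \<comment> \<open>The Galois connection between G and F. It makes G monotone, hence Borel, and
    gives {F c<..F d} as the preimage of {c<..d}.\<close>
  have G_iff: "G u \<le> d \<longleftrightarrow> u \<le> F d" if u: "u \<in> U" and d: "d \<in> I" for u d
  proof
    assume "G u \<le> d" then show "u \<le> F d" using mono_onD[OF mono, of "G u" d] G[OF u] d by auto
  next
    obtain c where c: "c \<in> I" "F c < u" using u by (auto simp: U_def)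
    assume "u \<le> F d" then show "G u \<le> d" unfolding G_def by (intro cInf_lower[OF _ bdd[OF c]]) (use d in simp)
  qed
  have "is_interval U" unfolding is_interval_1 U_def by (blast intro: less_le_trans order_trans)
  then have U[measurable]: "U \<in> sets borel" by (simp add: is_interval_convex_1 real_interval_borel_measurable)
  have "mono_on U G"
  proof (rule mono_onI)
    fix u v assume "u \<in> U" "v \<in> U" "u \<le> v"
    then show "G u \<le> G v" using G_iff[of u "G v"] G[of v] by auto
  qed
  then have "G \<in> borel_measurable (restrict_space borel U)" by (rule borel_measurable_mono_on_fnc)
  then have Gm[measurable]: "G \<in> measurable (restrict_space lborel U) borel"
    by (simp cong: measurable_cong_sets sets_restrict_space_cong)
  let ?M = "distr (restrict_space lborel U) borel G"
  have em: "emeasure ?M A = emeasure lborel (G -` A \<inter> U)" if "A \<in> sets borel" for A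
    using that U by (subst emeasure_distr) (auto simp: space_restrict_space emeasure_restrict_space Int_commute)
  have "is_LS F ?M"
    unfolding is_LS_def
  proof (intro conjI ballI impI)
    show "sets ?M = sets borel" by simp
    fix c d assume cd: "c \<in> I" "d \<in> I" "c \<le> d"
    have "G -` {c<..d} \<inter> U = {F c<..F d}"
    proof (intro set_eqI)
      fix u
      have "u \<in> U" if "F c < u" "u \<le> F d" using that cd by (auto simp: U_def)
      then show "u \<in> G -` {c<..d} \<inter> U \<longleftrightarrow> u \<in> {F c<..F d}"
        using G_iff[of u c] G_iff[of u d] cd by (auto simp: not_le[symmetric])
    qed
    then show "emeasure ?M {c<..d} = ennreal (F d - F c)"
      using em[of "{c<..d}"] mono_onD[OF mono cd] by simp
  next
    have "G -` (- {x \<in> I. left_end I < ereal x}) \<inter> U = {}" using G by auto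
    then show "emeasure ?M (- {x \<in> I. left_end I < ereal x}) = 0"
      using em[of "- {x \<in> I. left_end I < ereal x}"] by simp
  qed
  then show ?thesis by blast
qed

lemma inner_Union:
  assumes "\<And>i. c i \<in> I" "\<And>i. left_end I < ereal (c i)"
    "\<And>y. left_end I < ereal y \<Longrightarrow> \<forall>\<^sub>F i in sequentially. c i < y"
    "\<And>i. d i \<in> I" "\<And>x. x \<in> I \<Longrightarrow> \<forall>\<^sub>F i in sequentially. x \<le> d i"
  shows "{x \<in> I. left_end I < ereal x} = (\<Union>i::nat. {c i<..d i})"
proof (intro set_eqI iffI)
  fix x assume x: "x \<in> {x \<in> I. left_end I < ereal x}"
  then have "\<forall>\<^sub>F i in sequentially. c i < x \<and> x \<le> d i" using assms(3)[of x] assms(5)[of x] by (simp add: eventually_conj)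
  then show "x \<in> (\<Union>i::nat. {c i<..d i})" by (auto simp: eventually_sequentially)
next
  fix x assume "x \<in> (\<Union>i::nat. {c i<..d i})"
  then obtain i where i: "c i < x" "x \<le> d i" by auto
  then show "x \<in> {x \<in> I. left_end I < ereal x}"
    using between_mem[OF assms(1,4), of i x i] less_trans[OF assms(2)[of i], of "ereal x"] by simp
qed

lemma is_LS_sets: "is_LS F M \<Longrightarrow> sets M = sets borel"
  by (simp add: is_LS_def)

lemma is_LS_emeasure: "is_LS F M \<Longrightarrow> c \<in> I \<Longrightarrow> d \<in> I \<Longrightarrow> c \<le> d \<Longrightarrow> emeasure M {c<..d} = ennreal (F d - F c)"
  by (simp add: is_LS_def)

lemma is_LS_cong_set:
  assumes "is_LS F M" "A \<in> sets borel" "B \<in> sets borel"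
    and "\<And>t. t \<in> I \<Longrightarrow> left_end I < ereal t \<Longrightarrow> t \<in> A \<longleftrightarrow> t \<in> B"
  shows "emeasure M A = emeasure M B"
proof (rule emeasure_eq_AE)
  have "- {x \<in> I. left_end I < ereal x} \<in> null_sets M"
    using assms(1) by (auto simp: is_LS_def intro!: null_setsI)
  then have "AE t in M. t \<notin> - {x \<in> I. left_end I < ereal x}" by (rule AE_not_in)
  then show "AE t in M. t \<in> A \<longleftrightarrow> t \<in> B" by eventually_elim (use assms(4) in auto)
qed (use assms is_LS_sets in auto)

text \<open>The measures may be infinite near the endpoints of I. They are therefore compared on
  {a<..b} with a, b in I, where both are finite and agree on half-lines; exhausting I minus its left
  endpoint by such intervals gives equality on all Borel sets.\<close>

lemma is_LS_unique:
  assumes "is_LS F M" "is_LS F N"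
  shows "M = N"
proof (rule measure_eqI)
  have sM: "sets M = sets borel" and sN: "sets N = sets borel" using assms by (auto simp: is_LS_def)
  note [measurable_cong] = sM sN
  show "sets M = sets N" using sM sN by simp
  obtain z where z: "left_end I < ereal z" "ereal z < right_end I" by (rule interior_nonempty)
  obtain c d where cd: "decseq c" "\<And>i. c i \<in> I" "\<And>i. left_end I < ereal (c i)" "\<And>i. c i \<le> z"
    "\<And>y. left_end I < ereal y \<Longrightarrow> \<forall>\<^sub>F i in sequentially. c i < y"
    "incseq d" "\<And>i. d i \<in> I" "\<And>x. x \<in> I \<Longrightarrow> \<forall>\<^sub>F i in sequentially. x \<le> d i"
    using approximating_sequences[OF z] by metis
  let ?O = "{x \<in> I. left_end I < ereal x}"
  have U: "?O = (\<Union>i. {c i<..d i})" by (rule inner_Union[OF cd(2,3,5,7,8)])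
  have D: "density M (indicator {a<..b}) = density N (indicator {a<..b})" if ab: "a \<in> I" "b \<in> I" for a b
  proof (rule measure_eqI_lessThan)
    have e: "emeasure (density L (indicator {a<..b})) {x<..} = ennreal (if max x a \<le> b then F b - F (max x a) else 0)"
      if "is_LS F L" for L x
    proof -
      have s: "sets L = sets borel" using that by (simp add: is_LS_def)
      have "emeasure (density L (indicator {a<..b})) {x<..} = emeasure L ({a<..b} \<inter> {x<..})"
        using s by (subst emeasure_density) (auto simp: indicator_inter_arith[symmetric] nn_integral_indicator)
      also have "{a<..b} \<inter> {x<..} = {max x a<..b}" by auto
      also have "emeasure L {max x a<..b} = ennreal (if max x a \<le> b then F b - F (max x a) else 0)"
      proof (cases "max x a \<le> b")
        case True
        then have "max x a \<in> I" using between_mem[OF ab, of "max x a"] by simp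
        then show ?thesis using that True ab by (simp add: is_LS_def)
      next
        case False
        then have "b \<le> max x a" by linarith
        then have e: "{max x a<..b} = {}" by (rule greaterThanAtMost_empty)
        show ?thesis unfolding e if_not_P[OF False] by simp
      qed
      finally show ?thesis .
    qed
    show "emeasure (density M (indicator {a<..b})) {x<..} = emeasure (density N (indicator {a<..b})) {x<..}" for x
      using e[OF assms(1)] e[OF assms(2)] by simp
    show "emeasure (density M (indicator {a<..b})) {x<..} < \<infinity>" for x using e[OF assms(1)] by simp
  qed (simp_all add: sM sN)
  fix A assume "A \<in> sets M"
  then have A[measurable]: "A \<in> sets borel" using sM by simp
  have L: "emeasure L A = (SUP i. emeasure (density L (indicator {c i<..d i})) A)" if "is_LS F L" for L
  proof -
    note s[measurable_cong] = is_LS_sets[OF that]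
    have "emeasure L A = emeasure L (\<Union>i. A \<inter> {c i<..d i})"
    proof (rule is_LS_cong_set[OF that])
      fix t assume "t \<in> I" "left_end I < ereal t"
      then have "t \<in> (\<Union>i. {c i<..d i})" unfolding U[symmetric] by simp
      then show "t \<in> A \<longleftrightarrow> t \<in> (\<Union>i. A \<inter> {c i<..d i})" by auto
    qed auto
    also have "\<dots> = (SUP i. emeasure L (A \<inter> {c i<..d i}))"
    proof (rule SUP_emeasure_incseq[symmetric])
      show "incseq (\<lambda>i. A \<inter> {c i<..d i})"
      proof (intro incseq_SucI subsetI)
        fix i t assume "t \<in> A \<inter> {c i<..d i}"
        then show "t \<in> A \<inter> {c (Suc i)<..d (Suc i)}"
          using decseqD[OF cd(1), of i "Suc i"] incseqD[OF cd(6), of i "Suc i"] by auto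
      qed
    qed (auto simp: s)
    also have "(\<lambda>i. emeasure L (A \<inter> {c i<..d i})) = (\<lambda>i. emeasure (density L (indicator {c i<..d i})) A)"
    proof
      fix i
      have "emeasure (density L (indicator {c i<..d i})) A = (\<integral>\<^sup>+t. indicator (A \<inter> {c i<..d i}) t \<partial>L)"
        by (subst emeasure_density) (auto simp: s indicator_inter_arith[symmetric] Int_commute)
      then show "emeasure L (A \<inter> {c i<..d i}) = emeasure (density L (indicator {c i<..d i})) A" by (simp add: s)
    qed
    finally show ?thesis .
  qed
  show "emeasure M A = emeasure N A"
    unfolding L[OF assms(1)] L[OF assms(2)] D[OF cd(2,7)] ..
qed

lemma LS_measure_is_LS:
  assumes "mono_on I F" "\<And>x. x \<in> I \<Longrightarrow> ereal x \<noteq> right_end I \<Longrightarrow> continuous (at_right x) F"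
  shows "is_LS F (LS_measure I F)"
proof -
  have "LS_measure I F = (THE M. is_LS F M)" by (simp add: LS_measure_def is_LS_def)
  then show ?thesis using theI'[of "is_LS F"] is_LS_exists[OF assms] is_LS_unique by auto
qed

text \<open>Prepares Tonelli's theorem. The cover consists of the null complement and the intervals
  {c i<..d i} of finite mass.\<close>

lemma is_LS_sigma_finite:
  assumes "is_LS F M" shows "sigma_finite_measure M"
proof
  have s: "sets M = sets borel" and null: "emeasure M (- {x \<in> I. left_end I < ereal x}) = 0"
    and e: "\<And>c d. c \<in> I \<Longrightarrow> d \<in> I \<Longrightarrow> c \<le> d \<Longrightarrow> emeasure M {c<..d} = ennreal (F d - F c)"
    using assms by (auto simp: is_LS_def)
  obtain z where z: "left_end I < ereal z" "ereal z < right_end I" by (rule interior_nonempty)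
  obtain c d where cd: "decseq c" "\<And>i. c i \<in> I" "\<And>i. left_end I < ereal (c i)" "\<And>i. c i \<le> z"
    "\<And>y. left_end I < ereal y \<Longrightarrow> \<forall>\<^sub>F i in sequentially. c i < y"
    "incseq d" "\<And>i. d i \<in> I" "\<And>x. x \<in> I \<Longrightarrow> \<forall>\<^sub>F i in sequentially. x \<le> d i"
    using approximating_sequences[OF z] by metis
  have U: "{x \<in> I. left_end I < ereal x} = (\<Union>i. {c i<..d i})" by (rule inner_Union[OF cd(2,3,5,7,8)])
  have "emeasure M {c i<..d i} \<noteq> \<infinity>" for i
    using e[OF cd(2,7), of i i] by (cases "c i \<le> d i") auto
  then show "\<exists>A. countable A \<and> A \<subseteq> sets M \<and> \<Union> A = space M \<and> (\<forall>a\<in>A. emeasure M a \<noteq> \<infinity>)"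
    using null s sets_eq_imp_space_eq[OF s]
    by (intro exI[of _ "insert (- {x \<in> I. left_end I < ereal x}) (range (\<lambda>i. {c i<..d i}))"]) (auto simp: U)
qed

text \<open>Since y lies strictly to the right of a, there is some c < y in I, and {y..x} is
  contained in {c<..x}.\<close>

lemma is_LS_finite:
  assumes "is_LS F M" "y \<in> I" "left_end I < ereal y" "x \<in> I"
  shows "emeasure M {y..x} < \<infinity>"
proof -
  obtain c where c: "c \<in> I" "c < y" using left_end_less_obtain[OF assms(3)] by blast
  have "emeasure M {y..x} \<le> emeasure M {c<..x}"
    using c is_LS_sets[OF assms(1)] by (intro emeasure_mono) auto
  also have "\<dots> < \<infinity>"
  proof (cases "c \<le> x")
    case True
    then show ?thesis using is_LS_emeasure[OF assms(1) c(1) assms(4)] by simp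
  qed simp
  finally show ?thesis .
qed

text \<open>The constant \<open>F y - measure M {y}\<close> is the left limit F(y-), expressed
  through the atom at y.\<close>

lemma is_LS_Icc:
  assumes "is_LS F M" "mono_on I F" "y \<in> I" "left_end I < ereal y" "x \<in> I"
  shows "measure M {y..x} = (if y \<le> x then F x - (F y - measure M {y}) else 0)"
proof (cases "y \<le> x")
  case True
  have fin: "emeasure M {y} < \<infinity>" using is_LS_finite[OF assms(1,3,4,3)] by simp
  have e: "emeasure M {y<..x} = ennreal (F x - F y)" by (rule is_LS_emeasure[OF assms(1,3,5) True])
  have "measure M ({y} \<union> {y<..x}) = measure M {y} + measure M {y<..x}"
    using fin e is_LS_sets[OF assms(1)] by (intro measure_Union) auto
  moreover have "{y} \<union> {y<..x} = {y..x}" using True by auto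
  moreover have "measure M {y<..x} = F x - F y"
    using e mono_onD[OF assms(2,3,5) True] by (simp add: measure_def)
  ultimately show ?thesis using True by simp
qed simp

lemma is_LS_Ioo:
  assumes "is_LS F M" "mono_on I F" "y \<in> I" "left_end I < ereal y" "x \<in> I" "x < y"
  shows "measure M {x<..<y} = F y - measure M {y} - F x"
proof -
  have e: "emeasure M {x<..y} = ennreal (F y - F x)"
    by (rule is_LS_emeasure[OF assms(1,5,3)]) (use assms in simp)
  have fin: "emeasure M {y} < \<infinity>" using is_LS_finite[OF assms(1,3,4,3)] by simp
  have "emeasure M {x<..<y} \<le> emeasure M {x<..y}"
    using is_LS_sets[OF assms(1)] by (intro emeasure_mono) auto
  then have fin': "emeasure M {x<..<y} < \<infinity>" using e le_less_trans by fastforce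
  have "measure M ({x<..<y} \<union> {y}) = measure M {x<..<y} + measure M {y}"
    using fin fin' is_LS_sets[OF assms(1)] by (intro measure_Union) auto
  moreover have "{x<..<y} \<union> {y} = {x<..y}" using assms by auto
  moreover have "measure M {x<..y} = F y - F x"
    using e mono_onD[OF assms(2,5,3)] assms(6) by (simp add: measure_def)
  ultimately show ?thesis by simp
qed

text \<open>Up to a null set, {..x} is exhausted by {c i<..x}, and F (c i) tends to F(a+). If x is
  the left endpoint, both sides are 0, the right one by right-continuity.\<close>

lemma is_LS_atMost:
  assumes "is_LS F M" "mono_on I F" "\<And>x. x \<in> I \<Longrightarrow> 0 \<le> F x" "F \<in> RC I" "x \<in> I"
  shows "emeasure M {..x} = ennreal (F x - Lim (down_to_left_end I) F)"
proof (cases "left_end I < ereal x")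
  case False
  then have eq: "left_end I = ereal x" using left_end_le[OF assms(5)] by simp
  have "emeasure M {..x} = emeasure M {}"
    by (rule is_LS_cong_set[OF assms(1)]) (auto simp: eq)
  then show ?thesis using Lim_down(4)[OF assms(2,3,5) eq assms(4)] by simp
next
  case True
  obtain z where z: "left_end I < ereal z" "ereal z < right_end I" by (rule interior_nonempty)
  obtain c d where cd: "decseq c" "\<And>i. c i \<in> I" "\<And>i. left_end I < ereal (c i)" "\<And>i. c i \<le> z"
    "\<And>y. left_end I < ereal y \<Longrightarrow> \<forall>\<^sub>F i in sequentially. c i < y"
    using approximating_sequences[OF z] by metis
  have "(\<lambda>i. emeasure M {c i<..x}) \<longlonglongrightarrow> emeasure M (\<Union>i. {c i<..x})"
  proof (rule Lim_emeasure_incseq)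
    show "incseq (\<lambda>i. {c i<..x})"
    proof (intro incseq_SucI subsetI)
      fix i t assume "t \<in> {c i<..x}"
      then show "t \<in> {c (Suc i)<..x}" using decseqD[OF cd(1), of i "Suc i"] by simp
    qed
  qed (auto simp: is_LS_sets[OF assms(1)])
  also have "emeasure M (\<Union>i. {c i<..x}) = emeasure M {..x}"
  proof (rule is_LS_cong_set[OF assms(1)])
    fix t assume "t \<in> I" "left_end I < ereal t"
    then have "\<exists>i. c i < t" using cd(5)[of t] by (auto simp: eventually_sequentially)
    then show "t \<in> (\<Union>i. {c i<..x}) \<longleftrightarrow> t \<in> {..x}" by auto
  qed auto
  finally have 1: "(\<lambda>i. emeasure M {c i<..x}) \<longlonglongrightarrow> emeasure M {..x}" .
  have 2: "(\<lambda>i. ennreal (F x - F (c i))) \<longlonglongrightarrow> ennreal (F x - Lim (down_to_left_end I) F)"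
    using filterlim_compose[OF Lim_down(1)[OF assms(2,3)] filterlim_down[OF cd(3,5)]]
    by (intro tendsto_ennrealI tendsto_diff tendsto_const)
  have "\<forall>\<^sub>F i in sequentially. emeasure M {c i<..x} = ennreal (F x - F (c i))"
    using cd(5)[OF True] by eventually_elim (rule is_LS_emeasure[OF assms(1) cd(2) assms(5)], simp)
  from tendsto_cong[OF this] 2 have "(\<lambda>i. emeasure M {c i<..x}) \<longlonglongrightarrow> ennreal (F x - Lim (down_to_left_end I) F)" by simp
  with 1 show ?thesis by (rule LIMSEQ_unique)
qed

text \<open>The cut-off can create a jump only at y, seen from the left. As y is strictly below the
  right endpoint b, left-continuity at b is unaffected.\<close>

lemma RC_truncated:
  assumes "F \<in> RC I" "ereal y < right_end I"
  shows "(\<lambda>x. if y \<le> x then F x - K else 0) \<in> RC I"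
  unfolding RC_def
proof (intro CollectI conjI ballI impI)
  let ?g = "\<lambda>x. if y \<le> x then F x - K else 0"
  fix x assume x: "x \<in> I" "ereal x \<noteq> right_end I"
  show "continuous (at_right x) ?g"
  proof (cases "y \<le> x")
    case True
    have "(F \<longlongrightarrow> F x) (at_right x)" using assms(1) x by (auto simp: RC_def continuous_within)
    then have "((\<lambda>u. F u - K) \<longlongrightarrow> F x - K) (at_right x)" by (intro tendsto_diff tendsto_const)
    moreover have "\<forall>\<^sub>F u in at_right x. F u - K = ?g u"
      using eventually_at_right_less[of x] by eventually_elim (use True in auto)
    ultimately show ?thesis using True by (simp add: continuous_within tendsto_cong)
  next
    case False
    then have "\<forall>\<^sub>F u in at_right x. u < y" by (intro eventually_at_rightI[of x y]) auto
    then have "\<forall>\<^sub>F u in at_right x. 0 = ?g u" by eventually_elim simp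
    then have "(?g \<longlongrightarrow> 0) (at_right x)" by (rule Lim_transform_eventually[OF tendsto_const])
    then show ?thesis using False by (simp add: continuous_within)
  qed
next
  let ?g = "\<lambda>x. if y \<le> x then F x - K else 0"
  fix x assume x: "x \<in> I" "ereal x = right_end I"
  then have y: "y < x" using assms(2) by (metis ereal_less(3) less_ereal.simps(1))
  have "(F \<longlongrightarrow> F x) (at_left x)" using assms(1) x by (auto simp: RC_def continuous_within)
  then have "((\<lambda>u. F u - K) \<longlongrightarrow> F x - K) (at_left x)" by (intro tendsto_diff tendsto_const)
  moreover have "\<forall>\<^sub>F u in at_left x. y < u" using y by (intro eventually_at_leftI[of y x]) auto
  then have "\<forall>\<^sub>F u in at_left x. F u - K = ?g u" by eventually_elim simp
  ultimately show "continuous (at_left x) ?g" using y by (simp add: continuous_within tendsto_cong)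
qed

end

section \<open>Weighted derivatives of the Stieltjes integral in \<open>g_tilde\<close>\<close>

context gauged_interval
begin

lemma measurable_wn_mult:
  assumes "g \<in> Bor I" shows "(\<lambda>u. wn j u * ennreal (g u)) \<in> borel_measurable borel"
proof -
  have [measurable]: "(\<lambda>x. indicat_real I x * g x) \<in> borel_measurable borel"
    using assms unfolding Bor_def by (subst (asm) borel_measurable_restrict_space_iff) auto
  have "(\<lambda>u. wn j u * ennreal (indicat_real I u * g u)) \<in> borel_measurable borel" by measurable
  also have "(\<lambda>u. wn j u * ennreal (indicat_real I u * g u)) = (\<lambda>u. wn j u * ennreal (g u))"
    by (auto simp: indicator_def wn_def)
  finally show ?thesis .
qed

text \<open>Integrating p^+_(t;n,n) / w_n, the indicator of {t..}, over t \<ge> y leaves the mass of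
  {y..x}; it is thus the n-th weighted derivative of the integral in \<open>g_tilde\<close>.\<close>

definition step_mass :: "real measure \<Rightarrow> real \<Rightarrow> real \<Rightarrow> ennreal" where
  "step_mass M y x = emeasure M {y..x}"

lemma measurable_step_mass:
  assumes "is_LS F M" shows "step_mass M y \<in> borel_measurable borel"
proof -
  interpret sigma_finite_measure M by (rule is_LS_sigma_finite[OF assms])
  have s[measurable_cong]: "sets M = sets borel" using is_LS_sets[OF assms] .
  have "(\<lambda>x. \<integral>\<^sup>+t. (if y \<le> t \<and> t \<le> x then 1 else 0) \<partial>M) \<in> borel_measurable borel" by measurable
  also have "(\<lambda>x. \<integral>\<^sup>+t. (if y \<le> t \<and> t \<le> x then 1 else 0) \<partial>M) = step_mass M y"
  proof
    fix x
    have "(\<integral>\<^sup>+t. (if y \<le> t \<and> t \<le> x then 1 else 0) \<partial>M) = (\<integral>\<^sup>+t. indicator {y..x} t \<partial>M)"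
      by (intro nn_integral_cong) (simp add: indicator_def)
    then show "(\<integral>\<^sup>+t. (if y \<le> t \<and> t \<le> x then 1 else 0) \<partial>M) = step_mass M y x"
      by (simp add: step_mass_def s)
  qed
  finally show ?thesis .
qed

lemma bounded_from_step_mass:
  assumes "is_LS F M" "y \<in> I" "left_end I < ereal y"
  shows "bounded_from y (step_mass M y)"
  unfolding bounded_from_def
proof (intro conjI ballI impI)
  fix d assume d: "d \<in> I"
  show "\<exists>C. \<forall>u\<in>I. u \<le> d \<longrightarrow> step_mass M y u \<le> ennreal C"
  proof (intro exI ballI impI)
    fix u assume "u \<in> I" "u \<le> d"
    then have "step_mass M y u \<le> emeasure M {y..d}"
      unfolding step_mass_def using is_LS_sets[OF assms(1)] by (intro emeasure_mono) auto
    also have "\<dots> = ennreal (measure M {y..d})"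
      using is_LS_finite[OF assms d] by (intro emeasure_eq_ennreal_measure) auto
    finally show "step_mass M y u \<le> ennreal (measure M {y..d})" .
  qed
qed (simp add: step_mass_def)

text \<open>\<open>p_plus\<close> is \<open>nn_iter\<close> of the indicator of {t..}.
  \<open>nn_iter_Tonelli\<close> moves the integral over t inside, where the constraints y \<le> t
  and t \<le> x combine to the mass of {y..x}.\<close>

lemma LS_integral_p_plus:
  assumes "is_LS F M" "y \<in> I" "left_end I < ereal y" "x \<in> I"
  shows "(LINT t:I \<inter> {y..}|M. real_of_ereal (p_plus w (ereal t) 0 n x)) =
    enn2real (nn_iter 0 n (step_mass M y) x)"
proof -
  note s[measurable_cong] = is_LS_sets[OF assms(1)]
  \<comment> \<open>The factor in t makes the iterated integral vanish outside the domain of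
    integration, so that the set integral becomes one over the whole line.\<close>
  let ?\<phi> = "\<lambda>t x. indicator (I \<inter> {y..}) t * indicator {t..} x :: ennreal"
  have "(\<lambda>(t, x). ?\<phi> t x) = (\<lambda>(t, x). indicator (I \<inter> {y..}) t * (if t \<le> x then 1 else 0))"
    by (auto simp: indicator_def)
  then have m: "case_prod ?\<phi> \<in> borel_measurable (M \<Otimes>\<^sub>M borel)" by simp
  have m2: "(\<lambda>t. nn_iter 0 n (?\<phi> t) x) \<in> borel_measurable M"
    using measurable_nn_iter2[OF m, of 0 n] by measurable
  have eq: "indicat_real (I \<inter> {y..}) t *\<^sub>R real_of_ereal (p_plus w (ereal t) 0 n x) =
      enn2real (nn_iter 0 n (?\<phi> t) x)" for t
  proof (cases "t \<in> I \<inter> {y..}")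
    case True
    then have "?\<phi> t = indicator {t..}" and "t \<in> I" by auto
    then show ?thesis
      using True p_plus_eq[OF \<open>t \<in> I\<close> assms(4), of 0 n] by (simp only: enn2real_def indicator_simps) simp
  next
    case False
    then show ?thesis by (simp add: nn_iter_zero)
  qed
  have fin: "nn_iter 0 n (?\<phi> t) x < \<infinity>" for t
  proof (rule bounded_from_finite[OF bounded_from_nn_iter[OF assms(2)] assms(4)])
    show "bounded_from y (?\<phi> t)"
      unfolding bounded_from_def by (auto intro!: exI[of _ 1] simp: indicator_def)
  qed simp
  have "(LINT t:I \<inter> {y..}|M. real_of_ereal (p_plus w (ereal t) 0 n x)) =
      enn2real (\<integral>\<^sup>+t. ennreal (enn2real (nn_iter 0 n (?\<phi> t) x)) \<partial>M)"
    unfolding set_lebesgue_integral_def eq using m2 by (intro integral_eq_nn_integral) auto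
  also have "(\<integral>\<^sup>+t. ennreal (enn2real (nn_iter 0 n (?\<phi> t) x)) \<partial>M) = (\<integral>\<^sup>+t. nn_iter 0 n (?\<phi> t) x \<partial>M)"
    using fin by (intro nn_integral_cong ennreal_enn2real) (simp add: less_top)
  also have "\<dots> = nn_iter 0 n (\<lambda>x. \<integral>\<^sup>+t. ?\<phi> t x \<partial>M) x"
    by (rule nn_iter_Tonelli[OF is_LS_sigma_finite[OF assms(1)] m]) simp
  also have "\<dots> = nn_iter 0 n (step_mass M y) x"
  proof (rule nn_iter_cong)
    fix u assume u: "u \<in> I" "u \<le> x"
    have "(\<integral>\<^sup>+t. ?\<phi> t u \<partial>M) = (\<integral>\<^sup>+t. indicator {y..u} t \<partial>M)"
      using between_mem[OF assms(2) u(1)] by (intro nn_integral_cong) (auto simp: indicator_def)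
    then show "(\<integral>\<^sup>+t. ?\<phi> t u \<partial>M) = step_mass M y u" by (simp add: step_mass_def s)
  qed simp
  finally show ?thesis .
qed

text \<open>Level i of the tower for the Stieltjes integral in \<open>g_tilde\<close>. For a knot y
  in I above the left endpoint the values under \<open>enn2real\<close> are finite, by
  \<open>bounded_from_step_mass\<close>.\<close>

definition spline_part :: "nat \<Rightarrow> real measure \<Rightarrow> real \<Rightarrow> nat \<Rightarrow> real \<Rightarrow> real" where
  "spline_part n M y i x = enn2real (nn_iter i n (step_mass M y) x) / w i x"

lemma w_spline_part: "x \<in> I \<Longrightarrow> w i x * spline_part n M y i x = enn2real (nn_iter i n (step_mass M y) x)"
  using w_pos[of x i] by (simp add: spline_part_def)

lemma spline_part_less:
  "i < n \<Longrightarrow> x \<in> I \<Longrightarrow> spline_part n M y i x = enn2real (nn_prim (nn_iter (Suc i) n (step_mass M y)) x)"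
  using w_pos[of x i] by (simp add: spline_part_def nn_iter_less wn_I enn2real_mult)

lemma spline_part_last: "x \<in> I \<Longrightarrow> spline_part n M y n x = measure M {y..x}"
  using w_pos[of x n] by (simp add: spline_part_def nn_iter_base wn_I enn2real_mult step_mass_def measure_def)

lemma spline_part_Bor:
  assumes "is_LS F M" "i \<le> n" shows "spline_part n M y i \<in> Bor I"
proof -
  have [measurable]: "nn_iter i n (step_mass M y) \<in> borel_measurable borel"
    by (rule measurable_nn_iter[OF measurable_step_mass[OF assms(1)] assms(2)])
  have "(\<lambda>x. enn2real (nn_iter i n (step_mass M y) x)) \<in> Bor I"
    unfolding Bor_def by (intro measurable_restrict_space1) measurable
  then have "(\<lambda>x. w i x * spline_part n M y i x) \<in> Bor I"
    by (rule Bor_cong[THEN iffD1, rotated]) (simp add: w_spline_part)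
  then show ?thesis by (simp add: Bor_mult_w_iff)
qed

lemma spline_part_eq:
  assumes "is_LS F M" "y \<in> I" "left_end I < ereal y" "i < n"
  shows "loc_integrable I (\<lambda>x. w (Suc i) x * spline_part n M y (Suc i) x)"
    and "x \<in> I \<Longrightarrow> z \<in> I \<Longrightarrow> spline_part n M y i x = spline_part n M y i z +
      (LBINT u=ereal z..ereal x. w (Suc i) u * spline_part n M y (Suc i) u)"
proof -
  let ?\<phi> = "nn_iter (Suc i) n (step_mass M y)"
  have m: "?\<phi> \<in> borel_measurable borel"
    by (rule measurable_nn_iter[OF measurable_step_mass[OF assms(1)]]) (use assms(4) in simp)
  have b: "bounded_from y ?\<phi>"
    using bounded_from_nn_iter[OF assms(2) bounded_from_step_mass[OF assms(1-3)]] assms(4) by simp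
  have f1: "?\<phi> u < \<infinity>" for u
    using bounded_from_finite[OF b] nn_iter_outside[of "Suc i" n u] assms(4) by (cases "u \<in> I") auto
  have f2: "nn_prim ?\<phi> u < \<infinity>" if "u \<in> I" for u
    by (rule bounded_from_finite[OF bounded_from_nn_prim[OF assms(2) b] that])
      (use nn_iter_outside assms(4) in simp)
  show "loc_integrable I (\<lambda>x. w (Suc i) x * spline_part n M y (Suc i) x)"
    by (rule loc_integrable_cong[THEN iffD1, OF _ nn_prim_real(1)[OF m f1 f2]]) (simp_all add: w_spline_part)
  show "spline_part n M y i x = spline_part n M y i z +
      (LBINT u=ereal z..ereal x. w (Suc i) u * spline_part n M y (Suc i) u)" if "x \<in> I" "z \<in> I"
  proof -
    have "(LBINT u=ereal z..ereal x. enn2real (?\<phi> u)) =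
        (LBINT u=ereal z..ereal x. w (Suc i) u * spline_part n M y (Suc i) u)"
      by (rule LBINT_cong[OF that(2,1)]) (simp add: w_spline_part)
    then show ?thesis
      unfolding spline_part_less[OF assms(4) that(1)] spline_part_less[OF assms(4) that(2)]
      using nn_prim_real(2)[OF m f1 f2 that] by linarith
  qed
qed

text \<open>Below level n the functions are indefinite integrals, hence continuous. Level n is F -
  F(y-) cut off to the left of y and inherits its one-sided continuity from F; this is where F in
  \<open>RC\<close> enters.\<close>

lemma spline_part_tower:
  assumes "is_LS F M" "mono_on I F" "y \<in> I" "left_end I < ereal y" "ereal y < right_end I"
    and "m \<le> n" "0 < m \<Longrightarrow> m = n \<Longrightarrow> F \<in> RC I"
  shows "tower (spline_part n M y) m"
  unfolding tower_def
proof (intro conjI allI impI)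
  show "spline_part n M y 0 \<in> Bor I" by (rule spline_part_Bor[OF assms(1)]) simp
  fix j assume j: "j < m"
  note eq = spline_part_eq[OF assms(1,3,4)]
  show "is_wt_density I (w (Suc j)) (spline_part n M y j) (\<lambda>x. w (Suc j) x * spline_part n M y (Suc j) x)"
  proof (rule density_wI[OF _ _ _ assms(3)])
    show "spline_part n M y (Suc j) \<in> RC I"
    proof (cases "Suc j = n")
      case True
      have "(\<lambda>x. if y \<le> x then F x - (F y - measure M {y}) else 0) \<in> RC I"
        using j True assms(6,7) by (intro RC_truncated assms(5)) auto
      then show ?thesis
        by (rule RC_cong[rotated]) (simp add: True spline_part_last is_LS_Icc[OF assms(1-4)])
    next
      case False
      then have l: "Suc j < n" using j assms(6) by simp
      have "continuous_on I (\<lambda>x. spline_part n M y (Suc j) y +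
          (LBINT u=ereal y..ereal x. w (Suc (Suc j)) u * spline_part n M y (Suc (Suc j)) u))"
        by (intro continuous_on_add continuous_on_const indefinite_continuous_on eq(1)[OF l] assms(3))
      then have "continuous_on I (spline_part n M y (Suc j))"
        by (rule continuous_on_eq) (rule eq(2)[OF l _ assms(3), symmetric])
      then show ?thesis by (rule continuous_on_RC)
    qed
    show "spline_part n M y (Suc j) \<in> Bor I" using j assms(6) by (intro spline_part_Bor[OF assms(1)]) simp
    show "loc_integrable I (\<lambda>x. w (Suc j) x * spline_part n M y (Suc j) x)" using j assms(6) by (intro eq(1)) simp
    show "spline_part n M y j x = spline_part n M y j y +
        (LBINT u=ereal y..ereal x. w (Suc j) u * spline_part n M y (Suc j) u)" if "x \<in> I" for x
      using j assms(6) that by (intro eq(2) assms(3)) simp_all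
  qed
qed

section \<open>Taylor's formula at the left endpoint\<close>

text \<open>The integral identity on {c i..<x} with c i approaching a. Since G (Suc j) is
  nonnegative, the integrals increase to the one over {..<x}, and the limit makes sense before
  integrability at a is known.\<close>

lemma taylor_step:
  assumes "tower G m" "0 < j" "j < m" "mono_on I (G j)"
    and "\<And>x. x \<in> I \<Longrightarrow> 0 \<le> G j x" "\<And>x. x \<in> I \<Longrightarrow> 0 \<le> G (Suc j) x" and x: "x \<in> I"
  shows "ennreal (G j x) = ennreal (Lim (down_to_left_end I) (G j)) +
    nn_prim (\<lambda>u. wn (Suc j) u * ennreal (G (Suc j) u)) x"
    (is "_ = ennreal ?L + nn_prim ?\<phi> x")
proof (cases "left_end I < ereal x")
  case False
  then have eq: "left_end I = ereal x" using left_end_le[OF x] by simp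
  have "?\<phi> u = 0" if "u < x" for u
  proof -
    have "u \<notin> I" using left_end_le[of u] eq that by auto
    then show ?thesis by (simp add: wn_notI)
  qed
  then have "nn_prim ?\<phi> x = nn_prim (\<lambda>_. 0) x" by (rule nn_prim_cong)
  also have "\<dots> = 0" by (simp add: nn_prim_def)
  finally show ?thesis
    using Lim_down(4)[OF assms(4,5) x eq tower_RC[OF assms(1,2)]] assms(3) by simp
next
  case True
  have m: "?\<phi> \<in> borel_measurable borel"
    by (rule measurable_wn_mult[OF tower_Bor[OF assms(1)]]) (use assms(3) in simp)
  \<comment> \<open>With the integral viewed as a measure, the limit in the domain of integration is
    continuity from below.\<close>
  define \<nu> where "\<nu> = density lborel ?\<phi>"
  have \<nu>: "emeasure \<nu> A = (\<integral>\<^sup>+u\<in>A. ?\<phi> u \<partial>lborel)" if "A \<in> sets borel" for A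
    unfolding \<nu>_def using m that by (subst emeasure_density) auto
  obtain z where z: "left_end I < ereal z" "ereal z < right_end I" by (rule interior_nonempty)
  obtain c d where cd: "decseq c" "\<And>i. c i \<in> I" "\<And>i. left_end I < ereal (c i)" "\<And>i. c i \<le> z"
    "\<And>y. left_end I < ereal y \<Longrightarrow> \<forall>\<^sub>F i in sequentially. c i < y"
    using approximating_sequences[OF z] by metis
  have "(\<lambda>i. emeasure \<nu> {c i..<x}) \<longlonglongrightarrow> emeasure \<nu> (\<Union>i. {c i..<x})"
  proof (rule Lim_emeasure_incseq)
    show "incseq (\<lambda>i. {c i..<x})"
    proof (intro incseq_SucI subsetI)
      fix i t assume "t \<in> {c i..<x}"
      then show "t \<in> {c (Suc i)..<x}" using decseqD[OF cd(1), of i "Suc i"] by simp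
    qed
  qed (auto simp: \<nu>_def)
  also have "emeasure \<nu> (\<Union>i. {c i..<x}) = nn_prim ?\<phi> x"
  proof -
    \<comment> \<open>Of the points of I below x, the intervals {c i..<x} miss at most the left
      endpoint.\<close>
    have ae: "AE u in lborel. u \<noteq> real_of_ereal (left_end I)" by (rule AE_lborel_singleton)
    have "(\<integral>\<^sup>+u\<in>(\<Union>i. {c i..<x}). ?\<phi> u \<partial>lborel) = (\<integral>\<^sup>+u\<in>{..<x}. ?\<phi> u \<partial>lborel)"
    proof (rule nn_integral_cong_AE, use ae in eventually_elim)
      fix u assume u: "u \<noteq> real_of_ereal (left_end I)"
      show "?\<phi> u * indicator (\<Union>i. {c i..<x}) u = ?\<phi> u * indicator {..<x} u"
      proof (cases "u \<in> I")
        case True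
        have "left_end I \<noteq> ereal u" using u by auto
        then have "left_end I < ereal u" using left_end_le[OF True] by simp
        then have "\<exists>i. c i \<le> u" using cd(5)[of u] by (auto simp: eventually_sequentially intro: less_imp_le)
        then have "u \<in> (\<Union>i. {c i..<x}) \<longleftrightarrow> u \<in> {..<x}" by auto
        then show ?thesis by (simp only: indicator_def)
      qed (simp add: wn_notI)
    qed
    moreover have "(\<Union>i. {c i..<x}) \<in> sets borel" by measurable
    ultimately show ?thesis by (simp add: \<nu> nn_prim_def)
  qed
  finally have 1: "(\<lambda>i. emeasure \<nu> {c i..<x}) \<longlonglongrightarrow> nn_prim ?\<phi> x" .
  have e: "emeasure \<nu> {y..<x} = ennreal (G j x - G j y)" if y: "y \<in> I" "y < x" for y
  proof -
    let ?f = "\<lambda>u. indicat_real {y..<x} u *\<^sub>R (w (Suc j) u * G (Suc j) u)"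
    have "set_integrable lborel {y..<x} (\<lambda>u. w (Suc j) u * G (Suc j) u)"
      using set_integrable_subset[OF loc_integrable_Icc[OF tower_loc_integrable[OF assms(1,3)] y(1) x], of "{y..<x}"]
      by (simp add: subset_eq)
    then have int: "integrable lborel ?f" by (simp only: set_integrable_def)
    have I: "u \<in> I" if "u \<in> {y..<x}" for u using between_mem[OF y(1) x, of u] that by simp
    have "emeasure \<nu> {y..<x} = (\<integral>\<^sup>+u. ennreal (?f u) \<partial>lborel)"
    proof (subst \<nu>, simp, rule nn_integral_cong)
      fix u
      show "?\<phi> u * indicator {y..<x} u = ennreal (?f u)"
      proof (cases "u \<in> {y..<x}")
        case True
        then show ?thesis using assms(6)[OF I[OF True]] w_pos[OF I[OF True], of "Suc j"] I[OF True]
          by (simp add: wn_I ennreal_mult)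
      qed simp
    qed
    also have "\<dots> = ennreal (integral\<^sup>L lborel ?f)"
    proof (rule nn_integral_eq_integral[OF int], rule AE_I2)
      fix u show "0 \<le> ?f u"
        using assms(6)[OF I] w_pos[OF I, of u "Suc j"] by (cases "u \<in> {y..<x}") (auto intro: mult_nonneg_nonneg)
    qed
    also have "integral\<^sup>L lborel ?f = (LBINT u=ereal y..ereal x. w (Suc j) u * G (Suc j) u)"
      using y(2) by (simp add: interval_integral_Ico set_lebesgue_integral_def)
    also have "\<dots> = G j x - G j y" using tower_eq[OF assms(1,3) x y(1)] by linarith
    finally show ?thesis .
  qed
  have 2: "(\<lambda>i. ennreal (G j x - G j (c i))) \<longlonglongrightarrow> ennreal (G j x - ?L)"
    using filterlim_compose[OF Lim_down(1)[OF assms(4,5)] filterlim_down[OF cd(3,5)]]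
    by (intro tendsto_ennrealI tendsto_diff tendsto_const)
  have "\<forall>\<^sub>F i in sequentially. ennreal (G j x - G j (c i)) = emeasure \<nu> {c i..<x}"
    using cd(5)[OF True] by eventually_elim (rule e[OF cd(2), symmetric])
  from Lim_transform_eventually[OF 2 this] have "nn_prim ?\<phi> x = ennreal (G j x - ?L)"
    using 1 LIMSEQ_unique by blast
  moreover have "ennreal ?L + ennreal (G j x - ?L) = ennreal (G j x)"
    using Lim_down(2,3)[OF assms(4,5)] x True by (subst ennreal_plus[symmetric]) auto
  ultimately show ?thesis by simp
qed

text \<open>By \<open>is_LS_atMost\<close> this is the mass of {..u} on I, the limit of
  \<open>step_mass M y\<close> as y decreases to a. Cutting off outside I makes it Borel on the
  whole line.\<close>

definition left_mass :: "(real \<Rightarrow> real) \<Rightarrow> real \<Rightarrow> ennreal" where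
  "left_mass F u = ennreal (indicat_real I u * (F u - Lim (down_to_left_end I) F))"

lemma measurable_left_mass: "F \<in> Bor I \<Longrightarrow> left_mass F \<in> borel_measurable borel"
proof -
  assume "F \<in> Bor I"
  then have "(\<lambda>u. F u - Lim (down_to_left_end I) F) \<in> Bor I" by (simp add: Bor_def)
  then have "(\<lambda>u. indicat_real I u *\<^sub>R (F u - Lim (down_to_left_end I) F)) \<in> borel_measurable borel"
    unfolding Bor_def by (subst (asm) borel_measurable_restrict_space_iff) auto
  then show ?thesis unfolding left_mass_def[abs_def] by simp
qed

text \<open>Downward induction from j = n, where G n splits into its limit at a and the rest. The
  remainder is kept as an iterated integral of \<open>left_mass\<close>, which makes it directly
  comparable with the iterated integrals of \<open>step_mass\<close>.\<close>

lemma taylor: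
  assumes G: "tower G n" and k: "0 < k" and mono: "\<And>j. k \<le> j \<Longrightarrow> j \<le> n \<Longrightarrow> mono_on I (G j)"
    and nonneg: "\<And>j x. k \<le> j \<Longrightarrow> j \<le> n \<Longrightarrow> x \<in> I \<Longrightarrow> 0 \<le> G j x"
    and j: "k \<le> j" "j \<le> n"
  shows "wn j x * ennreal (G j x) =
    (\<Sum>i=j..n. ennreal (Lim (down_to_left_end I) (G i)) * nn_iter j i (\<lambda>_. 1) x) + nn_iter j n (left_mass (G n)) x"
  using j(2,1)
proof (induction j arbitrary: x rule: inc_induct)
  case base
  show ?case
  proof (cases "x \<in> I")
    case True
    have RC: "G n \<in> RC I" by (rule tower_RC[OF G]) (use k base in auto)
    have le: "Lim (down_to_left_end I) (G n) \<le> G n x"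
    proof (cases "left_end I < ereal x")
      case t: True
      show ?thesis by (rule Lim_down(3)[OF mono nonneg True t]) (use base in auto)
    next
      case f: False
      then have "left_end I = ereal x" using left_end_le[OF True] by simp
      from Lim_down(4)[OF mono nonneg True this RC] show ?thesis using base by auto
    qed
    have "0 \<le> Lim (down_to_left_end I) (G n)" by (rule Lim_down(2)[OF mono nonneg]) (use base in auto)
    then have "ennreal (G n x) = ennreal (Lim (down_to_left_end I) (G n)) + left_mass (G n) x"
      using le True by (simp add: left_mass_def ennreal_plus[symmetric] del: ennreal_plus)
    then show ?thesis by (simp add: nn_iter_base distrib_left mult.commute)
  qed (simp add: wn_notI nn_iter_base)
next
  case (step j)
  show ?case
  proof (cases "x \<in> I")
    case True
    let ?L = "\<lambda>i. ennreal (Lim (down_to_left_end I) (G i))"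
    have IH: "wn (Suc j) u * ennreal (G (Suc j) u) =
      (\<Sum>i=Suc j..n. ?L i * nn_iter (Suc j) i (\<lambda>_. 1) u) + nn_iter (Suc j) n (left_mass (G n)) u" for u
      by (rule step.IH) (use step.prems in simp)
    have Gn: "G n \<in> Bor I" by (rule tower_Bor[OF G order_refl])
    have "ennreal (G j x) = ?L j + nn_prim (\<lambda>u. wn (Suc j) u * ennreal (G (Suc j) u)) x"
      by (rule taylor_step[OF G _ _ mono nonneg nonneg True]) (use k step in auto)
    also have "nn_prim (\<lambda>u. wn (Suc j) u * ennreal (G (Suc j) u)) x =
        (\<Sum>i=Suc j..n. ?L i * nn_prim (nn_iter (Suc j) i (\<lambda>_. 1)) x) + nn_prim (nn_iter (Suc j) n (left_mass (G n))) x"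
      unfolding IH
      by (rule nn_prim_sum) (use step.hyps in \<open>auto intro!: measurable_nn_iter measurable_left_mass Gn\<close>)
    finally have "wn j x * ennreal (G j x) = wn j x * ?L j +
        ((\<Sum>i=Suc j..n. ?L i * (wn j x * nn_prim (nn_iter (Suc j) i (\<lambda>_. 1)) x)) +
         wn j x * nn_prim (nn_iter (Suc j) n (left_mass (G n))) x)"
      by (simp only: distrib_left sum_distrib_left mult.left_commute)
    also have "wn j x * ?L j = ?L j * nn_iter j j (\<lambda>_. 1) x" by (simp add: nn_iter_base mult.commute)
    also have "(\<Sum>i=Suc j..n. ?L i * (wn j x * nn_prim (nn_iter (Suc j) i (\<lambda>_. 1)) x)) =
        (\<Sum>i=Suc j..n. ?L i * nn_iter j i (\<lambda>_. 1) x)"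
      by (rule sum.cong) (auto simp: nn_iter_less)
    also have "wn j x * nn_prim (nn_iter (Suc j) n (left_mass (G n))) x = nn_iter j n (left_mass (G n)) x"
      using step.hyps by (simp add: nn_iter_less)
    also have "{j..n} = insert j {Suc j..n}" using step.hyps by auto
    then have "?L j * nn_iter j j (\<lambda>_. 1) x + ((\<Sum>i=Suc j..n. ?L i * nn_iter j i (\<lambda>_. 1) x) + nn_iter j n (left_mass (G n)) x)
      = (\<Sum>i=j..n. ?L i * nn_iter j i (\<lambda>_. 1) x) + nn_iter j n (left_mass (G n)) x"
      by (simp add: add.assoc)
    finally show ?thesis .
  next
    case False
    then show ?thesis using step.hyps by (simp add: wn_notI nn_iter_outside)
  qed
qed

lemma taylor_real:
  assumes G: "tower G n" and k: "0 < k" "k \<le> n" and mono: "\<And>j. k \<le> j \<Longrightarrow> j \<le> n \<Longrightarrow> mono_on I (G j)"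
    and nonneg: "\<And>j x. k \<le> j \<Longrightarrow> j \<le> n \<Longrightarrow> x \<in> I \<Longrightarrow> 0 \<le> G j x" and x: "x \<in> I"
  shows "nn_iter k n (left_mass (G n)) x < \<infinity>"
    and "w k x * G k x = (\<Sum>j\<in>F_idx I w k n. Lim (down_to_left_end I) (G j) * (w k x * p_left k j x)) +
      enn2real (nn_iter k n (left_mass (G n)) x)"
proof -
  let ?L = "\<lambda>i. Lim (down_to_left_end I) (G i)"
  have T: "ennreal (w k x * G k x) =
    (\<Sum>i=k..n. ennreal (?L i) * nn_iter k i (\<lambda>_. 1) x) + nn_iter k n (left_mass (G n)) x" if "x \<in> I" for x
    using taylor[OF G k(1) mono nonneg order_refl k(2), of x] that w_pos[OF that, of k] nonneg[OF order_refl k(2) that]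
    by (simp add: wn_I ennreal_mult)
  have fin: "(\<Sum>i=k..n. ennreal (?L i) * nn_iter k i (\<lambda>_. 1) x) < top" "nn_iter k n (left_mass (G n)) x < top"
    if "x \<in> I" for x
    using T[OF that] ennreal_less_top[of "w k x * G k x"] by simp_all
  then have fin1: "ennreal (?L i) * nn_iter k i (\<lambda>_. 1) x < top" if "x \<in> I" "i \<in> {k..n}" for x i
    using that by (simp add: ennreal_sum_less_top)
  show f: "nn_iter k n (left_mass (G n)) x < \<infinity>" using fin(2)[OF x] by simp
  have L0: "0 \<le> ?L i" if "i \<in> {k..n}" for i
    using that by (intro Lim_down(2) mono nonneg) auto
  have z: "ennreal (?L i) = 0" if "i \<in> {k..n} - F_idx I w k n" for i
  proof -
    \<comment> \<open>The identity is applied at a point y where p_(a;k,i) is infinite, not at x: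
      finiteness of the sum there forces the coefficient to be 0.\<close>
    obtain y where y: "y \<in> I" "nn_iter k i (\<lambda>_. 1) y = top"
      using \<open>i \<in> {k..n} - F_idx I w k n\<close> by (auto simp: F_idx_eq less_top[symmetric])
    show ?thesis using fin1[OF y(1), of i] that y(2) by (auto simp: ennreal_mult_less_top)
  qed
  have "(\<Sum>i=k..n. ennreal (?L i) * nn_iter k i (\<lambda>_. 1) x) = (\<Sum>i\<in>F_idx I w k n. ennreal (?L i) * nn_iter k i (\<lambda>_. 1) x)"
    by (rule sum.mono_neutral_right) (use z in \<open>auto simp: F_idx_eq\<close>)
  also have "\<dots> = (\<Sum>i\<in>F_idx I w k n. ennreal (?L i * (w k x * p_left k i x)))"
  proof (rule sum.cong[OF refl])
    fix i assume i: "i \<in> F_idx I w k n"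
    then have "nn_iter k i (\<lambda>_. 1) x < top" using x by (auto simp: F_idx_eq)
    then show "ennreal (?L i) * nn_iter k i (\<lambda>_. 1) x = ennreal (?L i * (w k x * p_left k i x))"
      using L0[of i] i by (simp add: w_p_left[OF x] F_idx_eq ennreal_mult)
  qed
  also have "\<dots> = ennreal (\<Sum>i\<in>F_idx I w k n. ?L i * (w k x * p_left k i x))"
    by (rule sum_ennreal) (use L0 in \<open>auto simp: w_p_left[OF x] F_idx_eq\<close>)
  finally have "ennreal (w k x * G k x) = ennreal (\<Sum>i\<in>F_idx I w k n. ?L i * (w k x * p_left k i x)) +
      ennreal (enn2real (nn_iter k n (left_mass (G n)) x))"
    using T[OF x] f by simp
  also have "\<dots> = ennreal ((\<Sum>i\<in>F_idx I w k n. ?L i * (w k x * p_left k i x)) + enn2real (nn_iter k n (left_mass (G n)) x))"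
    by (rule ennreal_plus[symmetric]) (use L0 in \<open>auto simp: w_p_left[OF x] F_idx_eq intro!: sum_nonneg\<close>)
  finally have "ennreal (w k x * G k x) = \<dots>" .
  moreover have "0 \<le> w k x * G k x" using w_pos[OF x, of k] nonneg[OF order_refl k(2) x] by simp
  moreover have "0 \<le> (\<Sum>i\<in>F_idx I w k n. ?L i * (w k x * p_left k i x)) + enn2real (nn_iter k n (left_mass (G n)) x)"
    using L0 by (auto simp: w_p_left[OF x] F_idx_eq intro!: sum_nonneg add_nonneg_nonneg)
  ultimately show "w k x * G k x = (\<Sum>j\<in>F_idx I w k n. ?L j * (w k x * p_left k j x)) +
      enn2real (nn_iter k n (left_mass (G n)) x)"
    by (simp only: ennreal_inj)
qed

lemma step_mass_le_left_mass:
  assumes "is_LS F M" "mono_on I F" "\<And>x. x \<in> I \<Longrightarrow> 0 \<le> F x" "F \<in> RC I" "x \<in> I"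
  shows "step_mass M y x \<le> left_mass F x"
proof -
  have "step_mass M y x \<le> emeasure M {..x}"
    unfolding step_mass_def using is_LS_sets[OF assms(1)] by (intro emeasure_mono) auto
  then show ?thesis using is_LS_atMost[OF assms] assms(5) by (simp add: left_mass_def)
qed

text \<open>The sets {c i..u} increase to {..u} up to a null set, so their masses increase to
  \<open>left_mass\<close>; \<open>nn_iter_SUP\<close> carries this through the iterated
  integrals.\<close>

lemma nn_iter_step_mass_tendsto:
  assumes "is_LS F M" "mono_on I F" "\<And>x. x \<in> I \<Longrightarrow> 0 \<le> F x" "F \<in> RC I" "k \<le> n"
    and "decseq c" "\<And>y. left_end I < ereal y \<Longrightarrow> \<forall>\<^sub>F i in sequentially. c i < y"
  shows "(\<lambda>i. nn_iter k n (step_mass M (c i)) x) \<longlonglongrightarrow> nn_iter k n (left_mass F) x"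
proof -
  have inc: "incseq (\<lambda>i. step_mass M (c i))"
  proof (rule incseq_SucI, rule le_funI)
    fix i t show "step_mass M (c i) t \<le> step_mass M (c (Suc i)) t"
      unfolding step_mass_def using is_LS_sets[OF assms(1)] decseqD[OF assms(6), of i "Suc i"]
      by (intro emeasure_mono) auto
  qed
  have sup: "(SUP i. step_mass M (c i) u) = left_mass F u" if u: "u \<in> I" for u
  proof -
    have "(SUP i. emeasure M {c i..u}) = emeasure M (\<Union>i. {c i..u})"
    proof (rule SUP_emeasure_incseq)
      show "incseq (\<lambda>i. {c i..u})"
      proof (intro incseq_SucI subsetI)
        fix i t assume "t \<in> {c i..u}"
        then show "t \<in> {c (Suc i)..u}" using decseqD[OF assms(6), of i "Suc i"] by simp
      qed
    qed (auto simp: is_LS_sets[OF assms(1)])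
    also have "\<dots> = emeasure M {..u}"
    proof (rule is_LS_cong_set[OF assms(1)])
      fix t assume "t \<in> I" "left_end I < ereal t"
      then have "\<exists>i. c i < t" using assms(7)[of t] by (auto simp: eventually_sequentially)
      then show "t \<in> (\<Union>i. {c i..u}) \<longleftrightarrow> t \<in> {..u}" by (auto intro: less_imp_le)
    qed auto
    also have "\<dots> = left_mass F u" using is_LS_atMost[OF assms(1-4) u] u by (simp add: left_mass_def)
    finally show ?thesis by (simp add: step_mass_def)
  qed
  have "incseq (\<lambda>i. nn_iter k n (step_mass M (c i)) x)"
  proof (rule incseq_SucI)
    fix i show "nn_iter k n (step_mass M (c i)) x \<le> nn_iter k n (step_mass M (c (Suc i))) x"
      using incseqD[OF inc, of i "Suc i"] by (intro nn_iter_mono[OF assms(5)]) (simp add: le_fun_def)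
  qed
  then have "(\<lambda>i. nn_iter k n (step_mass M (c i)) x) \<longlonglongrightarrow> (SUP i. nn_iter k n (step_mass M (c i)) x)"
    by (rule LIMSEQ_SUP)
  also have "(SUP i. nn_iter k n (step_mass M (c i)) x) = nn_iter k n (\<lambda>x. SUP i. step_mass M (c i) x) x"
    by (rule nn_iter_SUP[symmetric, OF measurable_step_mass[OF assms(1)] inc assms(5)])
  also have "\<dots> = nn_iter k n (left_mass F) x"
    by (rule nn_iter_cong[OF assms(5)]) (rule sup)
  finally show ?thesis .
qed

end

section \<open>Error terms\<close>

lemma set_integral_tendsto_zero:
  fixes f :: "nat \<Rightarrow> real \<Rightarrow> real"
  assumes "\<And>i. set_integrable M A (f i)" "set_integrable M A g"
    and "\<And>i u. u \<in> A \<Longrightarrow> \<bar>f i u\<bar> \<le> g u" "\<And>u. u \<in> A \<Longrightarrow> (\<lambda>i. f i u) \<longlonglongrightarrow> 0"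
  shows "(\<lambda>i. LINT u:A|M. f i u) \<longlonglongrightarrow> 0"
proof -
  have "(\<lambda>i. integral\<^sup>L M (\<lambda>u. indicat_real A u *\<^sub>R f i u)) \<longlonglongrightarrow> integral\<^sup>L M (\<lambda>_. 0::real)"
  proof (rule integral_dominated_convergence[where w="\<lambda>u. indicat_real A u *\<^sub>R g u"])
    show "(\<lambda>u. indicat_real A u *\<^sub>R f i u) \<in> borel_measurable M" for i
      using assms(1)[of i] unfolding set_integrable_def by (rule borel_measurable_integrable)
    show "integrable M (\<lambda>u. indicat_real A u *\<^sub>R g u)" using assms(2) unfolding set_integrable_def .
    show "AE u in M. (\<lambda>i. indicat_real A u *\<^sub>R f i u) \<longlonglongrightarrow> 0"
    proof (rule AE_I2)
      fix u show "(\<lambda>i. indicat_real A u *\<^sub>R f i u) \<longlonglongrightarrow> 0"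
        using assms(4)[of u] by (cases "u \<in> A") auto
    qed
    show "AE u in M. norm (indicat_real A u *\<^sub>R f i u) \<le> indicat_real A u *\<^sub>R g u" for i
    proof (rule AE_I2)
      fix u show "norm (indicat_real A u *\<^sub>R f i u) \<le> indicat_real A u *\<^sub>R g u"
        using assms(3)[of u i] by (cases "u \<in> A") auto
    qed
  qed simp
  then show ?thesis by (simp add: set_lebesgue_integral_def)
qed

lemma LBINT_lincomb:
  fixes \<phi> :: "'a \<Rightarrow> real \<Rightarrow> real"
  assumes "finite A" "\<And>j. j \<in> A \<Longrightarrow> interval_lebesgue_integrable lborel a b (\<phi> j)"
  shows "interval_lebesgue_integrable lborel a b (\<lambda>u. \<Sum>j\<in>A. c j * \<phi> j u) \<and>
    (LBINT u=a..b. (\<Sum>j\<in>A. c j * \<phi> j u)) = (\<Sum>j\<in>A. c j * (LBINT u=a..b. \<phi> j u))"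
  using assms
proof (induction A)
  case empty
  then show ?case by (simp add: interval_lebesgue_integrable_def set_integrable_def)
next
  case (insert j A)
  then have 1: "interval_lebesgue_integrable lborel a b (\<lambda>u. c j * \<phi> j u)"
    and 2: "interval_lebesgue_integrable lborel a b (\<lambda>u. \<Sum>j\<in>A. c j * \<phi> j u)"
    and 3: "(LBINT u=a..b. (\<Sum>j\<in>A. c j * \<phi> j u)) = (\<Sum>j\<in>A. c j * (LBINT u=a..b. \<phi> j u))"
    by auto
  show ?case
    using interval_lebesgue_integral_add[OF 1 2] 3 insert.hyps by simp
qed

section \<open>Propagation of sign, monotonicity and limit through integration from z\<close>

context gauged_interval
begin

text \<open>\<open>vanishing z c e \<rho>\<close> is the shape of the claim for an error term with sign \<open>(-1)\<^sup>e\<close> to the left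
  of \<open>z\<close>. Integration from \<open>z\<close> preserves it and increments \<open>e\<close>.\<close>

definition knots :: "real \<Rightarrow> real set" where
  "knots z = {y. left_end I < ereal y \<and> y \<le> z}"

definition vanishing :: "real \<Rightarrow> (nat \<Rightarrow> real) \<Rightarrow> nat \<Rightarrow> (real \<Rightarrow> real \<Rightarrow> real) \<Rightarrow> bool" where
  "vanishing z c e \<rho> \<longleftrightarrow>
    (\<forall>x\<in>I. z \<le> x \<longrightarrow> (\<forall>y\<in>knots z. \<forall>y'\<in>knots z. y \<le> y' \<longrightarrow> 0 \<le> \<rho> y x \<and> \<rho> y x \<le> \<rho> y' x)) \<and>
    (\<forall>x\<in>I. x \<le> z \<longrightarrow> (\<forall>y\<in>knots z. \<forall>y'\<in>knots z. y \<le> y' \<longrightarrow>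
       0 \<le> (-1) ^ e * \<rho> y x \<and> (-1) ^ e * \<rho> y x \<le> (-1) ^ e * \<rho> y' x)) \<and>
    (\<forall>x\<in>I. (\<lambda>i. \<rho> (c i) x) \<longlonglongrightarrow> 0)"

lemma vanishing_cong:
  assumes "\<And>y x. y \<in> knots z \<Longrightarrow> x \<in> I \<Longrightarrow> \<rho> y x = \<rho>' y x" "\<And>i. c i \<in> knots z"
  shows "vanishing z c e \<rho> \<longleftrightarrow> vanishing z c e \<rho>'"
  unfolding vanishing_def using assms by simp

text \<open>Dominated convergence needs a majorant common to all knots. Monotonicity in y provides
  it: each c i is at most z, and z is itself a knot, so the absolute error for the knot z dominates
  all the others.\<close>

lemma vanishing_step:
  assumes v: "vanishing z c e \<rho>" and z: "z \<in> I" "z \<in> knots z" and c: "\<And>i. c i \<in> knots z"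
    and int: "\<And>y. y \<in> knots z \<Longrightarrow> loc_integrable I (\<lambda>u. w j u * \<rho> y u)"
  shows "vanishing z c (Suc e) (\<lambda>y x. LBINT u=ereal z..ereal x. w j u * \<rho> y u)"
proof -
  \<comment> \<open>Treats both sides of z: s = 1 on (z, x), and s = (-1)^e on (x, z). The
    orientation of the integral, which raises e by one on the left, enters only afterwards.\<close>
  have J: "(\<forall>y\<in>knots z. \<forall>y'\<in>knots z. y \<le> y' \<longrightarrow>
        0 \<le> s * (LBINT u:{lo<..<hi}. w j u * \<rho> y u) \<and>
        s * (LBINT u:{lo<..<hi}. w j u * \<rho> y u) \<le> s * (LBINT u:{lo<..<hi}. w j u * \<rho> y' u)) \<and>
      (\<lambda>i. LBINT u:{lo<..<hi}. w j u * \<rho> (c i) u) \<longlonglongrightarrow> 0"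
    if lohi: "lo \<in> I" "hi \<in> I" and s: "\<bar>s\<bar> = 1"
      and mono: "\<And>u y y'. u \<in> {lo<..<hi} \<Longrightarrow> u \<in> I \<Longrightarrow> y \<in> knots z \<Longrightarrow> y' \<in> knots z \<Longrightarrow> y \<le> y' \<Longrightarrow>
        0 \<le> s * \<rho> y u \<and> s * \<rho> y u \<le> s * \<rho> y' u"
    for lo hi s :: real
  proof -
    have I: "u \<in> I" if "u \<in> {lo<..<hi}" for u using between_mem[OF lohi, of u] that by simp
    have si: "set_integrable lborel {lo<..<hi} (\<lambda>u. w j u * \<rho> y u)" if "y \<in> knots z" for y
      using set_integrable_subset[OF loc_integrable_Icc[OF int[OF that] lohi], of "{lo<..<hi}"]
      by (simp add: subset_eq)
    have eq: "s * (w j u * \<rho> y u) = w j u * (s * \<rho> y u)" for u y by simp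
    have bounds: "0 \<le> s * (w j u * \<rho> y u) \<and> s * (w j u * \<rho> y u) \<le> s * (w j u * \<rho> y' u)"
      if "u \<in> {lo<..<hi}" "y \<in> knots z" "y' \<in> knots z" "y \<le> y'" for u y y'
      unfolding eq using mono[OF that(1) I[OF that(1)] that(2-4)] w_pos[OF I[OF that(1)], of j]
        mult_nonneg_nonneg[of "w j u" "s * \<rho> y u"] mult_left_mono[of "s * \<rho> y u" "s * \<rho> y' u" "w j u"] by simp
    have "0 \<le> s * (LBINT u:{lo<..<hi}. w j u * \<rho> y u)"
      "s * (LBINT u:{lo<..<hi}. w j u * \<rho> y u) \<le> s * (LBINT u:{lo<..<hi}. w j u * \<rho> y' u)"
      if y: "y \<in> knots z" "y' \<in> knots z" "y \<le> y'" for y y'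
    proof -
      have "0 \<le> (LBINT u:{lo<..<hi}. s * (w j u * \<rho> y u))"
        unfolding set_lebesgue_integral_def
      proof (rule integral_nonneg_AE, rule AE_I2)
        fix u show "0 \<le> indicat_real {lo<..<hi} u *\<^sub>R (s * (w j u * \<rho> y u))"
          using bounds[of u, OF _ y] by (cases "u \<in> {lo<..<hi}") auto
      qed
      then show "0 \<le> s * (LBINT u:{lo<..<hi}. w j u * \<rho> y u)" by simp
      have "(LBINT u:{lo<..<hi}. s * (w j u * \<rho> y u)) \<le> (LBINT u:{lo<..<hi}. s * (w j u * \<rho> y' u))"
        by (rule set_integral_mono) (use bounds[OF _ y] si y in \<open>auto intro: set_integrable_mult_right\<close>)
      then show "s * (LBINT u:{lo<..<hi}. w j u * \<rho> y u) \<le> s * (LBINT u:{lo<..<hi}. w j u * \<rho> y' u)" by simp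
    qed
    moreover have "(\<lambda>i. LBINT u:{lo<..<hi}. w j u * \<rho> (c i) u) \<longlonglongrightarrow> 0"
    proof (rule set_integral_tendsto_zero[OF si[OF c]])
      show "set_integrable lborel {lo<..<hi} (\<lambda>u. s * (w j u * \<rho> z u))"
        using si[OF z(2)] by (rule set_integrable_mult_right)
      fix u assume u: "u \<in> {lo<..<hi}"
      show "\<bar>w j u * \<rho> (c i) u\<bar> \<le> s * (w j u * \<rho> z u)" for i
      proof -
        have "c i \<le> z" using c[of i] by (simp add: knots_def)
        from bounds[OF u c z(2) this] have "\<bar>s * (w j u * \<rho> (c i) u)\<bar> \<le> s * (w j u * \<rho> z u)" by simp
        then show ?thesis unfolding abs_mult[of s] s by simp
      qed
      have "(\<lambda>i. \<rho> (c i) u) \<longlonglongrightarrow> 0" using v I[OF u] unfolding vanishing_def by blast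
      then show "(\<lambda>i. w j u * \<rho> (c i) u) \<longlonglongrightarrow> 0" by (rule tendsto_mult_right_zero)
    qed
    ultimately show ?thesis by blast
  qed
  have right: "(LBINT u=ereal z..ereal x. \<phi> u) = (LBINT u:{z<..<x}. \<phi> u)" if "z \<le> x" for x and \<phi> :: "real \<Rightarrow> real"
    using that by (simp add: interval_lebesgue_integral_def)
  have left: "(LBINT u=ereal z..ereal x. \<phi> u) = - (LBINT u:{x<..<z}. \<phi> u)" if "x \<le> z" for x and \<phi> :: "real \<Rightarrow> real"
  proof (cases "x = z")
    case True
    then show ?thesis by (simp add: set_lebesgue_integral_def)
  qed (use that in \<open>simp add: interval_lebesgue_integral_def\<close>)
  have R: "(\<forall>y\<in>knots z. \<forall>y'\<in>knots z. y \<le> y' \<longrightarrow>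
        0 \<le> 1 * (LBINT u:{z<..<x}. w j u * \<rho> y u) \<and>
        1 * (LBINT u:{z<..<x}. w j u * \<rho> y u) \<le> 1 * (LBINT u:{z<..<x}. w j u * \<rho> y' u)) \<and>
      (\<lambda>i. LBINT u:{z<..<x}. w j u * \<rho> (c i) u) \<longlonglongrightarrow> 0" if "x \<in> I" "z \<le> x" for x
    by (rule J[OF z(1) that(1)]) (use v in \<open>simp_all add: vanishing_def\<close>)
  have L: "(\<forall>y\<in>knots z. \<forall>y'\<in>knots z. y \<le> y' \<longrightarrow>
        0 \<le> (-1) ^ e * (LBINT u:{x<..<z}. w j u * \<rho> y u) \<and>
        (-1) ^ e * (LBINT u:{x<..<z}. w j u * \<rho> y u) \<le> (-1) ^ e * (LBINT u:{x<..<z}. w j u * \<rho> y' u)) \<and>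
      (\<lambda>i. LBINT u:{x<..<z}. w j u * \<rho> (c i) u) \<longlonglongrightarrow> 0" if "x \<in> I" "x \<le> z" for x
    by (rule J[OF that(1) z(1)]) (use v in \<open>simp_all add: vanishing_def power_abs\<close>)
  show ?thesis
    unfolding vanishing_def
  proof (intro conjI ballI impI)
    fix x assume x: "x \<in> I" "z \<le> x"
    fix y y' assume y: "y \<in> knots z" "y' \<in> knots z" "y \<le> y'"
    from R[OF x] y show "0 \<le> (LBINT u=ereal z..ereal x. w j u * \<rho> y u)"
      "(LBINT u=ereal z..ereal x. w j u * \<rho> y u) \<le> (LBINT u=ereal z..ereal x. w j u * \<rho> y' u)"
      unfolding right[OF x(2)] by simp_all
  next
    fix x assume x: "x \<in> I" "x \<le> z"
    fix y y' assume y: "y \<in> knots z" "y' \<in> knots z" "y \<le> y'"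
    from L[OF x] y show "0 \<le> (-1) ^ Suc e * (LBINT u=ereal z..ereal x. w j u * \<rho> y u)"
      "(-1) ^ Suc e * (LBINT u=ereal z..ereal x. w j u * \<rho> y u) \<le> (-1) ^ Suc e * (LBINT u=ereal z..ereal x. w j u * \<rho> y' u)"
      unfolding left[OF x(2)] by simp_all
  next
    fix x assume x: "x \<in> I"
    show "(\<lambda>i. LBINT u=ereal z..ereal x. w j u * \<rho> (c i) u) \<longlonglongrightarrow> 0"
    proof (cases "z \<le> x")
      case True
      then show ?thesis unfolding right[OF True] using R[OF x True] by blast
    next
      case False
      then have le: "x \<le> z" by simp
      then show ?thesis unfolding left[OF le] using L[OF x le] tendsto_minus[of _ "0::real"] by fastforce
    qed
  qed
qed

text \<open>Because R y i vanishes at z for i < m, each level is the plain integral of weight times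
  next level, without a constant term, and \<open>vanishing_step\<close> applies once per
  level.\<close>

lemma vanishing_tower:
  assumes tower: "\<And>y. y \<in> knots z \<Longrightarrow> tower (R y) m" and zero: "\<And>y i. y \<in> knots z \<Longrightarrow> i < m \<Longrightarrow> R y i z = 0"
    and z: "z \<in> I" "z \<in> knots z" and c: "\<And>i. c i \<in> knots z"
    and v: "vanishing z c e (\<lambda>y. R y m)" and "i \<le> m"
  shows "vanishing z c (e + (m - i)) (\<lambda>y. R y i)"
  using assms(7)
proof (induction i rule: inc_induct)
  case (step i)
  have "vanishing z c (Suc (e + (m - Suc i))) (\<lambda>y x. LBINT u=ereal z..ereal x. w (Suc i) u * R y (Suc i) u)"
    by (rule vanishing_step[OF step.IH z c]) (rule tower_loc_integrable[OF tower step.hyps(2)])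
  also have "Suc (e + (m - Suc i)) = e + (m - i)" using step.hyps by simp
  finally show ?case
  proof (rule vanishing_cong[THEN iffD1, rotated 2])
    fix y x assume y: "y \<in> knots z" and x: "x \<in> I"
    show "(LBINT u=ereal z..ereal x. w (Suc i) u * R y (Suc i) u) = R y i x"
      using tower_eq[OF tower[OF y] step.hyps(2) x z(1)] zero[OF y step.hyps(2)] by simp
  qed (rule c)
qed (use v in simp)

text \<open>Level k - 1 is the highest one available both for k \<le> n and for k = n + 1. There
  \<theta> is the derivative of f - g_tilde, and subtracting its value at z is the effect of q,
  whose derivative of order k - 1 is constant. The exponent 1 stems from one integration in the
  first case and from the sign of minus a mass in the second.\<close>

lemma spline_error_vanishing:
  assumes G: "tower G n" and k: "1 \<le> k" "k \<le> n + 1" and mono: "\<And>j. k - 1 \<le> j \<Longrightarrow> j \<le> n \<Longrightarrow> mono_on I (G j)"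
    and LS: "is_LS (G n) M"
    and rc: "\<And>x. x \<in> I \<Longrightarrow> ereal x \<noteq> right_end I \<Longrightarrow> continuous (at_right x) (G n)"
    and z: "left_end I < ereal z" "ereal z < right_end I"
    and c: "decseq c" "\<And>i. c i \<in> knots z" "\<And>y. left_end I < ereal y \<Longrightarrow> \<forall>\<^sub>F i in sequentially. c i < y"
  defines "\<theta> \<equiv> \<lambda>y x. G (k - 1) x -
      ((\<Sum>j\<in>F_idx I w k n. Lim (down_to_left_end I) (G j) * tint z (\<lambda>_. 0) (p_left k j) k (k - 1) x) +
       spline_part n M y (k - 1) x)"
  shows "vanishing z c 1 (\<lambda>y x. \<theta> y x - \<theta> y z)"
proof -
  have zI: "z \<in> I" by (rule mem_if_strictly_between[OF z])
  have zz: "z \<in> knots z" using z by (simp add: knots_def)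
  have kn: "y \<in> I" "left_end I < ereal y" "y \<le> z" if "y \<in> knots z" for y
    using that mem_if_le[OF _ _ zI] by (auto simp: knots_def)
  show ?thesis
  proof (cases "k \<le> n")
    case True
    obtain k' where k': "k = Suc k'" using k(1) by (cases k) auto
    have k'n: "k' < n" using True k' by simp
    have monok: "mono_on I (G j)" if "k \<le> j" "j \<le> n" for j using mono that by simp
    \<comment> \<open>A nondecreasing function has a nonnegative density, so f^(j) \<ge> 0 follows
      from the monotonicity of f^(j-1). For j = k this is why monotonicity starts at order k -
      1.\<close>
    have nonneg: "0 \<le> G j x" if j: "k \<le> j" "j \<le> n" and x: "x \<in> I" for j x
    proof -
      obtain i where i: "j = Suc i" using j(1) k(1) by (cases j) auto
      have "0 \<le> w j x * G j x"
        unfolding i by (rule density_nonneg[OF w_Bor_pos towerD[OF G] _ x]) (use i j mono k' in auto)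
      then show ?thesis using w_pos[OF x, of j] by (simp add: zero_le_mult_iff)
    qed
    have RC: "G n \<in> RC I" by (rule tower_RC[OF G]) (use k True in auto)
    have k0: "0 < k" using k(1) by simp
    have taylor: "nn_iter k n (left_mass (G n)) x < \<infinity>"
      "w k x * G k x = (\<Sum>j\<in>F_idx I w k n. Lim (down_to_left_end I) (G j) * (w k x * p_left k j x)) +
        enn2real (nn_iter k n (left_mass (G n)) x)" if "x \<in> I" for x
      using taylor_real[OF G k0 True, OF monok nonneg that] by simp_all
    \<comment> \<open>The remainder over all t minus the one over t \<ge> y. Both are finite: the
      first by \<open>taylor\<close>, the second because it is at most the first.\<close>
    define \<rho> where "\<rho> = (\<lambda>y x. (enn2real (nn_iter k n (left_mass (G n)) x) - enn2real (nn_iter k n (step_mass M y) x)) / w k x)"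
    have w\<rho>: "w k x * \<rho> y x = enn2real (nn_iter k n (left_mass (G n)) x) - enn2real (nn_iter k n (step_mass M y) x)"
      if "x \<in> I" for x y using w_pos[OF that, of k] by (simp add: \<rho>_def)
    let ?L = "\<lambda>j. Lim (down_to_left_end I) (G j)"
    have w\<rho>': "w k x * \<rho> y x = w k x * G k x - ((\<Sum>j\<in>F_idx I w k n. ?L j * (w k x * p_left k j x)) + w k x * spline_part n M y k x)"
      if "x \<in> I" for x y
      using w\<rho>[OF that, of y] taylor(2)[OF that] by (simp add: w_spline_part[OF that])
    have fin: "finite (F_idx I w k n)" by (simp add: F_idx_def)
    have iG: "loc_integrable I (\<lambda>x. w k x * G k x)" using tower_loc_integrable[OF G k'n] by (simp add: k')
    have iS: "loc_integrable I (\<lambda>x. w k x * spline_part n M y k x)" if "y \<in> knots z" for y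
      using spline_part_eq(1)[OF LS kn(1,2)[OF that] k'n] by (simp add: k')
    have iP: "\<And>j. j \<in> F_idx I w k n \<Longrightarrow> loc_integrable I (\<lambda>x. w k x * p_left k j x)" by (rule p_left_regular(2))
    have int: "interval_lebesgue_integrable lborel (ereal z) (ereal x) (\<lambda>u. w k u * G k u)"
      "interval_lebesgue_integrable lborel (ereal z) (ereal x) (\<lambda>u. w k u * spline_part n M y k u)"
      "\<And>j. j \<in> F_idx I w k n \<Longrightarrow> interval_lebesgue_integrable lborel (ereal z) (ereal x) (\<lambda>u. w k u * p_left k j u)"
      if "y \<in> knots z" "x \<in> I" for x y
      using iG iS[OF that(1)] iP that(2) zI unfolding loc_integrable_def by blast+
    have eq: "(LBINT u=ereal z..ereal x. w k u * \<rho> y u) = \<theta> y x - \<theta> y z" if y: "y \<in> knots z" and x: "x \<in> I" for y x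
    proof -
      note i = int[OF y x]
      have S: "interval_lebesgue_integrable lborel (ereal z) (ereal x) (\<lambda>u. \<Sum>j\<in>F_idx I w k n. ?L j * (w k u * p_left k j u))"
        "(LBINT u=ereal z..ereal x. (\<Sum>j\<in>F_idx I w k n. ?L j * (w k u * p_left k j u))) =
          (\<Sum>j\<in>F_idx I w k n. ?L j * (LBINT u=ereal z..ereal x. w k u * p_left k j u))"
        using LBINT_lincomb[OF fin i(3), of "\<lambda>j. j" ?L] by blast+
      have "(LBINT u=ereal z..ereal x. w k u * \<rho> y u) = (LBINT u=ereal z..ereal x. w k u * G k u -
          ((\<Sum>j\<in>F_idx I w k n. ?L j * (w k u * p_left k j u)) + w k u * spline_part n M y k u))"
        by (rule LBINT_cong[OF zI x]) (rule w\<rho>')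
      also have "\<dots> = (LBINT u=ereal z..ereal x. w k u * G k u) -
          ((\<Sum>j\<in>F_idx I w k n. ?L j * (\<lambda>j. LBINT u=ereal z..ereal x. w k u * p_left k j u) j) +
           (LBINT u=ereal z..ereal x. w k u * spline_part n M y k u))"
        by (simp only: interval_lebesgue_integral_diff(2)[OF i(1) interval_lebesgue_integral_add(1)[OF S(1) i(2)]]
          interval_lebesgue_integral_add(2)[OF S(1) i(2)] S(2))
      also have "(LBINT u=ereal z..ereal x. w k u * G k u) = G k' x - G k' z"
        using tower_eq[OF G k'n x zI] unfolding k' by linarith
      also have "(LBINT u=ereal z..ereal x. w k u * spline_part n M y k u) = spline_part n M y k' x - spline_part n M y k' z"
        using spline_part_eq(2)[OF LS kn(1,2)[OF y] k'n x zI] unfolding k' by linarith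
      also have "(\<lambda>j. LBINT u=ereal z..ereal x. w k u * p_left k j u) = (\<lambda>j. tint z (\<lambda>_. 0) (p_left k j) k k' x)"
        using tint_less[of k' k z "\<lambda>_. 0" _ x] by (simp add: k' tint_k)
      finally show ?thesis
        unfolding \<theta>_def using tint_at[of k' k z "\<lambda>_. 0"] by (simp add: k')
    qed
    have le1: "nn_iter k n (step_mass M y) x \<le> nn_iter k n (step_mass M y') x" if "y' \<le> y" for x y y'
    proof (rule nn_iter_mono[OF True])
      fix u
      have "emeasure M {y..u} \<le> emeasure M {y'..u}"
        by (rule emeasure_mono) (use that in \<open>simp_all add: is_LS_sets[OF LS]\<close>)
      then show "step_mass M y u \<le> step_mass M y' u" by (simp add: step_mass_def)
    qed
    have le2: "nn_iter k n (step_mass M y) x \<le> nn_iter k n (left_mass (G n)) x" for x y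
      by (rule nn_iter_mono[OF True], rule step_mass_le_left_mass[OF LS monok[OF True order_refl] nonneg[OF True order_refl] RC])
    have f: "nn_iter k n (left_mass (G n)) x < top" if "x \<in> I" for x using taylor(1)[OF that] by simp
    have \<rho>_bounds: "0 \<le> \<rho> y x \<and> \<rho> y x \<le> \<rho> y' x" if x: "x \<in> I" and "y \<le> y'" for x y y'
    proof
      have "enn2real (nn_iter k n (step_mass M y) x) \<le> enn2real (nn_iter k n (left_mass (G n)) x)"
        by (rule enn2real_mono[OF le2 f[OF x]])
      then show "0 \<le> \<rho> y x" unfolding \<rho>_def using w_pos[OF x, of k] by (intro divide_nonneg_pos) simp_all
      have "enn2real (nn_iter k n (step_mass M y') x) \<le> enn2real (nn_iter k n (step_mass M y) x)"
        by (rule enn2real_mono[OF le1[OF that(2)] le_less_trans[OF le2 f[OF x]]])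
      then show "\<rho> y x \<le> \<rho> y' x" unfolding \<rho>_def using w_pos[OF x, of k] by (intro divide_right_mono) simp_all
    qed
    have "(\<lambda>i. \<rho> (c i) x) \<longlonglongrightarrow> 0" if x: "x \<in> I" for x
    proof -
      have "(\<lambda>i. nn_iter k n (step_mass M (c i)) x) \<longlonglongrightarrow> nn_iter k n (left_mass (G n)) x"
        by (rule nn_iter_step_mass_tendsto[OF LS monok[OF True order_refl] nonneg[OF True order_refl] RC True c(1,3)])
      also have "nn_iter k n (left_mass (G n)) x = ennreal (enn2real (nn_iter k n (left_mass (G n)) x))"
        using f[OF x] by simp
      finally have "(\<lambda>i. enn2real (nn_iter k n (step_mass M (c i)) x)) \<longlonglongrightarrow> enn2real (nn_iter k n (left_mass (G n)) x)"
        by (rule tendsto_enn2real) simp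
      from tendsto_divide_zero[OF tendsto_diff[OF tendsto_const this, of "enn2real (nn_iter k n (left_mass (G n)) x)", simplified], of "w k x"]
      show ?thesis by (simp add: \<rho>_def)
    qed
    then have "vanishing z c 0 \<rho>" unfolding vanishing_def using \<rho>_bounds by simp
    moreover have "loc_integrable I (\<lambda>u. w k u * \<rho> y u)" if y: "y \<in> knots z" for y
    proof -
      have "loc_integrable I (\<lambda>u. \<Sum>j\<in>F_idx I w k n. ?L j * (w k u * p_left k j u))"
        unfolding loc_integrable_def
        using LBINT_lincomb[OF fin, of _ _ "\<lambda>j u. w k u * p_left k j u" ?L] iP unfolding loc_integrable_def by blast
      then have "loc_integrable I (\<lambda>u. w k u * G k u - ((\<Sum>j\<in>F_idx I w k n. ?L j * (w k u * p_left k j u)) + w k u * spline_part n M y k u))"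
        by (intro loc_integrable_diff loc_integrable_add iG iS y)
      then show ?thesis by (rule loc_integrable_cong[THEN iffD2, rotated]) (rule w\<rho>')
    qed
    ultimately have "vanishing z c (Suc 0) (\<lambda>y x. LBINT u=ereal z..ereal x. w k u * \<rho> y u)"
      by (intro vanishing_step zI zz c(2))
    then show ?thesis
      unfolding One_nat_def by (rule vanishing_cong[THEN iffD1, rotated 2]) (rule eq, assumption+, rule c(2))
  next
    case False
    then have k': "k = Suc n" using k by simp
    have F: "F_idx I w k n = {}" by (simp add: F_idx_def k')
    have monon: "mono_on I (G n)" using mono[of n] k' by simp
    note Icc = is_LS_Icc[OF LS monon kn(1,2)] and Ioo = is_LS_Ioo[OF LS monon kn(1,2)]
    \<comment> \<open>By \<open>is_LS_Icc\<close>, G n x - measure M {y..x} is the constant G n(y-)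
      for x \<ge> y, in particular at x = z. For x < y the difference G n x - G n(y-) is minus the
      mass of {x<..<y}, an interval that is empty for y \<le> x < z.\<close>
    have r: "\<theta> y x - \<theta> y z = (if z \<le> x then 0 else - measure M {x<..<y})" if y: "y \<in> knots z" and x: "x \<in> I" for y x
    proof -
      have "\<theta> y x - \<theta> y z = (G n x - measure M {y..x}) - (G n z - measure M {y..z})"
        unfolding \<theta>_def F by (simp add: k' spline_part_last x zI)
      also have "\<dots> = (if y \<le> x then 0 else G n x - (G n y - measure M {y}))"
        using Icc[OF y y x] Icc[OF y y zI] kn(3)[OF y] by simp
      also have "\<dots> = (if z \<le> x then 0 else - measure M {x<..<y})"
        using Ioo[OF y y x] kn(3)[OF y] by (cases "y \<le> x") auto
      finally show ?thesis .
    qed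
    have fin: "emeasure M {x<..<y} < \<infinity>" if y: "y \<in> knots z" and x: "x \<in> I" for x y
    proof (cases "x \<le> y")
      case True
      have "emeasure M {x<..<y} \<le> emeasure M {x<..y}" using is_LS_sets[OF LS] by (intro emeasure_mono) auto
      also have "\<dots> < \<infinity>" using is_LS_emeasure[OF LS x kn(1)[OF y] True] by simp
      finally show ?thesis .
    qed simp
    have m: "measure M {x<..<y} \<le> measure M {x<..<y'}" if "y' \<in> knots z" "y \<le> y'" "x \<in> I" for x y y'
      using that fin[OF that(1,3)] is_LS_sets[OF LS] by (intro measure_mono_fmeasurable) (auto simp: fmeasurable_def)
    have lim: "(\<lambda>i. measure M {x<..<c i}) \<longlonglongrightarrow> 0" if x: "x \<in> I" for x
    proof -
      have "(\<lambda>i. measure M {x<..<c i}) \<longlonglongrightarrow> measure M (\<Inter>i. {x<..<c i})"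
      proof (rule Lim_measure_decseq)
        show "decseq (\<lambda>i. {x<..<c i})"
        proof (intro decseq_SucI subsetI)
          fix i t assume "t \<in> {x<..<c (Suc i)}"
          then show "t \<in> {x<..<c i}" using decseqD[OF c(1), of i "Suc i"] by simp
        qed
        show "emeasure M {x<..<c i} \<noteq> \<infinity>" for i using fin[OF c(2) x, of i] by simp
      qed (auto simp: is_LS_sets[OF LS])
      \<comment> \<open>A common point would lie strictly to the right of x, hence of a, and c i
        eventually drops below it.\<close>
      also have "(\<Inter>i. {x<..<c i}) = {}"
      proof -
        have "\<not> (\<forall>i. x < t \<and> t < c i)" for t
        proof
          assume t: "\<forall>i. x < t \<and> t < c i"
          then have "left_end I < ereal t" using le_less_trans[OF left_end_le[OF x], of "ereal t"] by simp
          then have "\<exists>i. c i < t" using c(3)[of t] by (auto simp: eventually_sequentially)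
          then show False using t less_asym by blast
        qed
        then show ?thesis by (simp add: set_eq_iff)
      qed
      finally show ?thesis by simp
    qed
    have "vanishing z c 1 (\<lambda>y x. if z \<le> x then 0 else - measure M {x<..<y})"
      unfolding vanishing_def
    proof (intro conjI)
      show "\<forall>x\<in>I. (\<lambda>i. if z \<le> x then 0 else - measure M {x<..<c i}) \<longlonglongrightarrow> 0"
      proof
        fix x assume "x \<in> I"
        from tendsto_minus[OF lim[OF this]] show "(\<lambda>i. if z \<le> x then 0 else - measure M {x<..<c i}) \<longlonglongrightarrow> 0"
          by (cases "z \<le> x") simp_all
      qed
    qed (use m in auto)
    then show ?thesis
      by (rule vanishing_cong[THEN iffD2, rotated 2]) (rule r, assumption+, rule c(2))
  qed
qed

section \<open>The error f - g_y as a tower, and its sign\<close>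

lemma mono_F_plus:
  assumes "f \<in> F_plus I w k n" "k - 1 \<le> j" "j \<le> n" shows "mono_on I (wderiv I w f j)"
  using assms by (simp add: F_plus_def)

text \<open>R is the tower of f - g_tilde minus that of q. Its height is k - 1 because f^(k) need
  not exist for k = n + 1. The tower of q reaches level k, where it is 0, so at level k - 1 it is
  the constant \<open>\<theta> (k - 1) z\<close>.\<close>

lemma g_error_tower:
  assumes f: "f \<in> F_plus I w k n" and k: "1 \<le> k" "k \<le> n + 1"
    and LS: "is_LS (wderiv I w f n) (LS_measure I (wderiv I w f n))"
    and z: "left_end I < ereal z" "ereal z < right_end I" and y: "y \<in> knots z"
  defines "\<theta> \<equiv> \<lambda>i x. wderiv I w f i x -
      ((\<Sum>j\<in>F_idx I w k n. Lim (down_to_left_end I) (wderiv I w f j) * tint z (\<lambda>_. 0) (p_left k j) k i x) +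
       spline_part n (LS_measure I (wderiv I w f n)) y i x)"
  shows "\<exists>R. tower R (k - 1) \<and> (\<forall>i<k. R i z = 0) \<and> (\<forall>x\<in>I. R (k - 1) x = \<theta> (k - 1) x - \<theta> (k - 1) z) \<and>
    (\<forall>x\<in>I. f x - g_fun I w k n f z y x = w 0 x * R 0 x)"
proof -
  let ?G = "wderiv I w f" and ?M = "LS_measure I (wderiv I w f n)" and ?F = "F_idx I w k n"
  let ?L = "\<lambda>j. Lim (down_to_left_end I) (?G j)"
  let ?g = "g_tilde I w k n f z y"
  have zI: "z \<in> I" by (rule mem_if_strictly_between[OF z])
  have yI: "y \<in> I" "left_end I < ereal y" using y mem_if_le[OF _ _ zI] by (auto simp: knots_def)
  have yr: "ereal y < right_end I" using y z(2) le_less_trans[of "ereal y" "ereal z"] by (simp add: knots_def)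
  have G: "tower ?G n" using f by (intro tower_wderiv) (simp add: F_plus_def)
  have k1: "k - 1 < k" "k - 1 \<le> n" using k by simp_all
  have tP: "tower (tint z (\<lambda>_. 0) (p_left k j) k) (k - 1)" if "j \<in> ?F" for j
    by (rule tint_tower[OF zI p_left_regular[OF that]]) (use k1 in simp_all)
  have tS: "tower (spline_part n ?M y) (k - 1)"
    by (rule spline_part_tower[OF LS mono_F_plus[OF f] yI yr k1(2)]) (use k tower_RC[OF G] in auto)
  have "tower (\<lambda>i x. 1 * (\<Sum>j\<in>?F. ?L j * tint z (\<lambda>_. 0) (p_left k j) k i x) + 1 * spline_part n ?M y i x) (k - 1)"
    by (rule tower_lin[OF tower_sum[OF tP] tS])
  from tower_lin[OF tower_mono[OF G k1(2)] this, of 1 "-1"]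
  have t\<theta>: "tower \<theta> (k - 1)" unfolding \<theta>_def by (simp only: mult_1 mult_minus1 diff_conv_add_uminus)
  have gx: "?g x = w 0 x * ((\<Sum>j\<in>?F. ?L j * tint z (\<lambda>_. 0) (p_left k j) k 0 x) + spline_part n ?M y 0 x)"
    if x: "x \<in> I" for x
  proof -
    have "(\<Sum>j\<in>?F. ?L j * p_az I w z 0 k j x) = (\<Sum>j\<in>?F. ?L j * (w 0 x * tint z (\<lambda>_. 0) (p_left k j) k 0 x))"
      by (rule sum.cong) (auto simp: p_az_eq[OF zI _ _ x] F_idx_def)
    then show ?thesis
      unfolding g_tilde_def using LS_integral_p_plus[OF LS yI x, of n] w_spline_part[OF x, of 0 n ?M y]
      by (simp add: distrib_left sum_distrib_left mult.left_commute)
  qed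
  have fx: "f x = w 0 x * ?G 0 x" if "x \<in> I" for x using w_pos[OF that, of 0] by simp
  have fg: "f x - ?g x = w 0 x * \<theta> 0 x" if "x \<in> I" for x
    unfolding \<theta>_def using fx[OF that] gx[OF that] by (simp add: right_diff_distrib del: wderiv.simps)
  \<comment> \<open>These are the initial data in the description of \<open>q_fun\<close>. For i < k
    they are levels of the tower \<theta> of height k - 1, so \<open>wderiv_tower\<close> computes
    them.\<close>
  define c where "c = (\<lambda>i. wderiv I w (\<lambda>x. f x - ?g x) i z)"
  have c: "c i = \<theta> i z" if "i < k" for i
    using wderiv_tower[OF t\<theta>, of "\<lambda>x. f x - ?g x"] fg zI that unfolding c_def by simp
  let ?Q = "tint z c (\<lambda>_. 0) k"
  have tQ: "tower ?Q k" by (rule interpolating_P_le(2)[OF zI])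
  have q: "q_fun I w k n f z y = restrict (\<lambda>x. w 0 x * ?Q 0 x) I"
    unfolding q_fun_def using interpolating_P_le(1)[OF zI, of k c] by (simp only: c_def)
  define R where "R = (\<lambda>i x. 1 * \<theta> i x + (-1) * ?Q i x)"
  have "tower R (k - 1)"
    unfolding R_def by (rule tower_lin[OF t\<theta> tower_mono[OF tQ]]) simp
  moreover have "R i z = 0" if "i < k" for i using c[OF that] tint_at[OF that] by (simp add: R_def)
  moreover have "R (k - 1) x = \<theta> (k - 1) x - \<theta> (k - 1) z" if "x \<in> I" for x
    using tint_less[OF k1(1), of z c "\<lambda>_. 0" x] k c[OF k1(1)] by (simp add: R_def tint_k)
  moreover have "f x - g_fun I w k n f z y x = w 0 x * R 0 x" if "x \<in> I" for x
    using fg[OF that] that unfolding g_fun_def q R_def by (simp add: right_diff_distrib)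
  ultimately show ?thesis by blast
qed

lemma g_error_vanishing:
  assumes f: "f \<in> F_plus I w k n" and k: "1 \<le> k" "k \<le> n + 1"
    and rc: "\<And>x. n = 0 \<Longrightarrow> x \<in> I \<Longrightarrow> continuous (at x within I \<inter> {x..}) (wderiv I w f n)"
    and z: "left_end I < ereal z" "ereal z < right_end I"
    and c: "decseq c" "\<And>i. c i \<in> knots z" "\<And>y. left_end I < ereal y \<Longrightarrow> \<forall>\<^sub>F i in sequentially. c i < y"
  shows "vanishing z c k (\<lambda>y x. f x - g_fun I w k n f z y x)"
proof -
  let ?G = "wderiv I w f" and ?M = "LS_measure I (wderiv I w f n)"
  have zI: "z \<in> I" by (rule mem_if_strictly_between[OF z])
  have zz: "z \<in> knots z" using z by (simp add: knots_def)
  have G: "tower ?G n" using f by (intro tower_wderiv) (simp add: F_plus_def)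
  have mono: "mono_on I (?G n)" using mono_F_plus[OF f, of n] k by simp
  have cont: "continuous (at_right x) (?G n)" if x: "x \<in> I" "ereal x \<noteq> right_end I" for x
  \<comment> \<open>For n = 0 the function f^(0) = f / w_0 is a priori only Borel and monotone, and
    right-continuity is the assumption \<open>rc\<close>; for n > 0 it is part of f^(n) being in
    \<open>RC\<close>.\<close>
  proof (cases "n = 0")
    case True
    have "(?G n \<longlongrightarrow> ?G n x) (at x within I \<inter> {x..})" using rc[OF True x(1)] by (simp add: continuous_within)
    moreover have "at_right x \<le> at x within I \<inter> {x..}"
      using eventually_at_right_mem[OF x]
      by (auto simp: at_within_def le_inf_iff le_principal eventually_inf_principal elim: eventually_mono)
    ultimately show ?thesis unfolding continuous_within by (rule filterlim_mono[OF _ order_refl])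
  next
    case False
    then show ?thesis using tower_RC[OF G, of n] x by (simp add: RC_def)
  qed
  have LS: "is_LS (?G n) ?M" by (rule LS_measure_is_LS[OF mono cont])
  define \<theta> where "\<theta> = (\<lambda>y i x. ?G i x -
      ((\<Sum>j\<in>F_idx I w k n. Lim (down_to_left_end I) (?G j) * tint z (\<lambda>_. 0) (p_left k j) k i x) +
       spline_part n ?M y i x))"
  have "\<forall>y. \<exists>R. y \<in> knots z \<longrightarrow> tower R (k - 1) \<and> (\<forall>i<k. R i z = 0) \<and>
      (\<forall>x\<in>I. R (k - 1) x = \<theta> y (k - 1) x - \<theta> y (k - 1) z) \<and>
      (\<forall>x\<in>I. f x - g_fun I w k n f z y x = w 0 x * R 0 x)"
    unfolding \<theta>_def using g_error_tower[OF f k LS z] by blast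
  then obtain R where R: "\<And>y. y \<in> knots z \<Longrightarrow> tower (R y) (k - 1)" "\<And>y i. y \<in> knots z \<Longrightarrow> i < k \<Longrightarrow> R y i z = 0"
    "\<And>y x. y \<in> knots z \<Longrightarrow> x \<in> I \<Longrightarrow> R y (k - 1) x = \<theta> y (k - 1) x - \<theta> y (k - 1) z"
    "\<And>y x. y \<in> knots z \<Longrightarrow> x \<in> I \<Longrightarrow> f x - g_fun I w k n f z y x = w 0 x * R y 0 x"
    by metis
  have "vanishing z c 1 (\<lambda>y x. \<theta> y (k - 1) x - \<theta> y (k - 1) z)"
    unfolding \<theta>_def by (rule spline_error_vanishing[OF G k mono_F_plus[OF f] LS cont z c])
  then have "vanishing z c 1 (\<lambda>y. R y (k - 1))"
    by (rule vanishing_cong[THEN iffD1, rotated 2]) (rule R(3)[symmetric], assumption+, rule c(2))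
  \<comment> \<open>The k - 1 integrations from level k - 1 to level 0 raise the exponent from 1 to
    k.\<close>
  then have "vanishing z c (1 + (k - 1 - 0)) (\<lambda>y. R y 0)"
    by (intro vanishing_tower R(1) zI zz c(2)) (auto intro: R(2))
  then have v: "vanishing z c k (\<lambda>y. R y 0)" using k by simp
  have "vanishing z c k (\<lambda>y x. w 0 x * R y 0 x)"
    unfolding vanishing_def
  proof (intro conjI ballI impI)
    fix x assume x: "x \<in> I" "z \<le> x"
    fix y y' assume y: "y \<in> knots z" "y' \<in> knots z" "y \<le> y'"
    have "0 \<le> R y 0 x" "R y 0 x \<le> R y' 0 x" using v x y unfolding vanishing_def by blast+
    then show "0 \<le> w 0 x * R y 0 x" "w 0 x * R y 0 x \<le> w 0 x * R y' 0 x"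
      using w_pos[OF x(1), of 0] by simp_all
  next
    fix x assume x: "x \<in> I" "x \<le> z"
    fix y y' assume y: "y \<in> knots z" "y' \<in> knots z" "y \<le> y'"
    have "0 \<le> (-1) ^ k * R y 0 x" "(-1) ^ k * R y 0 x \<le> (-1) ^ k * R y' 0 x"
      using v x y unfolding vanishing_def by blast+
    then have "0 \<le> w 0 x * ((-1) ^ k * R y 0 x)" "w 0 x * ((-1) ^ k * R y 0 x) \<le> w 0 x * ((-1) ^ k * R y' 0 x)"
      using w_pos[OF x(1), of 0] by (simp_all only: mult_left_mono less_imp_le mult_nonneg_nonneg)
    then show "0 \<le> (-1) ^ k * (w 0 x * R y 0 x)" "(-1) ^ k * (w 0 x * R y 0 x) \<le> (-1) ^ k * (w 0 x * R y' 0 x)"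
      by (simp_all only: mult.left_commute)
  next
    fix x assume "x \<in> I"
    then have "(\<lambda>i. R (c i) 0 x) \<longlonglongrightarrow> 0" using v unfolding vanishing_def by blast
    then show "(\<lambda>i. w 0 x * R (c i) 0 x) \<longlonglongrightarrow> 0" by (rule tendsto_mult_right_zero)
  qed
  then show ?thesis
    by (rule vanishing_cong[THEN iffD2, rotated 2]) (rule R(4), assumption+, rule c(2))
qed

end

theorem theorem4p6:
  fixes I :: "real set" and w :: "nat \<Rightarrow> real \<Rightarrow> real" and f :: "real \<Rightarrow> real"
    and k n :: nat and z :: real
  assumes "is_interval I" and "\<exists>x\<in>I. \<exists>y\<in>I. x < y"
    and "\<And>j. w j \<in> Bor_pos I"
    and "\<And>j K. compact K \<Longrightarrow> K \<subseteq> I \<Longrightarrow> bounded (w j ` K)"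
    and "1 \<le> k" and "k \<le> n + 1"
    and "f \<in> F_plus I w k n"
    and "\<And>x. n = 0 \<Longrightarrow> x \<in> I \<Longrightarrow> continuous (at x within I \<inter> {x..}) (wderiv I w f n)"
    and "left_end I < ereal z" and "ereal z < right_end I"
  shows "(\<forall>x\<in>I. z \<le> x \<longrightarrow>
            antimono_on {y. left_end I < ereal y \<and> y \<le> z} (\<lambda>y. g_fun I w k n f z y x) \<and>
            ((\<lambda>y. g_fun I w k n f z y x) \<longlongrightarrow> f x) (down_to_left_end I)) \<and>
         (\<forall>x\<in>I. x \<le> z \<longrightarrow>
            mono_on {y. left_end I < ereal y \<and> y \<le> z} (\<lambda>y. (-1) ^ k * (f x - g_fun I w k n f z y x)) \<and>
            ((\<lambda>y. (-1) ^ k * (f x - g_fun I w k n f z y x)) \<longlongrightarrow> 0) (down_to_left_end I))"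
proof -
  interpret gauged_interval I w
    by unfold_locales (use assms in auto)
  let ?r = "\<lambda>y x. f x - g_fun I w k n f z y x"
  obtain c d where c: "decseq c" "\<And>i. left_end I < ereal (c i)" "\<And>i. c i \<le> z"
    "\<And>y. left_end I < ereal y \<Longrightarrow> \<forall>\<^sub>F i in sequentially. c i < y"
    using approximating_sequences[OF assms(9,10)] by metis
  have v: "vanishing z c k ?r"
    by (rule g_error_vanishing[OF assms(7,5,6,8,9,10) c(1) _ c(4)]) (simp_all add: knots_def c)
  have lim: "(\<lambda>i. ?r (c i) x) \<longlonglongrightarrow> 0" if "x \<in> I" for x using v that unfolding vanishing_def by blast
  have tendsto: "(h \<longlongrightarrow> l) (down_to_left_end I)"
    if "mono_on {y. left_end I < ereal y \<and> y \<le> z} h" "(\<lambda>i. h (c i)) \<longlonglongrightarrow> l" for h :: "real \<Rightarrow> real" and l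
    by (rule tendsto_down_mono[OF that(1) c(2,3) _ that(2)]) (rule c(4))
  show ?thesis
  proof (intro conjI ballI impI)
    fix x assume x: "x \<in> I" "z \<le> x"
    \<comment> \<open>An error that is nondecreasing in y amounts to values g_y(x) that grow as y
      decreases.\<close>
    have "?r y x \<le> ?r y' x" if "y \<in> knots z" "y' \<in> knots z" "y \<le> y'" for y y'
      using v x that unfolding vanishing_def by blast
    then have m: "mono_on {y. left_end I < ereal y \<and> y \<le> z} (\<lambda>y. ?r y x)"
      by (auto simp: mono_on_def knots_def)
    then show "antimono_on {y. left_end I < ereal y \<and> y \<le> z} (\<lambda>y. g_fun I w k n f z y x)"
      by (simp add: monotone_on_def)
    have "((\<lambda>y. f x - ?r y x) \<longlongrightarrow> f x - 0) (down_to_left_end I)"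
      by (intro tendsto_diff tendsto_const tendsto[OF m lim[OF x(1)]])
    then show "((\<lambda>y. g_fun I w k n f z y x) \<longlongrightarrow> f x) (down_to_left_end I)" by simp
  next
    fix x assume x: "x \<in> I" "x \<le> z"
    have "(-1) ^ k * ?r y x \<le> (-1) ^ k * ?r y' x" if "y \<in> knots z" "y' \<in> knots z" "y \<le> y'" for y y'
      using v x that unfolding vanishing_def by blast
    then show m: "mono_on {y. left_end I < ereal y \<and> y \<le> z} (\<lambda>y. (-1) ^ k * ?r y x)"
      by (auto simp: mono_on_def knots_def)
    show "((\<lambda>y. (-1) ^ k * ?r y x) \<longlongrightarrow> 0) (down_to_left_end I)"
      by (rule tendsto[OF m tendsto_mult_right_zero[OF lim[OF x(1)]]])
  qed
qed

end
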